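(* Let $d,d'\ge2$ and let $L_1$ and $L_2$ be a pair of $2$-component oriented links with $P(L_1)=P(L_2)$. Then $\Theta_d(L_1)=\Theta_d(L_2)$ if and only if $\Theta_{d'}(L_1)=\Theta_{d'}(L_2)$.
   Context: The Yokonuma--Hecke algebra $Y_{d,n}(q)$ ($q\in\mathbb{C}\setminus\{0\}$) is the $\mathbb{C}$-algebra generated by $g_1,\dots,g_{n-1},t_1,\dots,t_n$ with relations: $g_ig_jg_i=g_jg_ig_j$ for $|i-j|=1$; $g_ig_j=g_jg_i$ for $|i-j|>1$; $t_it_j=t_jt_i$; $t_jg_i=g_it_{s_i(j)}$ where $s_i=(i,i+1)$; $t_j^d=1$; and $g_i^2=1+(q-q^{-1})e_ig_i$, where $e_i=\frac1d\sum_{s=0}^{d-1}t_i^st_{i+1}^{d-s}$. Set $Y_{d,0}(q)=\mathbb{C}$; there are natural inclusions $Y_{d,n}(q)\subset Y_{d,n+1}(q)$. Let $D=\mathbb{Z}/d\mathbb{Z}$, $E_D=1/d$. The trace $\mathrm{tr}_{d,D}:\bigcup_{n}Y_{d,n}(q)\to\mathbb{C}[z]$ is the unique linear map with, for $a,b\in Y_{d,n}(q)$: $\mathrm{tr}_{d,D}(ab)=\mathrm{tr}_{d,D}(ba)$; $\mathrm{tr}_{d,D}(1)=1$; $\mathrm{tr}_{d,D}(ag_n)=z\,\mathrm{tr}_{d,D}(a)$; $\mathrm{tr}_{d,D}(at_{n+1}^k)=0$ for $1\le k\le d-1$. Set $\lambda_D=\frac{z-(q-q^{-1})E_D}{z}$,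 $\Lambda_D=\frac{1}{z\sqrt{\lambda_D}}$. For a braid $\alpha\in B_n$ with closure $\widehat\alpha$ and exponent sum $\epsilon(\alpha)$, $\Theta_d(\widehat\alpha)=\Lambda_D^{n-1}(\sqrt{\lambda_D})^{\epsilon(\alpha)}\mathrm{tr}_{d,D}(\alpha)$, where $\mathrm{tr}_{d,D}(\alpha)$ is the trace of the image of $\alpha$ under $\sigma_i\mapsto g_i$; this is an isotopy invariant of oriented links. $P=\Theta_1$ is the Homflypt polynomial. These are $2$-variable invariants: equality of values means equality as functions of $(q,z)$, equivalently of $(q,\lambda_D)$ via $z=\frac{(q-q^{-1})E_D}{1-\lambda_D}$. *)

theory Defs
  imports
    "HOL-Analysis.Analysis"
    "HOL-Computational_Algebra.Polynomial"
    "HOL-Library.Poly_Mapping"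
    "HOL-Library.FuncSet"
    "HOL-Combinatorics.Transposition"
    "HOL-Algebra.QuotRing"
begin

text \<open>
  Lists form the free monoid, written additively because the convolution product of
  \<^typ>\<open>'a \<Rightarrow>\<^sub>0 'b\<close> is over an additive monoid of exponents. Hence
  \<open>'x list \<Rightarrow>\<^sub>0 complex\<close> is the free associative unital
  complex algebra on \<open>'x\<close>.
\<close>

instantiation list :: (type) monoid_add
begin
definition zero_list :: "'a list" where "zero_list = []"
definition plus_list :: "'a list \<Rightarrow> 'a list \<Rightarrow> 'a list" where "plus_list = (@)"
instance by standard (simp_all add: zero_list_def plus_list_def)
end

section \<open>The Yokonuma--Hecke algebra\<close>

datatype yh_gen = G nat | T nat

type_synonym yh_poly = "yh_gen list \<Rightarrow>\<^sub>0 complex"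

definition yh_const :: "complex \<Rightarrow> yh_poly" where
  "yh_const c = Poly_Mapping.single [] c"

definition yg :: "nat \<Rightarrow> yh_poly" where
  "yg i = Poly_Mapping.single [G i] 1"

definition yt :: "nat \<Rightarrow> yh_poly" where
  "yt j = Poly_Mapping.single [T j] 1"

definition yh_gens :: "nat \<Rightarrow> yh_gen set" where
  "yh_gens n = {G i | i. 1 \<le> i \<and> i < n} \<union> {T j | j. 1 \<le> j \<and> j \<le> n}"

definition yh_free :: "nat \<Rightarrow> yh_poly ring" where
  "yh_free n = \<lparr>carrier = {x. \<forall>w \<in> Poly_Mapping.keys x. set w \<subseteq> yh_gens n},
     mult = (*), one = 1, zero = 0, add = (+)\<rparr>"

definition ye :: "nat \<Rightarrow> nat \<Rightarrow> yh_poly" where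
  "ye d i = yh_const (1 / of_nat d) * (\<Sum>s<d. yt i ^ s * yt (i + 1) ^ (d - s))"

definition yh_relations :: "nat \<Rightarrow> complex \<Rightarrow> nat \<Rightarrow> yh_poly set" where
  "yh_relations d q n =
     {yg i * yg j * yg i - yg j * yg i * yg j | i j.
        i \<in> {1..<n} \<and> j \<in> {1..<n} \<and> \<bar>int i - int j\<bar> = 1}
   \<union> {yg i * yg j - yg j * yg i | i j.
        i \<in> {1..<n} \<and> j \<in> {1..<n} \<and> \<bar>int i - int j\<bar> > 1}
   \<union> {yt i * yt j - yt j * yt i | i j. i \<in> {1..n} \<and> j \<in> {1..n}}
   \<union> {yt j * yg i - yg i * yt (Transposition.transpose i (i + 1) j) | i j. i \<in> {1..<n} \<and> j \<in> {1..n}}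
   \<union> {yt j ^ d - 1 | j. j \<in> {1..n}}
   \<union> {yg i ^ 2 - (1 + yh_const (q - inverse q) * ye d i * yg i) | i. i \<in> {1..<n}}"

definition yh_ideal :: "nat \<Rightarrow> complex \<Rightarrow> nat \<Rightarrow> yh_poly set" where
  "yh_ideal d q n = genideal (yh_free n) (yh_relations d q n)"

text \<open>\<open>YH d q n\<close> is $Y_{d,n}(q)$; for \<open>n = 0\<close> it is $\mathbb{C}$.\<close>

definition YH :: "nat \<Rightarrow> complex \<Rightarrow> nat \<Rightarrow> yh_poly set ring" where
  "YH d q n = yh_free n Quot yh_ideal d q n"

definition yh_class :: "nat \<Rightarrow> complex \<Rightarrow> nat \<Rightarrow> yh_poly \<Rightarrow> yh_poly set" where
  "yh_class d q n x = yh_ideal d q n +>\<^bsub>yh_free n\<^esub> x"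

text \<open>The natural map from $Y_{d,n}(q)$ to $Y_{d,n+1}(q)$, sending the coset \<open>I\<^sub>n + x\<close>
  to the coset \<open>I\<^sub>n\<^sub>+\<^sub>1 + x\<close>.\<close>

definition yh_incl :: "nat \<Rightarrow> complex \<Rightarrow> nat \<Rightarrow> yh_poly set \<Rightarrow> yh_poly set" where
  "yh_incl d q n a = yh_ideal d q (Suc n) <+>\<^bsub>yh_free (Suc n)\<^esub> a"

section \<open>The trace\<close>

text \<open>
  A linear map on the union of the chain $Y_{d,0}(q) \subset Y_{d,1}(q) \subset \dots$ is a family
  of linear maps \<open>\<tau> n\<close> compatible with the inclusions. Values outside the
  carriers are fixed by extensionality, so that the family is unique as a function.
  The polynomial \<open>[:0, 1:]\<close> is the indeterminate $z$.
\<close>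

definition is_yh_trace ::
  "nat \<Rightarrow> complex \<Rightarrow> (nat \<Rightarrow> yh_poly set \<Rightarrow> complex poly) \<Rightarrow> bool" where
  "is_yh_trace d q \<tau> \<longleftrightarrow>
     (\<forall>n. \<tau> n \<in> extensional (carrier (YH d q n))) \<and>
     (\<forall>n. \<forall>a \<in> carrier (YH d q n). \<forall>b \<in> carrier (YH d q n).
        \<tau> n (a \<oplus>\<^bsub>YH d q n\<^esub> b) = \<tau> n a + \<tau> n b) \<and>
     (\<forall>n c. \<forall>a \<in> carrier (YH d q n).
        \<tau> n (yh_class d q n (yh_const c) \<otimes>\<^bsub>YH d q n\<^esub> a) = smult c (\<tau> n a)) \<and>
     (\<forall>n. \<forall>a \<in> carrier (YH d q n). \<tau> (Suc n) (yh_incl d q n a) = \<tau> n a) \<and>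
     (\<forall>n. \<forall>a \<in> carrier (YH d q n). \<forall>b \<in> carrier (YH d q n).
        \<tau> n (a \<otimes>\<^bsub>YH d q n\<^esub> b) = \<tau> n (b \<otimes>\<^bsub>YH d q n\<^esub> a)) \<and>
     (\<forall>n. \<tau> n \<one>\<^bsub>YH d q n\<^esub> = 1) \<and>
     (\<forall>n \<ge> 1. \<forall>a \<in> carrier (YH d q n).
        \<tau> (Suc n) (yh_incl d q n a \<otimes>\<^bsub>YH d q (Suc n)\<^esub> yh_class d q (Suc n) (yg n))
          = [:0, 1:] * \<tau> n a) \<and>
     (\<forall>n. \<forall>a \<in> carrier (YH d q n). \<forall>k \<in> {1..<d}.
        \<tau> (Suc n) (yh_incl d q n a \<otimes>\<^bsub>YH d q (Suc n)\<^esub> yh_class d q (Suc n) (yt (Suc n) ^ k)) = 0)"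

definition yh_trace :: "nat \<Rightarrow> complex \<Rightarrow> nat \<Rightarrow> yh_poly set \<Rightarrow> complex poly" where
  "yh_trace d q = (THE \<tau>. is_yh_trace d q \<tau>)"

section \<open>Braids\<close>

text \<open>Braids are given by words in the Artin generators and their inverses.\<close>

datatype braid_gen = Sigma nat | SigmaInv nat

fun braid_idx :: "braid_gen \<Rightarrow> nat" where
  "braid_idx (Sigma i) = i"
| "braid_idx (SigmaInv i) = i"

fun braid_sign :: "braid_gen \<Rightarrow> int" where
  "braid_sign (Sigma i) = 1"
| "braid_sign (SigmaInv i) = - 1"

definition braid_words :: "nat \<Rightarrow> braid_gen list set" where
  "braid_words n = {w. \<forall>x \<in> set w. braid_idx x \<in> {1..<n}}"

definition exponent_sum :: "braid_gen list \<Rightarrow> int" where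
  "exponent_sum w = (\<Sum>x\<leftarrow>w. braid_sign x)"

fun yh_braid_gen :: "nat \<Rightarrow> complex \<Rightarrow> nat \<Rightarrow> braid_gen \<Rightarrow> yh_poly set" where
  "yh_braid_gen d q n (Sigma i) = yh_class d q n (yg i)"
| "yh_braid_gen d q n (SigmaInv i) = inv\<^bsub>YH d q n\<^esub> (yh_class d q n (yg i))"

definition yh_braid :: "nat \<Rightarrow> complex \<Rightarrow> nat \<Rightarrow> braid_gen list \<Rightarrow> yh_poly set" where
  "yh_braid d q n w =
     foldr (\<lambda>x a. yh_braid_gen d q n x \<otimes>\<^bsub>YH d q n\<^esub> a) w \<one>\<^bsub>YH d q n\<^esub>"

section \<open>Oriented links and closed braids\<close>

text \<open>Euclidean 3-space is \<^typ>\<open>complex \<times> real\<close>.\<close>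

type_synonym space3 = "complex \<times> real"

text \<open>
  An oriented link with \<open>c\<close> components is an embedding of \<open>c\<close> disjoint copies of the
  unit circle, oriented by the counterclockwise orientation of the circle.
\<close>

definition oriented_link :: "nat \<Rightarrow> (nat \<times> complex \<Rightarrow> space3) \<Rightarrow> bool" where
  "oriented_link c L \<longleftrightarrow>
     (\<forall>i<c. continuous_on (sphere 0 1) (\<lambda>u. L (i, u))) \<and>
     inj_on L ({..<c} \<times> sphere 0 1)"

definition link_image :: "nat \<Rightarrow> (nat \<times> complex \<Rightarrow> space3) \<Rightarrow> space3 set" where
  "link_image c L = L ` ({..<c} \<times> sphere 0 1)"

definition ambient_isotopy :: "(real \<Rightarrow> space3 \<Rightarrow> space3) \<Rightarrow> bool" where
  "ambient_isotopy H \<longleftrightarrow>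
     continuous_on ({0..1} \<times> UNIV) (\<lambda>(t, x). H t x) \<and>
     (\<forall>t \<in> {0..1}. \<exists>h. homeomorphism UNIV UNIV (H t) h) \<and>
     H 0 = id"

text \<open>
  Closed braids wind counterclockwise around the axis \<open>{0} \<times> \<real>\<close>. One braid generator
  (\<open>None\<close> meaning none) acts while the angle runs through one sector, parametrized by
  \<open>s \<in> {0..1}\<close>; the strand entering at position \<open>j\<close> is at distance \<open>j\<close> from the axis.
  In a crossing one strand makes a bump into the upper half-space over the other;
  with the choice below \<open>Sigma i\<close> is a positive crossing.
\<close>

fun strand_radius :: "braid_gen option \<Rightarrow> nat \<Rightarrow> real \<Rightarrow> real" where
  "strand_radius None j s = real j"
| "strand_radius (Some x) j s =
     (1 - s) * real j + s * real (Transposition.transpose (braid_idx x) (braid_idx x + 1) j)"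

fun strand_height :: "braid_gen option \<Rightarrow> nat \<Rightarrow> real \<Rightarrow> real" where
  "strand_height None j s = 0"
| "strand_height (Some (Sigma i)) j s = (if j = i then sin (pi * s) else 0)"
| "strand_height (Some (SigmaInv i)) j s = (if j = i + 1 then sin (pi * s) else 0)"

text \<open>The appended crossingless sector makes the definition uniform in the empty word.\<close>

definition closed_braid :: "nat \<Rightarrow> braid_gen list \<Rightarrow> space3 set" where
  "closed_braid n w = (let v = map Some w @ [None]; m = length v in
     {(rcis (strand_radius (v ! k) j s) (2 * pi * (real k + s) / real m),
       strand_height (v ! k) j s) | k j s. k < m \<and> j \<in> {1..n} \<and> s \<in> {0..1}})"

text \<open>
  The oriented link \<open>L\<close> is isotopic to the closure of the braid \<open>w\<close> on \<open>n\<close> strands. The last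
  condition says that the isotopy carries the orientation of \<open>L\<close> to that of the closed braid,
  on which the angle around the axis increases.
\<close>

definition is_closure_of ::
  "nat \<Rightarrow> (nat \<times> complex \<Rightarrow> space3) \<Rightarrow> nat \<Rightarrow> braid_gen list \<Rightarrow> bool" where
  "is_closure_of c L n w \<longleftrightarrow>
     (\<exists>H. ambient_isotopy H \<and>
        H 1 ` link_image c L = closed_braid n w \<and>
        (\<forall>i<c. \<exists>\<phi> r h. continuous_on UNIV \<phi> \<and> strict_mono (\<phi> :: real \<Rightarrow> real) \<and>
           (\<forall>t. r t > 0 \<and> H 1 (L (i, cis t)) = (rcis (r t) (\<phi> t), h t))))"

section \<open>The invariants\<close>

definition theta_lambda :: "nat \<Rightarrow> complex \<Rightarrow> complex \<Rightarrow> complex" where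
  "theta_lambda d q z = (z - (q - inverse q) * (1 / of_nat d)) / z"

definition theta_Lambda :: "nat \<Rightarrow> complex \<Rightarrow> complex \<Rightarrow> complex" where
  "theta_Lambda d q z = 1 / (z * csqrt (theta_lambda d q z))"

definition theta_domain :: "nat \<Rightarrow> (complex \<times> complex) set" where
  "theta_domain d = {(q, z). q \<noteq> 0 \<and> z \<noteq> 0 \<and> theta_lambda d q z \<noteq> 0}"

text \<open>\<open>Theta d n \<alpha>\<close> is the value of $\Theta_d$ on the closure of \<open>\<alpha> \<in> B\<^sub>n\<close>, a function of
  \<open>(q, z)\<close>.\<close>

definition Theta :: "nat \<Rightarrow> nat \<Rightarrow> braid_gen list \<Rightarrow> complex \<times> complex \<Rightarrow> complex" where
  "Theta d n \<alpha> = restrict (\<lambda>(q, z).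
     theta_Lambda d q z ^ (n - 1) * csqrt (theta_lambda d q z) powi exponent_sum \<alpha>
       * poly (yh_trace d q n (yh_braid d q n \<alpha>)) z) (theta_domain d)"

definition homflypt :: "nat \<Rightarrow> braid_gen list \<Rightarrow> complex \<times> complex \<Rightarrow> complex" where
  "homflypt = Theta 1"

end

theory Submission
  imports Defs
begin

text \<open>
  Put \<open>h = q - 1/q\<close>. The idea is to compute the trace of a braid as a sum over colorings of its
  strands by \<open>d\<close> colors. Let \<open>V\<close> have a basis of pairs (color, label), and let \<open>g\<^sub>i\<close> act on the
  \<open>n\<close>-th tensor power of \<open>V\<close> by the type A R-matrix on two strands of equal color and by the flip
  on two strands of different colors, while \<open>t\<^sub>j\<close> multiplies by a root of unity that reads off the color.
  This respects all relations of the Yokonuma--Hecke algebra, and a suitably weighted trace of the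
  operators is \<open>tr\<^sub>d\<close> evaluated at a special value of \<open>z\<close>
  (\<open>word_trace_state_trace\<close>). A braid permutes the colors, so only colorings that are constant on the cycles
  of its permutation contribute, and a contribution depends only on which colors coincide. If there are
  at most two cycles, \<open>d\<close> colorings use one color and \<open>d (d - 1)\<close> use two, whence
  \<open>d\<^sup>n tr\<^sub>d(\<alpha>)(q, z/d) = d A + d (d - 1) B\<close> with \<open>A\<close> and \<open>B\<close> that do not involve \<open>d\<close>
  (\<open>trace_relation_two_cycles\<close>). The case \<open>d = 1\<close> identifies \<open>A\<close>. Since \<open>\<lambda>\<close> takes the same
  value for \<open>(d, q, z/d)\<close> as for \<open>(1, q, z)\<close>, and \<open>\<Lambda>\<close> only gains a factor \<open>d\<close>, this becomes
  \<open>\<Theta>\<^sub>d(q, z/d) = P(q, z) + (d - 1) R(q, z)\<close> (\<open>Theta_decomposition\<close>), where \<open>R\<close> is \<open>mixed_term\<close>.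
  So for links with the same Homflypt polynomial and any \<open>d \<ge> 2\<close>, equality of \<open>\<Theta>\<^sub>d\<close> means equality
  of \<open>R\<close>, a condition without \<open>d\<close>.

  The trace is defined by a description operator, so its existence and uniqueness have to be proved
  for every \<open>q\<close>. Both rest on one reduction (\<open>yh_functional_in_closed\<close>,
  \<open>word_trace_in_closed\<close>): the relations push every word to words of lower level, so the values of a
  trace lie in any set that contains the value at \<open>1\<close> and is closed under addition and under multiplication by
  \<open>h/d\<close> and \<open>z\<close>. Applied to a pair of traces and the diagonal it gives uniqueness. Applied
  to the state sums it shows that they are values of polynomials in \<open>h\<close> and \<open>d z\<close>. The points
  at which state sums are available are Zariski dense (\<open>eval2_eqI\<close>), so the polynomials inherit all trace
  identities, and they define the trace for all \<open>q\<close>, roots of unity included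
  (\<open>word_trace_trace_poly\<close>, \<open>yh_trace_eq\<close>).

  Topology enters only through the number of cycles: a coloring invariant under the permutation cuts the closed braid
  into disjoint closed sets, so every connected subset has a single color. As the closed braid is the
  union of two images of circles, there are at most two cycles (\<open>two_component_closure\<close>).
\<close>


section \<open>Functionals on words in the Yokonuma--Hecke generators\<close>

text \<open>
  The relations of the Yokonuma--Hecke algebra except the quadratic one equate monomials, so they generate a
  congruence on words. It is independent of \<open>q\<close>, which lets one derivation serve all parameters.
\<close>

inductive mono_eq :: "nat \<Rightarrow> nat \<Rightarrow> yh_gen list \<Rightarrow> yh_gen list \<Rightarrow> bool" for d n where
  refl: "w \<in> lists (yh_gens n) \<Longrightarrow> mono_eq d n w w"
| sym: "mono_eq d n w w' \<Longrightarrow> mono_eq d n w' w"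
| trans [trans]: "mono_eq d n w w' \<Longrightarrow> mono_eq d n w' w'' \<Longrightarrow> mono_eq d n w w''"
| append: "mono_eq d n u u' \<Longrightarrow> mono_eq d n v v' \<Longrightarrow> mono_eq d n (u @ v) (u' @ v')"
| braid: "1 \<le> i \<Longrightarrow> Suc i < n \<Longrightarrow> mono_eq d n [G i, G (Suc i), G i] [G (Suc i), G i, G (Suc i)]"
| far: "1 \<le> i \<Longrightarrow> Suc i < j \<Longrightarrow> j < n \<Longrightarrow> mono_eq d n [G i, G j] [G j, G i]"
| TT: "i \<in> {1..n} \<Longrightarrow> j \<in> {1..n} \<Longrightarrow> mono_eq d n [T i, T j] [T j, T i]"
| TG: "1 \<le> i \<Longrightarrow> i < n \<Longrightarrow> j \<in> {1..n} \<Longrightarrow>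
    mono_eq d n [T j, G i] [G i, T (Transposition.transpose i (Suc i) j)]"
| Tpow: "j \<in> {1..n} \<Longrightarrow> mono_eq d n (replicate d (T j)) []"

text \<open>
  These are the functionals on words whose linear extension annihilates the defining ideal, with
  \<open>c\<close> in the place of \<open>(q - 1/q) / d\<close>.
\<close>

definition yh_functional :: "nat \<Rightarrow> nat \<Rightarrow> complex \<Rightarrow> (yh_gen list \<Rightarrow> complex) \<Rightarrow> bool" where
  "yh_functional d n c f \<longleftrightarrow>
     (\<forall>w w'. mono_eq d n w w' \<longrightarrow> f w = f w') \<and>
     (\<forall>u \<in> lists (yh_gens n). \<forall>v \<in> lists (yh_gens n). \<forall>i \<in> {1..<n}.
        f (u @ [G i, G i] @ v) = f (u @ v) +
          c * (\<Sum>s<d. f (u @ replicate s (T i) @ replicate (d - s) (T (Suc i)) @ [G i] @ v)))"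

lemma G_in_gens [simp]: "G i \<in> yh_gens n \<longleftrightarrow> 1 \<le> i \<and> i < n"
  and T_in_gens [simp]: "T j \<in> yh_gens n \<longleftrightarrow> 1 \<le> j \<and> j \<le> n"
  by (auto simp: yh_gens_def)

lemma yh_gens_mono: "m \<le> n \<Longrightarrow> yh_gens m \<subseteq> yh_gens n"
  by (auto simp: yh_gens_def)

lemma yh_gens_0 [simp]: "yh_gens 0 = {}"
  by (auto simp: yh_gens_def)

lemma lists_gens_mono: "w \<in> lists (yh_gens m) \<Longrightarrow> m \<le> n \<Longrightarrow> w \<in> lists (yh_gens n)"
  using yh_gens_mono by (meson in_mono lists_mono)

lemma lists_gens_Suc [simp, intro]: "w \<in> lists (yh_gens m) \<Longrightarrow> w \<in> lists (yh_gens (Suc m))"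
  using lists_gens_mono by simp

lemma replicate_in_lists [simp]: "replicate k x \<in> lists A \<longleftrightarrow> k = 0 \<or> x \<in> A"
  by (induction k) auto

lemma transpose_range:
  "1 \<le> i \<Longrightarrow> i < n \<Longrightarrow> j \<in> {1..n::nat} \<Longrightarrow> Transposition.transpose i (Suc i) j \<in> {1..n}"
  by (auto simp: Transposition.transpose_def)

lemma mono_eq_lists:
  assumes "mono_eq d n w w'"
  shows "w \<in> lists (yh_gens n) \<and> w' \<in> lists (yh_gens n)"
  using assms
proof induction
  case (TG i j)
  then show ?case using transpose_range[of i n j] by simp
qed auto

lemma mono_eq_mono:
  assumes "mono_eq d m w w'" "m \<le> n"
  shows "mono_eq d n w w'"
  using assms(1)
proof induction
  case (refl w) then show ?case using assms(2) by (intro mono_eq.refl) (rule lists_gens_mono)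
next
  case (sym w w') show ?case by (rule mono_eq.sym, rule sym)
next
  case (trans w w' w'') show ?case by (rule mono_eq.trans, rule trans, rule trans)
next
  case (append u u' v v') show ?case by (rule mono_eq.append, rule append, rule append)
next
  case (braid i) then show ?case using assms(2) by (intro mono_eq.braid) auto
next
  case (far i j) then show ?case using assms(2) by (intro mono_eq.far) auto
next
  case (TT i j) then show ?case using assms(2) by (intro mono_eq.TT) auto
next
  case (TG i j) then show ?case using assms(2) by (intro mono_eq.TG) auto
next
  case (Tpow j) then show ?case using assms(2) by (intro mono_eq.Tpow) auto
qed

lemma mono_eq_context:
  assumes "mono_eq d n w w'" "u \<in> lists (yh_gens n)" "v \<in> lists (yh_gens n)"
  shows "mono_eq d n (u @ w @ v) (u @ w' @ v)"
  by (intro mono_eq.append mono_eq.refl assms)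

lemma yh_functional_mono_eq: "yh_functional d n c f \<Longrightarrow> mono_eq d n w w' \<Longrightarrow> f w = f w'"
  unfolding yh_functional_def by blast

lemma yh_functional_quadratic:
  "yh_functional d n c f \<Longrightarrow> u \<in> lists (yh_gens n) \<Longrightarrow> v \<in> lists (yh_gens n) \<Longrightarrow> i \<in> {1..<n} \<Longrightarrow>
    f (u @ [G i, G i] @ v) = f (u @ v) +
      c * (\<Sum>s<d. f (u @ replicate s (T i) @ replicate (d - s) (T (Suc i)) @ [G i] @ v))"
  unfolding yh_functional_def by blast

lemma yh_functional_context:
  assumes "yh_functional d n c f" "m \<le> n" "x \<in> lists (yh_gens n)" "y \<in> lists (yh_gens n)"
  shows "yh_functional d m c (\<lambda>w. f (x @ w @ y))"
  unfolding yh_functional_def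
proof (intro conjI allI impI ballI)
  fix w w' assume "mono_eq d m w w'"
  then have "mono_eq d n (x @ w @ y) (x @ w' @ y)"
    using mono_eq_context[OF mono_eq_mono[OF _ assms(2)] assms(3,4)] by blast
  then show "f (x @ w @ y) = f (x @ w' @ y)" using assms(1) yh_functional_mono_eq by blast
next
  fix u v i assume "u \<in> lists (yh_gens m)" "v \<in> lists (yh_gens m)" and i: "i \<in> {1..<m}"
  then have "u \<in> lists (yh_gens n)" "v \<in> lists (yh_gens n)"
    using assms(2) lists_gens_mono by auto
  then show "f (x @ (u @ [G i, G i] @ v) @ y) = f (x @ (u @ v) @ y) + c * (\<Sum>s<d.
      f (x @ (u @ replicate s (T i) @ replicate (d - s) (T (Suc i)) @ [G i] @ v) @ y))"
    using yh_functional_quadratic[OF assms(1), of "x @ u" "v @ y" i] assms i by simp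
qed

lemma gen_commutes_word:
  assumes "\<And>y. y \<in> yh_gens m \<Longrightarrow> mono_eq d n [x, y] [y, x]"
    and "w \<in> lists (yh_gens m)" "m \<le> n" "x \<in> yh_gens n"
  shows "mono_eq d n (x # w) (w @ [x])"
  using assms(2)
proof (induction w)
  case Nil then show ?case using assms by (auto intro: mono_eq.refl)
next
  case (Cons y w)
  have "mono_eq d n ([x, y] @ w) ([y, x] @ w)"
    using Cons assms lists_gens_mono by (intro mono_eq.append mono_eq.refl) auto
  also have "mono_eq d n ([y] @ (x # w)) ([y] @ (w @ [x]))"
    using Cons assms yh_gens_mono[OF assms(3)] by (intro mono_eq.append mono_eq.refl) auto
  hence "mono_eq d n ([y, x] @ w) ((y # w) @ [x])" by simp
  finally show ?case by simp
qed

lemma T_commutes_below: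
  assumes "w \<in> lists (yh_gens m)"
  shows "mono_eq d (Suc m) (T (Suc m) # w) (w @ [T (Suc m)])"
proof (rule gen_commutes_word[OF _ assms])
  fix y assume y: "y \<in> yh_gens m"
  show "mono_eq d (Suc m) [T (Suc m), y] [y, T (Suc m)]"
  proof (cases y)
    case (G i)
    then show ?thesis using y mono_eq.TG[of i "Suc m" "Suc m" d] by simp
  next
    case (T j)
    then show ?thesis using y mono_eq.TT[of "Suc m" "Suc m" j d] by simp
  qed
qed auto

lemma G_commutes_below:
  assumes "w \<in> lists (yh_gens m)"
  shows "mono_eq d (Suc (Suc m)) (G (Suc m) # w) (w @ [G (Suc m)])"
proof (rule gen_commutes_word[OF _ assms])
  fix y assume y: "y \<in> yh_gens m"
  show "mono_eq d (Suc (Suc m)) [G (Suc m), y] [y, G (Suc m)]"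
  proof (cases y)
    case (G i)
    then show ?thesis using y mono_eq.far[of i "Suc m" "Suc (Suc m)" d]
      by (auto intro: mono_eq.sym)
  next
    case (T j)
    then show ?thesis using y mono_eq.TG[of "Suc m" "Suc (Suc m)" j d]
      by (auto intro: mono_eq.sym)
  qed
qed auto

text \<open>
  The word \<open>w\<close> turns a letter \<open>x\<close> that passes it into \<open>y\<close>; iterating moves a power of \<open>x\<close>.
\<close>

lemma mono_eq_move_power:
  assumes "mono_eq d n (x # w) (w @ [y])" "x \<in> yh_gens n" "y \<in> yh_gens n"
  shows "mono_eq d n (replicate k x @ w) (w @ replicate k y)"
proof (induction k)
  case 0
  then show ?case using mono_eq_lists[OF assms(1)] by (auto intro: mono_eq.refl)
next
  case (Suc k)
  have "mono_eq d n ([x] @ (replicate k x @ w)) ([x] @ (w @ replicate k y))"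
    using Suc assms by (intro mono_eq.append[OF mono_eq.refl]) auto
  also have "mono_eq d n ((x # w) @ replicate k y) ((w @ [y]) @ replicate k y)"
    using assms by (intro mono_eq.append[OF _ mono_eq.refl]) auto
  hence "mono_eq d n ([x] @ w @ replicate k y) (w @ replicate (Suc k) y)" by simp
  finally show ?case by simp
qed

text \<open>
  Values depend on a parameter \<open>p\<close>, so that one statement covers a whole family of functionals; the
  closure properties are those that the coefficients of the relations call for.
\<close>

definition closed_under :: "('p \<Rightarrow> complex) \<Rightarrow> ('p \<Rightarrow> complex) set \<Rightarrow> bool" where
  "closed_under c S \<longleftrightarrow> (\<lambda>p. 0) \<in> S \<and> (\<forall>f\<in>S. \<forall>g\<in>S. (\<lambda>p. f p + g p) \<in> S) \<and>
     (\<forall>f\<in>S. (\<lambda>p. c p * f p) \<in> S)"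

lemma closed_under_sum:
  fixes k :: nat
  assumes "closed_under c S" "\<And>s. s < k \<Longrightarrow> f s \<in> S"
  shows "(\<lambda>p. \<Sum>s<k. f s p) \<in> S"
  using assms(2)
proof (induction k)
  case (Suc k)
  then have "(\<lambda>p. \<Sum>s<k. f s p) \<in> S" "f k \<in> S" by auto
  then show ?case using assms(1) unfolding closed_under_def by simp
qed (use assms(1) in \<open>simp add: closed_under_def\<close>)

text \<open>
  This is the dual form of the fact that \<open>Y\<^sub>n\<^sub>+\<^sub>1\<close> is spanned by \<open>Y\<^sub>n g\<^sub>n Y\<^sub>n\<close> and the \<open>Y\<^sub>n t\<^sub>n\<^sub>+\<^sub>1\<^sup>k\<close>: it suffices that this
  span is stable under left multiplication by a generator. The only case that needs more than commutations and \<open>t\<^sup>d = 1\<close> is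
  \<open>g\<^sub>n a g\<^sub>n b\<close>, where the same description of \<open>a \<in> Y\<^sub>n\<close>, one level down, reduces to the braid relation
  or to the quadratic relation. Working with functionals instead of linear combinations keeps the argument on single words.
\<close>

lemma yh_functional_in_closed:
  fixes c :: "'p \<Rightarrow> complex" and f :: "yh_gen list \<Rightarrow> 'p \<Rightarrow> complex"
  assumes S: "closed_under c S" and d: "d \<ge> 1"
    and "\<And>p. yh_functional d (Suc n) (c p) (\<lambda>w. f w p)"
    and "\<And>a b. n \<ge> 1 \<Longrightarrow> a \<in> lists (yh_gens n) \<Longrightarrow> b \<in> lists (yh_gens n) \<Longrightarrow> f (a @ [G n] @ b) \<in> S"
    and "\<And>a k. a \<in> lists (yh_gens n) \<Longrightarrow> k < d \<Longrightarrow> f (a @ replicate k (T (Suc n))) \<in> S"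
    and "w \<in> lists (yh_gens (Suc n))"
  shows "f w \<in> S"
  using assms(3-6)
proof (induction n arbitrary: f w)
  case 0
  note f = 0(1) and T = 0(3)
  have "w = replicate (length w) (T 1)"
    using 0(4) by (intro replicate_eqI[symmetric, THEN HOL.sym]) (auto simp: in_lists_conv_set yh_gens_def)
  moreover have "f (replicate k (T 1)) \<in> S" for k
  proof (induction k rule: less_induct)
    case (less k)
    show ?case
    proof (cases "k < d")
      case True then show ?thesis using T[of "[]" k] by simp
    next
      case False
      have "mono_eq d (Suc 0) (replicate d (T 1) @ replicate (k - d) (T 1)) ([] @ replicate (k - d) (T 1))"
        by (intro mono_eq.append mono_eq.refl mono_eq.Tpow) auto
      then have "mono_eq d (Suc 0) (replicate k (T 1)) (replicate (k - d) (T 1))"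
        using False by (simp flip: replicate_add)
      then have "f (replicate k (T 1)) = f (replicate (k - d) (T 1))"
        using yh_functional_mono_eq[OF f] by blast
      then show ?thesis using less[of "k - d"] False d by simp
    qed
  qed
  ultimately show ?case by metis
next
  case (Suc m)
  let ?n = "Suc m" and ?W = "lists (yh_gens (Suc (Suc m)))"
  show ?case using Suc(2-)
  proof (induction w arbitrary: f)
    case Nil
    then show ?case using Nil(3)[of "[]" 0] d by simp
  next
    case (Cons x w)
    note f = Cons(2) and G = Cons(3) and T = Cons(4)
    have feq: "f w = f w'" if "mono_eq d (Suc ?n) w w'" for w w'
      using yh_functional_mono_eq[OF f that] by blast
    have x: "x \<in> yh_gens (Suc ?n)" and w: "w \<in> ?W" using Cons(5) by auto
    consider "x \<in> yh_gens ?n" | "x = T (Suc ?n)" | "x = G ?n"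
      using x by (cases x) (auto simp: le_Suc_eq less_Suc_eq)
    note x_cases = this
    have lhsG: "f (x # a @ [G ?n] @ b) \<in> S" if a: "a \<in> lists (yh_gens ?n)" and b: "b \<in> lists (yh_gens ?n)" for a b
      using x_cases
    proof cases
      case 1
      then show ?thesis using G[of "x # a" b] a b by simp
    next
      case 2
      have "mono_eq d (Suc ?n) ([] @ (x # a) @ [G ?n] @ b) ([] @ (a @ [x]) @ [G ?n] @ b)"
        using T_commutes_below[OF a] a b unfolding 2
        by (intro mono_eq_context) auto
      also have "mono_eq d (Suc ?n) (a @ [x, G ?n] @ b) (a @ [G ?n, T ?n] @ b)"
        using mono_eq.TG[of ?n "Suc ?n" "Suc ?n" d] a b unfolding 2 by (intro mono_eq_context) auto
      hence "mono_eq d (Suc ?n) ([] @ (a @ [x]) @ [G ?n] @ b) (a @ [G ?n, T ?n] @ b)" by simp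
      finally have "f (x # a @ [G ?n] @ b) = f (a @ [G ?n] @ (T ?n # b))" using feq by simp
      then show ?thesis using G[of a "T ?n # b"] a b by simp
    next
      case 3
      \<comment> \<open>The induction on the level applies to \<open>a\<close> alone, the two outer factors being a fixed context.\<close>
      define f' where "f' a = f ([G ?n] @ a @ ([G ?n] @ b))" for a
      have "f' a \<in> S"
      proof (rule Suc(1)[OF _ _ _ a])
        show "yh_functional d ?n (c p) (\<lambda>w. f' w p)" for p
          using yh_functional_context[OF f[of p], of ?n "[G ?n]" "[G ?n] @ b"] b
          by (simp add: f'_def lists_gens_mono)
      next
        fix y z assume m: "1 \<le> m" and y: "y \<in> lists (yh_gens m)" and z: "z \<in> lists (yh_gens m)"
        have y': "y \<in> lists (yh_gens ?n)" and z': "z \<in> lists (yh_gens ?n)" using y z by auto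
        \<comment> \<open>\<open>g\<^sub>n y g\<^sub>m z g\<^sub>n b = y g\<^sub>n g\<^sub>m g\<^sub>n z b = y g\<^sub>m g\<^sub>n g\<^sub>m z b\<close> for \<open>m = n - 1\<close>\<close>
        have "mono_eq d (Suc ?n) ([] @ (G ?n # y) @ [G m] @ z @ [G ?n] @ b)
            ([] @ (y @ [G ?n]) @ [G m] @ z @ [G ?n] @ b)"
          using y' z' b m G_commutes_below[OF y] by (intro mono_eq_context) auto
        also have "mono_eq d (Suc ?n) ((y @ [G ?n, G m]) @ (z @ [G ?n]) @ b)
            ((y @ [G ?n, G m]) @ (G ?n # z) @ b)"
          using y' z' b m G_commutes_below[OF z] by (intro mono_eq_context) (auto intro: mono_eq.sym)
        hence "mono_eq d (Suc ?n) ([] @ (y @ [G ?n]) @ [G m] @ z @ [G ?n] @ b)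
            (y @ [G ?n, G m, G ?n] @ z @ b)" by simp
        also have "mono_eq d (Suc ?n) (y @ [G ?n, G m, G ?n] @ z @ b) (y @ [G m, G ?n, G m] @ z @ b)"
          using y' z' b m mono_eq.braid[of m "Suc ?n" d]
          by (intro mono_eq_context) (auto intro: mono_eq.sym)
        finally have "f' (y @ [G m] @ z) = f ((y @ [G m]) @ [G ?n] @ ([G m] @ z @ b))"
          using feq by (simp add: f'_def)
        then show "f' (y @ [G m] @ z) \<in> S"
          using G[of "y @ [G m]" "[G m] @ z @ b"] y' z' b m by simp
      next
        fix y k assume y: "y \<in> lists (yh_gens m)" and k: "k < d"
        have y': "y \<in> lists (yh_gens ?n)" using y by auto
        \<comment> \<open>\<open>g\<^sub>n y t\<^sub>n\<^sup>k g\<^sub>n b = y t\<^sub>n\<^sub>+\<^sub>1\<^sup>k g\<^sub>n\<^sup>2 b\<close>, to which the quadratic relation applies\<close>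
        let ?t = "T ?n" and ?t' = "T (Suc ?n)" and ?g = "G ?n"
        have tg: "mono_eq d (Suc ?n) [?t, ?g] [?g, ?t']"
          using mono_eq.TG[of ?n "Suc ?n" ?n d] by simp
        have t'g: "mono_eq d (Suc ?n) [?t', ?g] [?g, ?t]"
          using mono_eq.TG[of ?n "Suc ?n" "Suc ?n" d] by simp
        have gt: "mono_eq d (Suc ?n) ([?g] @ replicate k ?t) (replicate k ?t' @ [?g])"
          using mono_eq_move_power[of d "Suc ?n" ?t' "[?g]" ?t k] t'g by (auto intro: mono_eq.sym)
        have "mono_eq d (Suc ?n) ([] @ (?g # y) @ replicate k ?t @ [?g] @ b)
            ([] @ (y @ [?g]) @ replicate k ?t @ [?g] @ b)"
          using y' b G_commutes_below[OF y] by (intro mono_eq_context) auto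
        also have "mono_eq d (Suc ?n) (y @ ([?g] @ replicate k ?t) @ [?g] @ b)
            (y @ (replicate k ?t' @ [?g]) @ [?g] @ b)"
          using y' b gt by (intro mono_eq_context) auto
        hence "mono_eq d (Suc ?n) ([] @ (y @ [?g]) @ replicate k ?t @ [?g] @ b)
            ((y @ replicate k ?t') @ [?g, ?g] @ b)" by simp
        finally have 1: "f' (y @ replicate k ?t) = f ((y @ replicate k ?t') @ [?g, ?g] @ b)"
          using feq by (simp add: f'_def)
        have 2: "f ((y @ replicate k ?t') @ [?g, ?g] @ b) = (\<lambda>p. f ((y @ replicate k ?t') @ b) p +
          c p * (\<Sum>s<d. f ((y @ replicate k ?t') @ replicate s ?t @ replicate (d - s) ?t' @ [?g] @ b) p))"
          by (intro ext yh_functional_quadratic[OF f]) (use y' b in auto)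
        have "mono_eq d (Suc ?n) (y @ (replicate k ?t' @ b) @ []) (y @ (b @ replicate k ?t') @ [])"
          using y' b mono_eq_move_power[OF T_commutes_below[OF b]] by (intro mono_eq_context) auto
        then have 3: "f ((y @ replicate k ?t') @ b) \<in> S"
          using feq T[of "y @ b" k] y' b k by simp
        have 4: "f ((y @ replicate k ?t') @ replicate s ?t @ replicate (d - s) ?t' @ [?g] @ b) \<in> S" for s
        proof -
          have a: "mono_eq d (Suc ?n) (replicate j ?t' @ [?g]) ([?g] @ replicate j ?t)" for j
            using mono_eq_move_power[of d "Suc ?n" ?t' "[?g]" ?t j] t'g by auto
          have "mono_eq d (Suc ?n) (y @ (replicate k ?t' @ replicate s ?t) @ replicate (d - s) ?t' @ [?g] @ b)
             (y @ (replicate s ?t @ replicate k ?t') @ replicate (d - s) ?t' @ [?g] @ b)"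
            using y' b mono_eq_move_power[OF T_commutes_below[of "replicate s ?t" ?n]]
            by (intro mono_eq_context) auto
          also have "mono_eq d (Suc ?n) ((y @ replicate s ?t) @ (replicate (k + (d - s)) ?t' @ [?g]) @ b)
            ((y @ replicate s ?t) @ ([?g] @ replicate (k + (d - s)) ?t) @ b)"
            using y' b a by (intro mono_eq_context) auto
          hence "mono_eq d (Suc ?n) (y @ (replicate s ?t @ replicate k ?t') @ replicate (d - s) ?t' @ [?g] @ b)
            ((y @ replicate s ?t) @ [?g] @ (replicate (k + (d - s)) ?t @ b))"
            by (simp add: replicate_add)
          finally have "f ((y @ replicate k ?t') @ replicate s ?t @ replicate (d - s) ?t' @ [?g] @ b)
             = f ((y @ replicate s ?t) @ [?g] @ (replicate (k + (d - s)) ?t @ b))"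
            using feq by simp
          then show ?thesis
            using G[of "y @ replicate s ?t" "replicate (k + (d - s)) ?t @ b"] y' b by simp
        qed
        show "f' (y @ replicate k ?t) \<in> S"
          using closed_under_sum[OF S, of d] 3 4 S unfolding 1 2 closed_under_def by simp
      qed
      then show ?thesis using 3 by (simp add: f'_def)
    qed
    have lhsT: "f (x # a @ replicate k (T (Suc ?n))) \<in> S" if a: "a \<in> lists (yh_gens ?n)" and k: "k < d" for a k
      using x_cases
    proof cases
      case 1
      then show ?thesis using T[of "x # a" k] a k by simp
    next
      case 2
      have "mono_eq d (Suc ?n) ([] @ (x # a) @ replicate k x) ([] @ (a @ [x]) @ replicate k x)"
        using T_commutes_below[OF a] a unfolding 2 by (intro mono_eq_context) auto
      then have eq: "f (x # a @ replicate k x) = f (a @ replicate (Suc k) x)" using feq by simp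
      show ?thesis
      proof (cases "Suc k < d")
        case True
        then show ?thesis using eq T[OF a, of "Suc k"] 2 by simp
      next
        case False
        then have "Suc k = d" using k by simp
        moreover have "mono_eq d (Suc ?n) (a @ replicate d x @ []) (a @ [] @ [])"
          using a unfolding 2 by (intro mono_eq_context mono_eq.Tpow) auto
        ultimately have "f (x # a @ replicate k x) = f a" using eq feq by simp
        then show ?thesis using T[OF a, of 0] 2 d by simp
      qed
    next
      case 3
      have "mono_eq d (Suc ?n) (replicate k (T (Suc ?n)) @ a) (a @ replicate k (T (Suc ?n)))"
        using mono_eq_move_power[OF T_commutes_below[OF a]] by auto
      then have "mono_eq d (Suc ?n) ([G ?n] @ (a @ replicate k (T (Suc ?n))) @ [])
          ([G ?n] @ (replicate k (T (Suc ?n)) @ a) @ [])"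
        by (intro mono_eq_context) (auto intro: mono_eq.sym)
      also have "mono_eq d (Suc ?n) ([] @ ([G ?n] @ replicate k (T (Suc ?n))) @ a)
          ([] @ (replicate k (T ?n) @ [G ?n]) @ a)"
        using a mono_eq_move_power[of d "Suc ?n" "T ?n" "[G ?n]" "T (Suc ?n)" k]
          mono_eq.TG[of ?n "Suc ?n" ?n d] by (intro mono_eq_context) (auto intro: mono_eq.sym)
      hence "mono_eq d (Suc ?n) ([G ?n] @ (replicate k (T (Suc ?n)) @ a) @ [])
          (replicate k (T ?n) @ [G ?n] @ a)" by simp
      finally have "f (x # a @ replicate k (T (Suc ?n))) = f (replicate k (T ?n) @ [G ?n] @ a)"
        using feq 3 by simp
      then show ?thesis using G[of "replicate k (T ?n)" a] a by simp
    qed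
    show ?case
    proof (rule Cons(1)[of "\<lambda>w. f (x # w)"])
      show "yh_functional d (Suc ?n) (c p) (\<lambda>w. f (x # w) p)" for p
        using yh_functional_context[OF f[of p], of "Suc ?n" "[x]" "[]"] x by simp
    qed (use lhsG lhsT w in auto)
  qed
qed

text \<open>
  The axioms of the trace, restricted to monomials and with values at one point \<open>(c, z)\<close>, where
  \<open>c = (q - 1/q) / d\<close>.
\<close>

definition word_trace :: "nat \<Rightarrow> complex \<Rightarrow> complex \<Rightarrow> (nat \<Rightarrow> yh_gen list \<Rightarrow> complex) \<Rightarrow> bool" where
  "word_trace d c z \<tau> \<longleftrightarrow>
    (\<forall>n. yh_functional d n c (\<tau> n)) \<and>
    (\<forall>n. \<forall>w \<in> lists (yh_gens n). \<tau> (Suc n) w = \<tau> n w) \<and>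
    (\<forall>n. \<forall>u \<in> lists (yh_gens n). \<forall>v \<in> lists (yh_gens n). \<tau> n (u @ v) = \<tau> n (v @ u)) \<and>
    (\<forall>n\<ge>1. \<forall>w \<in> lists (yh_gens n). \<tau> (Suc n) (w @ [G n]) = z * \<tau> n w) \<and>
    (\<forall>n. \<forall>w \<in> lists (yh_gens n). \<forall>k \<in> {1..<d}. \<tau> (Suc n) (w @ replicate k (T (Suc n))) = 0)"

lemma word_traceD:
  assumes "word_trace d c z \<tau>"
  shows "yh_functional d n c (\<tau> n)"
    and "w \<in> lists (yh_gens n) \<Longrightarrow> \<tau> (Suc n) w = \<tau> n w"
    and "u \<in> lists (yh_gens n) \<Longrightarrow> v \<in> lists (yh_gens n) \<Longrightarrow> \<tau> n (u @ v) = \<tau> n (v @ u)"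
    and "n \<ge> 1 \<Longrightarrow> w \<in> lists (yh_gens n) \<Longrightarrow> \<tau> (Suc n) (w @ [G n]) = z * \<tau> n w"
    and "w \<in> lists (yh_gens n) \<Longrightarrow> k \<in> {1..<d} \<Longrightarrow> \<tau> (Suc n) (w @ replicate k (T (Suc n))) = 0"
  using assms unfolding word_trace_def by simp_all

text \<open>
  Cyclicity turns \<open>a g\<^sub>n b\<close> into \<open>b a g\<^sub>n\<close>, so the Markov conditions express the values on the spanning words by values one
  level down.
\<close>

lemma word_trace_in_closed:
  fixes c z :: "'p \<Rightarrow> complex" and \<tau> :: "nat \<Rightarrow> yh_gen list \<Rightarrow> 'p \<Rightarrow> complex"
  assumes S: "closed_under c S" "closed_under z S" and d: "d \<ge> 1"
    and \<tau>: "\<And>p. word_trace d (c p) (z p) (\<lambda>n w. \<tau> n w p)"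
    and 1: "\<tau> 0 [] \<in> S"
    and "w \<in> lists (yh_gens n)"
  shows "\<tau> n w \<in> S"
  using assms(6)
proof (induction n arbitrary: w)
  case 0
  then show ?case using 1 by simp
next
  case (Suc n)
  show ?case
  proof (rule yh_functional_in_closed[OF S(1) d _ _ _ Suc(2)])
    show "yh_functional d (Suc n) (c p) (\<lambda>w. \<tau> (Suc n) w p)" for p
      by (rule word_traceD(1)[OF \<tau>])
  next
    fix a b assume n: "1 \<le> n" and ab: "a \<in> lists (yh_gens n)" "b \<in> lists (yh_gens n)"
    have "\<tau> (Suc n) (a @ [G n] @ b) p = z p * \<tau> n (b @ a) p" for p
      using word_traceD(3)[OF \<tau>[of p], of "a @ [G n]" "Suc n" b]
        word_traceD(4)[OF \<tau>[of p], of n "b @ a"] ab n by simp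
    then have "\<tau> (Suc n) (a @ [G n] @ b) = (\<lambda>p. z p * \<tau> n (b @ a) p)" by blast
    then show "\<tau> (Suc n) (a @ [G n] @ b) \<in> S"
      using S(2) Suc(1)[of "b @ a"] ab unfolding closed_under_def by simp
  next
    fix a k assume a: "a \<in> lists (yh_gens n)" and k: "k < d"
    show "\<tau> (Suc n) (a @ replicate k (T (Suc n))) \<in> S"
    proof (cases "k = 0")
      case True
      have "\<tau> (Suc n) a = \<tau> n a" using word_traceD(2)[OF \<tau> a] by blast
      then show ?thesis using True Suc(1)[OF a] by simp
    next
      case False
      then have "\<tau> (Suc n) (a @ replicate k (T (Suc n))) = (\<lambda>p. 0)"
        using word_traceD(5)[OF \<tau> a, of k] k by fastforce
      then show ?thesis using S unfolding closed_under_def by simp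
    qed
  qed
qed


section \<open>Colored state sums\<close>

text \<open>
  A state assigns to each strand position a pair of a color and a label. Operators act on all functions of states
  \<open>nat \<Rightarrow> nat \<times> nat\<close>; the finite sets of states on \<open>n\<close> strands appear only when traces are taken, so
  the number of strands never enters the definition of an operator.
\<close>

type_synonym state = "nat \<Rightarrow> nat \<times> nat"

definition swp :: "nat \<Rightarrow> (nat \<Rightarrow> 'a) \<Rightarrow> nat \<Rightarrow> 'a" where
  "swp i s = s \<circ> Transposition.transpose i (Suc i)"

lemma swp_apply [simp]:
  "swp i s i = s (Suc i)" "swp i s (Suc i) = s i" "j \<noteq> i \<Longrightarrow> j \<noteq> Suc i \<Longrightarrow> swp i s j = s j"
  by (simp_all add: swp_def)

lemma swp_swp [simp]: "swp i (swp i s) = s"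
  by (simp add: swp_def comp_assoc)

lemma swp_same: "s i = s (Suc i) \<Longrightarrow> swp i s = s"
  by (auto simp: swp_def Transposition.transpose_def fun_eq_iff)

lemma swp_braid: "swp (Suc i) (swp i (swp (Suc i) s)) = swp i (swp (Suc i) (swp i s))"
  by (auto simp: swp_def Transposition.transpose_def fun_eq_iff)

lemma swp_far: "Suc i < j \<Longrightarrow> swp i (swp j s) = swp j (swp i s)"
  by (auto simp: swp_def Transposition.transpose_def fun_eq_iff)

text \<open>
  On two strands of equal color this is the R-matrix of type A with eigenvalues \<open>q\<close> and \<open>- 1/q\<close>, on
  two strands of different colors it is the flip.
\<close>

definition Rop :: "complex \<Rightarrow> nat \<Rightarrow> (state \<Rightarrow> complex) \<Rightarrow> state \<Rightarrow> complex" where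
  "Rop q i \<psi> s = (if s i = s (Suc i) then q * \<psi> s else \<psi> (swp i s) +
     (if fst (s i) = fst (s (Suc i)) \<and> snd (s (Suc i)) < snd (s i) then (q - inverse q) * \<psi> s else 0))"

definition Rinv :: "complex \<Rightarrow> nat \<Rightarrow> (state \<Rightarrow> complex) \<Rightarrow> state \<Rightarrow> complex" where
  "Rinv q i \<psi> s = (if s i = s (Suc i) then inverse q * \<psi> s else \<psi> (swp i s) -
     (if fst (s i) = fst (s (Suc i)) \<and> snd (s i) < snd (s (Suc i)) then (q - inverse q) * \<psi> s else 0))"

definition unity_root :: "nat \<Rightarrow> complex" where
  "unity_root d = cis (2 * pi / real d)"

fun gen_op :: "nat \<Rightarrow> complex \<Rightarrow> yh_gen \<Rightarrow> (state \<Rightarrow> complex) \<Rightarrow> state \<Rightarrow> complex" where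
  "gen_op d q (G i) = Rop q i"
| "gen_op d q (T j) = (\<lambda>\<psi> s. unity_root d ^ fst (s j) * \<psi> s)"

definition word_op :: "nat \<Rightarrow> complex \<Rightarrow> yh_gen list \<Rightarrow> (state \<Rightarrow> complex) \<Rightarrow> state \<Rightarrow> complex" where
  "word_op d q w = foldr (gen_op d q) w"

lemma word_op_simps [simp]:
  "word_op d q [] = id" "word_op d q (x # w) = gen_op d q x \<circ> word_op d q w"
  "word_op d q (u @ v) = word_op d q u \<circ> word_op d q v"
  by (auto simp: word_op_def fun_eq_iff)

subsection \<open>Relations\<close>

text \<open>
  The cases are the possible coincidences among three neighbouring entries. A coincidence identifies some of the
  permuted states, and entries that coincide contribute \<open>q\<close> with \<open>q\<^sup>2 = 1 + h q\<close>; otherwise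
  both sides agree as polynomials in \<open>h\<close> for each order of the labels.
\<close>

lemma Rop_braid:
  assumes "q \<noteq> 0"
  shows "Rop q i (Rop q (Suc i) (Rop q i \<psi>)) s = Rop q (Suc i) (Rop q i (Rop q (Suc i) \<psi>)) s"
proof -
  obtain a1 a2 b1 b2 c1 c2 where abc: "s i = (a1, a2)" "s (Suc i) = (b1, b2)" "s (Suc (Suc i)) = (c1, c2)"
    by (metis prod.exhaust)
  define h where "h = q - inverse q"
  have qq: "q * (q * x) = x + h * (q * x)" for x
    using assms by (simp add: h_def algebra_simps)
  let ?x = "swp i" and ?y = "swp (Suc i)"
  note R = Rop_def h_def[symmetric]
  consider "s i = s (Suc i)" "s (Suc i) = s (Suc (Suc i))" | "s i = s (Suc i)" "s (Suc i) \<noteq> s (Suc (Suc i))"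
    | "s i \<noteq> s (Suc i)" "s (Suc i) = s (Suc (Suc i))" | "s i \<noteq> s (Suc i)" "s i = s (Suc (Suc i))"
    | "s i \<noteq> s (Suc i)" "s (Suc i) \<noteq> s (Suc (Suc i))" "s i \<noteq> s (Suc (Suc i))"
    by metis
  then show ?thesis
  proof cases
    case 1
    then show ?thesis by (simp add: R)
  next
    case 2
    then have "?x s = s" by (simp add: swp_same)
    moreover have "?x (?y (?x s)) = ?x (?y s)" "?y (?x (?y s)) = ?x (?y s)"
      using calculation by (simp_all add: swp_braid)
    ultimately show ?thesis using 2 abc by (auto simp: R qq algebra_simps)
  next
    case 3
    then have "?y s = s" by (simp add: swp_same)
    moreover have "?y (?x (?y s)) = ?y (?x s)" "?x (?y (?x s)) = ?y (?x s)"
      using calculation by (simp_all add: swp_braid[symmetric])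
    ultimately show ?thesis using 3 abc by (auto simp: R qq algebra_simps)
  next
    case 4
    have "?y (?x s) = ?x s" "?x (?y s) = ?y s" using 4 by (simp_all add: swp_same)
    then show ?thesis using 4 abc by (auto simp: R qq algebra_simps)
  next
    case 5
    then show ?thesis using abc
      by (cases "a1 = b1"; cases "b1 = c1"; cases "a1 = c1"; cases "a2 < b2"; cases "b2 < c2"; cases "a2 < c2";
          simp add: R swp_braid algebra_simps)
  qed
qed

lemma Rop_far:
  assumes "Suc i < j"
  shows "Rop q i (Rop q j \<psi>) s = Rop q j (Rop q i \<psi>) s"
proof -
  have "i \<noteq> j" "i \<noteq> Suc j" "Suc i \<noteq> j" "j \<noteq> Suc i" "j \<noteq> i" "Suc j \<noteq> i" "Suc j \<noteq> Suc i" "Suc i \<noteq> Suc j"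
    using assms by auto
  moreover have "swp i (swp j s) = swp j (swp i s)" using assms by (rule swp_far)
  ultimately show ?thesis by (simp add: Rop_def algebra_simps)
qed

text \<open>
  The diagonal part of the operator survives only between equal colors, where the transposition does not change the color.
\<close>

lemma Rop_color:
  "Rop q i (\<lambda>r. k (fst (r (Transposition.transpose i (Suc i) j))) * \<psi> r) s = k (fst (s j)) * Rop q i \<psi> s"
  by (cases "s i = s (Suc i)"; cases "j = i"; cases "j = Suc i") (simp_all add: Rop_def algebra_simps)

lemma unity_root_power_eq_iff:
  assumes "d \<ge> 1" "a < d" "b < d"
  shows "unity_root d ^ a = unity_root d ^ b \<longleftrightarrow> a = b"
proof -
  have "unity_root d ^ a = cis (2 * pi * real a / real d)" for a
    by (simp add: unity_root_def Complex.DeMoivre mult.commute mult.left_commute)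
  moreover have "inj_on (\<lambda>k. cis (2 * pi * real k / real d)) {..<d}"
    using Complex.bij_betw_roots_unity[of d] assms by (auto simp: bij_betw_def)
  ultimately show ?thesis using assms by (auto dest: inj_onD)
qed

lemma unity_root_power_d: "d \<ge> 1 \<Longrightarrow> unity_root d ^ d = 1"
  by (simp add: unity_root_def Complex.DeMoivre)

lemma unity_root_nonzero [simp]: "unity_root d \<noteq> 0"
  by (simp add: unity_root_def)

lemma sum_powers_root_of_unity:
  fixes x :: complex
  assumes "x ^ d = 1" "x \<noteq> 1"
  shows "(\<Sum>t<d. x ^ t) = 0"
  using assms by (simp add: geometric_sum)

text \<open>
  Orthogonality of characters of the cyclic group: \<open>e\<^sub>i\<close> acts as the projection to states with equal colors at
  \<open>i\<close> and \<open>i + 1\<close>.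
\<close>

lemma color_projector:
  assumes "d \<ge> 1" "a < d" "b < d"
  shows "(\<Sum>t<d. (unity_root d ^ a) ^ t * (unity_root d ^ b) ^ (d - t)) = (if a = b then of_nat d else 0)"
proof -
  let ?x = "unity_root d ^ a / unity_root d ^ b"
  have 1: "(unity_root d ^ b) ^ d = 1" for b
    using unity_root_power_d[OF assms(1)] by (metis power_commutes power_mult power_one mult.commute)
  have "(unity_root d ^ a) ^ t * (unity_root d ^ b) ^ (d - t) = ?x ^ t" if "t < d" for t
    using that 1[of b] by (simp add: power_diff power_divide)
  then have eq: "(\<Sum>t<d. (unity_root d ^ a) ^ t * (unity_root d ^ b) ^ (d - t)) = (\<Sum>t<d. ?x ^ t)"
    by simp
  show ?thesis
  proof (cases "a = b")
    case False
    then have "?x \<noteq> 1" using unity_root_power_eq_iff[OF assms] by simp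
    moreover have "?x ^ d = 1" using 1 by (simp add: power_divide)
    ultimately show ?thesis using sum_powers_root_of_unity[of ?x d] False eq by simp
  next
    case True
    show ?thesis unfolding eq by (simp add: True)
  qed
qed

lemma word_op_replicate_T:
  "word_op d q (replicate k (T j)) \<psi> s = (unity_root d ^ fst (s j)) ^ k * \<psi> s"
  by (induction k) auto

lemma word_op_color_projector:
  assumes "d \<ge> 1" "fst (s i) < d" "fst (s (Suc i)) < d"
  shows "(\<Sum>t<d. word_op d q (replicate t (T i) @ replicate (d - t) (T (Suc i))) \<psi> s)
     = (if fst (s i) = fst (s (Suc i)) then of_nat d * \<psi> s else 0)"
proof -
  have "(\<Sum>t<d. word_op d q (replicate t (T i) @ replicate (d - t) (T (Suc i))) \<psi> s)
    = (\<Sum>t<d. (unity_root d ^ fst (s i)) ^ t * (unity_root d ^ fst (s (Suc i))) ^ (d - t)) * \<psi> s"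
    by (simp add: word_op_replicate_T sum_distrib_right mult.assoc)
  then show ?thesis using color_projector[OF assms] by simp
qed

lemma Rop_quadratic:
  assumes "q \<noteq> 0"
  shows "Rop q i (Rop q i \<psi>) s = \<psi> s +
    (if fst (s i) = fst (s (Suc i)) then (q - inverse q) * Rop q i \<psi> s else 0)"
proof -
  define h where "h = q - inverse q"
  have qq: "q * (q * x) = x + h * (q * x)" for x
    using assms by (simp add: h_def algebra_simps)
  obtain a1 a2 b1 b2 where ab: "s i = (a1, a2)" "s (Suc i) = (b1, b2)"
    by (metis prod.exhaust)
  have "swp i s = s" if "s i = s (Suc i)" using that by (rule swp_same)
  then show ?thesis using ab
    by (cases "a1 = b1"; cases "a2 < b2"; cases "a2 = b2"; simp add: Rop_def h_def[symmetric] qq algebra_simps)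
qed

lemma Rinv_eq:
  assumes "q \<noteq> 0"
  shows "Rinv q i \<psi> s = Rop q i \<psi> s - (if fst (s i) = fst (s (Suc i)) then (q - inverse q) * \<psi> s else 0)"
proof -
  obtain a1 a2 b1 b2 where ab: "s i = (a1, a2)" "s (Suc i) = (b1, b2)"
    by (metis prod.exhaust)
  then show ?thesis
    by (cases "a1 = b1"; cases "a2 < b2"; cases "a2 = b2"; simp add: Rop_def Rinv_def algebra_simps)
qed

subsection \<open>Symmetric operators and their traces\<close>

text \<open>
  The second condition says that the operator relates only states that differ by a permutation
  of the positions \<open>1, \<dots>, n\<close>: it commutes with multiplication by symmetric functions. Indicator functions of
  stable sets are among these, so the operator also restricts to such sets.
\<close>

definition sym_op :: "nat \<Rightarrow> ((state \<Rightarrow> complex) \<Rightarrow> state \<Rightarrow> complex) \<Rightarrow> bool" where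
  "sym_op n F \<longleftrightarrow>
    (\<forall>\<psi> \<phi>. F (\<lambda>r. \<psi> r + \<phi> r) = (\<lambda>s. F \<psi> s + F \<phi> s)) \<and>
    (\<forall>\<kappa> \<psi>. (\<forall>s. \<forall>i\<in>{1..<n}. \<kappa> (swp i s) = \<kappa> s) \<longrightarrow> F (\<lambda>r. \<kappa> r * \<psi> r) = (\<lambda>s. \<kappa> s * F \<psi> s))"

lemma sym_op_comp: "sym_op n F \<Longrightarrow> sym_op n H \<Longrightarrow> sym_op n (F \<circ> H)"
  unfolding sym_op_def by simp

lemma sym_op_Rop: "1 \<le> i \<Longrightarrow> i < n \<Longrightarrow> sym_op n (Rop q i)"
  unfolding sym_op_def by (auto simp: Rop_def fun_eq_iff algebra_simps)

lemma sym_op_foldr: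
  assumes "\<And>x. x \<in> set w \<Longrightarrow> sym_op n (F x)"
  shows "sym_op n (foldr F w)"
  using assms
proof (induction w)
  case Nil
  then show ?case by (simp add: sym_op_def)
next
  case (Cons x w)
  then have "sym_op n (F x \<circ> foldr F w)" by (intro sym_op_comp) auto
  then show ?case by (simp add: comp_def)
qed

lemma sym_op_word_op: "w \<in> lists (yh_gens n) \<Longrightarrow> sym_op n (word_op d q w)"
  unfolding word_op_def
proof (rule sym_op_foldr)
  fix x assume "w \<in> lists (yh_gens n)" "x \<in> set w"
  then have "x \<in> yh_gens n" by (simp add: in_lists_conv_set)
  then show "sym_op n (gen_op d q x)"
    by (cases x) (auto simp: sym_op_Rop, auto simp: sym_op_def fun_eq_iff algebra_simps)
qed

lemma sym_op_add: "sym_op n F \<Longrightarrow> F (\<lambda>r. \<psi> r + \<phi> r) s = F \<psi> s + F \<phi> s"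
  unfolding sym_op_def by simp

lemma sym_op_weight:
  "sym_op n F \<Longrightarrow> (\<And>s i. i \<in> {1..<n} \<Longrightarrow> \<kappa> (swp i s) = \<kappa> s) \<Longrightarrow> F (\<lambda>r. \<kappa> r * \<psi> r) s = \<kappa> s * F \<psi> s"
  unfolding sym_op_def by simp

lemma sym_op_scale: "sym_op n F \<Longrightarrow> F (\<lambda>r. c * \<psi> r) s = c * F \<psi> s"
  using sym_op_weight[of n F "\<lambda>_. c"] by simp

lemma sym_op_cong:
  assumes F: "sym_op n F" and X: "\<And>s i. s \<in> X \<Longrightarrow> i \<in> {1..<n} \<Longrightarrow> swp i s \<in> X"
    and eq: "\<And>r. r \<in> X \<Longrightarrow> \<psi> r = \<phi> r" and s: "s \<in> X"
  shows "F \<psi> s = F \<phi> s"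
proof -
  define \<kappa> :: "state \<Rightarrow> complex" where "\<kappa> r = (if r \<in> X then 1 else 0)" for r
  have "\<kappa> (swp i r) = \<kappa> r" if "i \<in> {1..<n}" for i r
    using X[of r i] X[of "swp i r" i] that by (auto simp: \<kappa>_def)
  then have "F (\<lambda>r. \<kappa> r * \<psi> r) s = \<kappa> s * F \<psi> s" for \<psi> using sym_op_weight[OF F] by blast
  moreover have "(\<lambda>r. \<kappa> r * \<psi> r) = (\<lambda>r. \<kappa> r * \<phi> r)" using eq by (auto simp: \<kappa>_def)
  ultimately show ?thesis using s by (metis \<kappa>_def mult_1)
qed

lemma sym_op_sum:
  assumes "sym_op n F" "finite R"
  shows "F (\<lambda>x. \<Sum>r\<in>R. \<phi> r x) s = (\<Sum>r\<in>R. F (\<phi> r) s)"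
  using assms(2)
proof induction
  case empty
  show ?case using sym_op_scale[OF assms(1), of 0 "\<lambda>_. 0" s] by simp
next
  case (insert x R)
  then show ?case by (simp add: sym_op_add[OF assms(1)])
qed

definition delta :: "state \<Rightarrow> state \<Rightarrow> complex" where
  "delta s r = (if r = s then 1 else 0)"

definition op_trace ::
    "state set \<Rightarrow> (state \<Rightarrow> complex) \<Rightarrow> ((state \<Rightarrow> complex) \<Rightarrow> state \<Rightarrow> complex) \<Rightarrow> complex" where
  "op_trace X \<kappa> F = (\<Sum>s\<in>X. \<kappa> s * F (delta s) s)"

lemma sym_op_expand:
  assumes F: "sym_op n F" and X: "\<And>s i. s \<in> X \<Longrightarrow> i \<in> {1..<n} \<Longrightarrow> swp i s \<in> X" "finite X" and s: "s \<in> X"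
  shows "F \<psi> s = (\<Sum>r\<in>X. \<psi> r * F (delta r) s)"
proof -
  have "F \<psi> s = F (\<lambda>x. \<Sum>r\<in>X. \<psi> r * delta r x) s"
    by (rule sym_op_cong[OF F X(1) _ s]) (simp_all add: delta_def X(2) if_distrib[of "\<lambda>x. _ * x"] cong: if_cong)
  also have "\<dots> = (\<Sum>r\<in>X. \<psi> r * F (delta r) s)"
    by (simp add: sym_op_sum[OF F X(2)] sym_op_scale[OF F])
  finally show ?thesis .
qed

text \<open>
  Matrix entries of \<open>F\<close> vanish between states of different weight, so the weight can be moved past \<open>F\<close> in the
  double sum.
\<close>

lemma op_trace_cyclic:
  assumes F: "sym_op n F" and H: "sym_op n H"
    and X: "\<And>s i. s \<in> X \<Longrightarrow> i \<in> {1..<n} \<Longrightarrow> swp i s \<in> X" "finite X"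
    and \<kappa>: "\<And>s i. i \<in> {1..<n} \<Longrightarrow> \<kappa> (swp i s) = \<kappa> s"
  shows "op_trace X \<kappa> (F \<circ> H) = op_trace X \<kappa> (H \<circ> F)"
proof -
  have w: "\<kappa> s * F (delta r) s = \<kappa> r * F (delta r) s" for r s
  proof -
    have "(\<lambda>x. \<kappa> x * delta r x) = (\<lambda>x. \<kappa> r * delta r x)" by (auto simp: delta_def)
    then show ?thesis using sym_op_weight[OF F \<kappa>, of "delta r" s] sym_op_scale[OF F, of "\<kappa> r" "delta r" s]
      by metis
  qed
  have FH: "F (H (delta s)) s = (\<Sum>r\<in>X. H (delta s) r * F (delta r) s)"
    and HF: "H (F (delta s)) s = (\<Sum>r\<in>X. F (delta s) r * H (delta r) s)" if "s \<in> X" for s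
    using sym_op_expand[OF F X that] sym_op_expand[OF H X that] by blast+
  have "op_trace X \<kappa> (F \<circ> H) = (\<Sum>s\<in>X. \<Sum>r\<in>X. \<kappa> s * (H (delta s) r * F (delta r) s))"
    unfolding op_trace_def by (intro sum.cong) (simp_all add: FH sum_distrib_left)
  also have "\<dots> = (\<Sum>s\<in>X. \<Sum>r\<in>X. \<kappa> r * (F (delta r) s * H (delta s) r))"
  proof (intro sum.cong HOL.refl)
    fix s r
    have "\<kappa> s * (H (delta s) r * F (delta r) s) = H (delta s) r * (\<kappa> s * F (delta r) s)"
      by (simp only: mult_ac)
    also have "\<dots> = H (delta s) r * (\<kappa> r * F (delta r) s)" by (simp only: w)
    finally show "\<kappa> s * (H (delta s) r * F (delta r) s) = \<kappa> r * (F (delta r) s * H (delta s) r)"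
      by (simp only: mult_ac)
  qed
  also have "\<dots> = (\<Sum>r\<in>X. \<Sum>s\<in>X. \<kappa> r * (F (delta r) s * H (delta s) r))"
    by (rule sum.swap)
  also have "\<dots> = op_trace X \<kappa> (H \<circ> F)"
    unfolding op_trace_def by (intro sum.cong) (simp_all add: HF sum_distrib_left)
  finally show ?thesis .
qed

subsection \<open>States and weights\<close>

definition states :: "nat \<Rightarrow> nat \<Rightarrow> nat \<Rightarrow> state set" where
  "states d N n = PiE {1..n} (\<lambda>_. {..<d} \<times> {..<N})"

text \<open>
  The value of \<open>d z\<close> for which the state sum with \<open>N\<close> labels has the Markov property. It is the same for all
  \<open>d\<close>, which is why \<open>d z\<close> rather than \<open>z\<close> is used as polynomial variable below.
\<close>

definition state_z :: "complex \<Rightarrow> nat \<Rightarrow> complex" where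
  "state_z q N = 1 / (\<Sum>a<N. inverse q ^ (2 * a + 1))"

text \<open>
  The diagonal entries of the enhancement of the R-matrix, normalized to sum \<open>1\<close>.
\<close>

definition label_weight :: "complex \<Rightarrow> nat \<Rightarrow> nat \<Rightarrow> complex" where
  "label_weight q N a = state_z q N * inverse q ^ (2 * a + 1)"

definition weight :: "nat \<Rightarrow> complex \<Rightarrow> nat \<Rightarrow> nat \<Rightarrow> state \<Rightarrow> complex" where
  "weight d q N n s = (\<Prod>j\<in>{1..n}. label_weight q N (snd (s j)) / of_nat d)"

lemma finite_states [simp]: "finite (states d N n)"
  by (auto simp: states_def intro!: finite_PiE)

lemma swp_PiE: "s \<in> PiE {1..n} (\<lambda>_. A) \<Longrightarrow> i \<in> {1..<n} \<Longrightarrow> swp i s \<in> PiE {1..n} (\<lambda>_. A)"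
  using transpose_range[of i n] by (auto simp: swp_def PiE_iff extensional_def Transposition.transpose_def)

lemma swp_states: "s \<in> states d N n \<Longrightarrow> i \<in> {1..<n} \<Longrightarrow> swp i s \<in> states d N n"
  unfolding states_def by (rule swp_PiE)

lemma prod_swp:
  assumes "i \<in> {1..<n}"
  shows "(\<Prod>j\<in>{1..n}. f (swp i s j)) = (\<Prod>j\<in>{1..n::nat}. f (s j))"
proof -
  have "bij_betw (Transposition.transpose i (Suc i)) {1..n} {1..n}"
    using assms transpose_range[of i n]
    by (intro bij_betwI[where g = "Transposition.transpose i (Suc i)"]) auto
  then show ?thesis unfolding swp_def comp_def by (rule prod.reindex_bij_betw)
qed

lemma weight_swp: "i \<in> {1..<n} \<Longrightarrow> weight d q N n (swp i s) = weight d q N n s"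
  unfolding weight_def by (rule prod_swp)

lemma sum_PiE_Suc:
  fixes f :: "(nat \<Rightarrow> 'a) \<Rightarrow> 'b::comm_monoid_add"
  shows "(\<Sum>s\<in>PiE {1..Suc n} (\<lambda>_. A). f s) = (\<Sum>s\<in>PiE {1..n} (\<lambda>_. A). \<Sum>b\<in>A. f (s(Suc n := b)))"
proof -
  have "{1..Suc n} = insert (Suc n) {1..n}" by auto
  then have "(\<Sum>s\<in>PiE {1..Suc n} (\<lambda>_. A). f s) = (\<Sum>s\<in>(\<lambda>(y, g). g(Suc n := y)) ` (A \<times> PiE {1..n} (\<lambda>_. A)). f s)"
    by (simp only: PiE_insert_eq)
  also have "\<dots> = (\<Sum>(y, g)\<in>A \<times> PiE {1..n} (\<lambda>_. A). f (g(Suc n := y)))"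
    using inj_combinator[of "Suc n" "{1..n}" "\<lambda>_. A"] by (subst sum.reindex) (auto simp: case_prod_unfold)
  also have "\<dots> = (\<Sum>y\<in>A. \<Sum>g\<in>PiE {1..n} (\<lambda>_. A). f (g(Suc n := y)))"
    by (rule sum.cartesian_product[symmetric])
  also have "\<dots> = (\<Sum>g\<in>PiE {1..n} (\<lambda>_. A). \<Sum>y\<in>A. f (g(Suc n := y)))"
    by (rule sum.swap)
  finally show ?thesis .
qed


subsection \<open>The Markov property\<close>

lemma q_powers_telescope:
  fixes q :: complex
  assumes "q \<noteq> 0"
  shows "(\<Sum>a<m. (q - inverse q) * inverse q ^ (2 * a + 1)) = 1 - inverse q ^ (2 * m)"
proof (induction m)
  case (Suc m)
  have "(q - inverse q) * inverse q ^ (2 * m + 1) = inverse q ^ (2 * m) - inverse q ^ (2 * Suc m)"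
    using assms by (simp add: algebra_simps)
  then show ?case using Suc by simp
qed simp

text \<open>The diagonal matrix entries of the R-matrix.\<close>

definition Rdiag :: "complex \<Rightarrow> nat \<times> nat \<Rightarrow> nat \<times> nat \<Rightarrow> complex" where
  "Rdiag q a b = (if a = b then q else if fst a = fst b \<and> snd b < snd a then q - inverse q else 0)"

text \<open>
  The weights \<open>inverse q ^ (2 * a + 1)\<close> are chosen such that this partial trace does not depend on \<open>a\<close>:
  the labels below \<open>a\<close> contribute a telescoping sum, which the entry \<open>q\<close> at \<open>b = a\<close> completes.
\<close>

lemma Rdiag_partial_trace:
  assumes "q \<noteq> 0" "a \<in> {..<d} \<times> {..<N}"
  shows "(\<Sum>b\<in>{..<d} \<times> {..<N}. label_weight q N (snd b) / of_nat d * Rdiag q a b) = state_z q N / of_nat d"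
proof -
  obtain c x where a: "a = (c, x)" "c < d" "x < N" using assms by auto
  have "(\<Sum>b\<in>{..<d} \<times> {..<N}. label_weight q N (snd b) / of_nat d * Rdiag q a b)
     = (\<Sum>b\<in>{c} \<times> {..x}. label_weight q N (snd b) / of_nat d * Rdiag q a b)"
    by (rule sum.mono_neutral_right) (use a in \<open>auto simp: Rdiag_def\<close>)
  also have "\<dots> = (\<Sum>y\<le>x. label_weight q N y / of_nat d * Rdiag q a (c, y))"
    by (simp add: sum.cartesian_product')
  also have "\<dots> = (\<Sum>y<x. label_weight q N y / of_nat d * (q - inverse q)) + label_weight q N x / of_nat d * q"
    using a by (simp add: Rdiag_def lessThan_Suc_atMost[symmetric])
  also have "\<dots> = state_z q N / of_nat d * ((\<Sum>y<x. (q - inverse q) * inverse q ^ (2 * y + 1)) + inverse q ^ (2 * x + 1) * q)"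
    by (simp add: label_weight_def sum_distrib_left distrib_left mult_ac)
  also have "inverse q ^ (2 * x + 1) * q = inverse q ^ (2 * x)"
    using assms(1) by simp
  finally show ?thesis using q_powers_telescope[OF assms(1), of x] by simp
qed

lemma sum_label_weight:
  assumes "(\<Sum>a<N. inverse q ^ (2 * a + 1)) \<noteq> 0"
  shows "(\<Sum>a<N. label_weight q N a) = 1"
  by (simp only: label_weight_def sum_distrib_left[symmetric] state_z_def) (use assms in simp)

lemma word_op_upd:
  assumes "w \<in> lists (yh_gens n)"
  shows "word_op d q w \<psi> (s(Suc n := b)) = word_op d q w (\<lambda>r. \<psi> (r(Suc n := b))) s"
  using assms
proof (induction w arbitrary: s)
  case (Cons x w)
  have sw: "swp i (s(Suc n := b)) = (swp i s)(Suc n := b)" if "1 \<le> i" "i < n" for i s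
    using that by (auto simp: swp_def fun_eq_iff Transposition.transpose_def)
  show ?case
    using Cons by (cases x) (auto simp: Rop_def sw[unfolded fun_upd_def] fun_upd_def)
qed simp

lemma weight_upd:
  "weight d q N (Suc n) (s(Suc n := b)) = weight d q N n s * (label_weight q N (snd b) / of_nat d)"
proof -
  have "{1..Suc n} = insert (Suc n) {1..n}" by auto
  then have "weight d q N (Suc n) (s(Suc n := b)) = label_weight q N (snd b) / of_nat d *
     (\<Prod>j\<in>{1..n}. label_weight q N (snd ((s(Suc n := b)) j)) / of_nat d)"
    unfolding weight_def by simp
  also have "(\<Prod>j\<in>{1..n}. label_weight q N (snd ((s(Suc n := b)) j)) / of_nat d) = weight d q N n s"
    unfolding weight_def by (intro prod.cong) auto
  finally show ?thesis by (simp add: fun_upd_def mult.commute)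
qed

lemma word_op_delta_upd:
  assumes w: "w \<in> lists (yh_gens n)" and s: "s \<in> states d N n"
  shows "word_op d q w (\<lambda>r. delta (s(Suc n := b)) (r(Suc n := b))) s = word_op d q w (delta s) s"
proof (rule sym_op_cong[OF sym_op_word_op[OF w] swp_states _ s])
  fix r assume r: "r \<in> states d N n"
  have "r = s" if eq: "r(Suc n := b) = s(Suc n := b)"
  proof
    fix j show "r j = s j"
    proof (cases "j = Suc n")
      case True
      then have "j \<notin> {1..n}" by simp
      with PiE_arb[OF r[unfolded states_def]] PiE_arb[OF s[unfolded states_def]]
      show ?thesis by metis
    next
      case False
      then show ?thesis using fun_cong[OF eq, of j] by simp
    qed
  qed
  then have "r(Suc n := b) = s(Suc n := b) \<longleftrightarrow> r = s" by blast
  then show "delta (s(Suc n := b)) (r(Suc n := b)) = delta s r" by (simp add: delta_def)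
qed

text \<open>
  In the Markov trace the last entry of the state has to return to its value, and the words that act afterwards do not
  touch it. Hence only the diagonal part of the last crossing matters.
\<close>

lemma Rop_delta_upd:
  "Rop q n (delta (s(Suc n := b))) (r(Suc n := b)) = Rdiag q (s n) b * delta (s(Suc n := b)) (r(Suc n := b))"
proof (cases "r n = b")
  case True
  then show ?thesis by (auto simp: Rop_def Rdiag_def delta_def fun_eq_iff)
next
  case False
  have "swp n (r(Suc n := b)) (Suc n) \<noteq> (s(Suc n := b)) (Suc n)" using False by simp
  then have "swp n (r(Suc n := b)) \<noteq> s(Suc n := b)" by metis
  moreover have "r n = s n" if "r(Suc n := b) = s(Suc n := b)"
    using fun_cong[OF that, of n] by simp
  ultimately show ?thesis using False by (auto simp: Rop_def Rdiag_def delta_def)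
qed

definition state_trace :: "nat \<Rightarrow> complex \<Rightarrow> nat \<Rightarrow> nat \<Rightarrow> yh_gen list \<Rightarrow> complex" where
  "state_trace d q N n w = op_trace (states d N n) (weight d q N n) (word_op d q w)"

lemma state_trace_markov_G:
  assumes q: "q \<noteq> 0" and n: "n \<ge> 1" and w: "w \<in> lists (yh_gens n)"
  shows "state_trace d q N (Suc n) (w @ [G n]) = state_z q N / of_nat d * state_trace d q N n w"
proof -
  have "word_op d q (w @ [G n]) (delta (s(Suc n := b))) (s(Suc n := b)) = Rdiag q (s n) b * word_op d q w (delta s) s"
    if s: "s \<in> states d N n" for s b
  proof -
    have "word_op d q (w @ [G n]) (delta (s(Suc n := b))) (s(Suc n := b))
        = word_op d q w (\<lambda>r. Rdiag q (s n) b * delta (s(Suc n := b)) (r(Suc n := b))) s"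
      using word_op_upd[OF w] by (simp add: Rop_delta_upd)
    then show ?thesis
      using sym_op_scale[OF sym_op_word_op[OF w]] word_op_delta_upd[OF w s] by simp
  qed
  then have "state_trace d q N (Suc n) (w @ [G n]) =
     (\<Sum>s\<in>states d N n. \<Sum>b\<in>{..<d} \<times> {..<N}. weight d q N n s * (label_weight q N (snd b) / of_nat d) *
        (Rdiag q (s n) b * word_op d q w (delta s) s))"
    unfolding state_trace_def op_trace_def states_def sum_PiE_Suc weight_upd
    by (simp add: states_def)
  also have "\<dots> = (\<Sum>s\<in>states d N n. weight d q N n s * word_op d q w (delta s) s * (state_z q N / of_nat d))"
  proof (intro sum.cong HOL.refl)
    fix s assume "s \<in> states d N n"
    then have "s n \<in> {..<d} \<times> {..<N}"
      using n PiE_mem[of s "{1..n}" _ n] unfolding states_def by auto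
    note z = Rdiag_partial_trace[OF q this]
    have "(\<Sum>b\<in>{..<d} \<times> {..<N}. weight d q N n s * (label_weight q N (snd b) / of_nat d) *
        (Rdiag q (s n) b * word_op d q w (delta s) s)) = weight d q N n s * word_op d q w (delta s) s *
        (\<Sum>b\<in>{..<d} \<times> {..<N}. label_weight q N (snd b) / of_nat d * Rdiag q (s n) b)"
      unfolding sum_distrib_left by (intro sum.cong) simp_all
    then show "(\<Sum>b\<in>{..<d} \<times> {..<N}. weight d q N n s * (label_weight q N (snd b) / of_nat d) *
        (Rdiag q (s n) b * word_op d q w (delta s) s)) = weight d q N n s * word_op d q w (delta s) s * (state_z q N / of_nat d)"
      by (simp only: z)
  qed
  finally show ?thesis
    by (simp add: state_trace_def op_trace_def sum_distrib_left mult_ac)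
qed

lemma state_trace_T:
  assumes w: "w \<in> lists (yh_gens n)"
  shows "state_trace d q N (Suc n) (w @ replicate k (T (Suc n))) =
    (\<Sum>c<d. (unity_root d ^ c) ^ k) / of_nat d * (\<Sum>a<N. label_weight q N a) * state_trace d q N n w"
proof -
  have "word_op d q (w @ replicate k (T (Suc n))) (delta (s(Suc n := b))) (s(Suc n := b)) =
      (unity_root d ^ fst b) ^ k * word_op d q w (delta s) s"
    if s: "s \<in> states d N n" for s b
  proof -
    have "word_op d q (w @ replicate k (T (Suc n))) (delta (s(Suc n := b))) (s(Suc n := b))
        = word_op d q w (\<lambda>r. (unity_root d ^ fst b) ^ k * delta (s(Suc n := b)) (r(Suc n := b))) s"
      using word_op_upd[OF w] by (simp add: word_op_replicate_T)
    then show ?thesis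
      using sym_op_scale[OF sym_op_word_op[OF w]] word_op_delta_upd[OF w s] by simp
  qed
  then have "state_trace d q N (Suc n) (w @ replicate k (T (Suc n))) =
     (\<Sum>s\<in>states d N n. \<Sum>b\<in>{..<d} \<times> {..<N}. weight d q N n s * (label_weight q N (snd b) / of_nat d) *
        ((unity_root d ^ fst b) ^ k * word_op d q w (delta s) s))"
    unfolding state_trace_def op_trace_def states_def sum_PiE_Suc weight_upd
    by (simp add: states_def)
  also have "\<dots> = (\<Sum>s\<in>states d N n. weight d q N n s * word_op d q w (delta s) s *
      (\<Sum>b\<in>{..<d} \<times> {..<N}. (unity_root d ^ fst b) ^ k / of_nat d * label_weight q N (snd b)))"
    by (simp add: sum_distrib_left mult_ac)
  also have "(\<Sum>b\<in>{..<d} \<times> {..<N}. (unity_root d ^ fst b) ^ k / of_nat d * label_weight q N (snd b))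
      = (\<Sum>c<d. (unity_root d ^ c) ^ k / of_nat d) * (\<Sum>a<N. label_weight q N a)"
    by (simp add: sum_product sum.cartesian_product case_prod_unfold)
  finally show ?thesis
    unfolding state_trace_def[of d q N n] op_trace_def
    by (subst (asm) sum_distrib_right[symmetric]) (simp add: sum_divide_distrib mult_ac)
qed

subsection \<open>The state sum is a trace\<close>

text \<open>
  The identities hold at states whose colors are below \<open>d\<close>, a set that the operators preserve.
\<close>

lemma word_op_mono_eq:
  assumes q: "q \<noteq> 0" and d: "d \<ge> 1" and "mono_eq d n w w'"
  shows "s \<in> states d N n \<Longrightarrow> word_op d q w \<psi> s = word_op d q w' \<psi> s"
  using assms(3)
proof (induction arbitrary: \<psi> s)
  case (append u u' v v')
  have "u \<in> lists (yh_gens n)" using mono_eq_lists append by blast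
  then have "word_op d q u (word_op d q v \<psi>) s = word_op d q u (word_op d q v' \<psi>) s"
    using append.IH(2) append.prems by (intro sym_op_cong[OF sym_op_word_op swp_states]) auto
  then show ?case using append by simp
next
  case (TG i j)
  then show ?case using Rop_color[of q i "\<lambda>c. unity_root d ^ c" j] by simp
next
  case (Tpow j)
  have "(unity_root d ^ fst (s j)) ^ d = 1"
    using unity_root_power_d[OF d] by (metis power_commutes power_mult power_one mult.commute)
  then show ?case by (simp add: word_op_replicate_T)
next
  case (far i j)
  then show ?case using Rop_far[of i j q \<psi> s] by simp
qed (simp_all add: Rop_braid[OF q])

lemma word_op_quadratic:
  assumes q: "q \<noteq> 0" and d: "d \<ge> 1" and i: "i \<in> {1..<n}" and s: "s \<in> states d N n"
  shows "word_op d q [G i, G i] \<psi> s = \<psi> s + (q - inverse q) / of_nat d *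
     (\<Sum>t<d. word_op d q (replicate t (T i) @ replicate (d - t) (T (Suc i))) (Rop q i \<psi>) s)"
proof -
  have "s i \<in> {..<d} \<times> {..<N}" "s (Suc i) \<in> {..<d} \<times> {..<N}"
    using s i unfolding states_def by (auto simp: PiE_iff)
  then have "fst (s i) < d" "fst (s (Suc i)) < d" by auto
  from word_op_color_projector[OF d this, where q = q] show ?thesis
    using d by (simp add: Rop_quadratic[OF q] del: word_op_simps(3))
qed

lemma yh_functional_state_trace:
  assumes q: "q \<noteq> 0" and d: "d \<ge> 1"
  shows "yh_functional d n ((q - inverse q) / of_nat d) (state_trace d q N n)"
  unfolding yh_functional_def
proof (intro conjI allI impI ballI)
  fix w w' assume "mono_eq d n w w'"
  then show "state_trace d q N n w = state_trace d q N n w'"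
    unfolding state_trace_def op_trace_def
  proof (intro sum.cong HOL.refl)
    fix s assume "s \<in> states d N n"
    from word_op_mono_eq[OF q d \<open>mono_eq d n w w'\<close> this]
    show "weight d q N n s * word_op d q w (delta s) s = weight d q N n s * word_op d q w' (delta s) s"
      by simp
  qed
next
  fix u v i assume u: "u \<in> lists (yh_gens n)" and v: "v \<in> lists (yh_gens n)" and i: "i \<in> {1..<n}"
  let ?h = "(q - inverse q) / of_nat d"
  let ?e = "\<lambda>t. replicate t (T i) @ replicate (d - t) (T (Suc i))"
  have "word_op d q (u @ [G i, G i] @ v) \<psi> s = word_op d q (u @ v) \<psi> s +
      ?h * (\<Sum>t<d. word_op d q (u @ ?e t @ [G i] @ v) \<psi> s)" if s: "s \<in> states d N n" for \<psi> s
  proof -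
    note U = sym_op_word_op[OF u, of d q]
    define \<phi> where "\<phi> = word_op d q v \<psi>"
    have "word_op d q (u @ [G i, G i] @ v) \<psi> s = word_op d q u (word_op d q [G i, G i] \<phi>) s"
      by (simp add: \<phi>_def)
    also have "\<dots> = word_op d q u (\<lambda>s. \<phi> s + ?h * (\<Sum>t<d. word_op d q (?e t) (Rop q i \<phi>) s)) s"
      by (rule sym_op_cong[OF U swp_states word_op_quadratic[OF q d i] s])
    also have "\<dots> = word_op d q u \<phi> s + ?h * (\<Sum>t<d. word_op d q u (word_op d q (?e t) (Rop q i \<phi>)) s)"
      by (simp only: sym_op_add[OF U] sym_op_scale[OF U] sym_op_sum[OF U finite_lessThan])
    finally show ?thesis by (simp add: \<phi>_def)
  qed
  then have "state_trace d q N n (u @ [G i, G i] @ v) = (\<Sum>s\<in>states d N n. weight d q N n s *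
     (word_op d q (u @ v) (delta s) s + ?h * (\<Sum>t<d. word_op d q (u @ ?e t @ [G i] @ v) (delta s) s)))"
    unfolding state_trace_def op_trace_def by (intro sum.cong HOL.refl) (simp only:)
  also have "\<dots> = state_trace d q N n (u @ v) + ?h * (\<Sum>t<d. state_trace d q N n (u @ ?e t @ [G i] @ v))"
    unfolding state_trace_def op_trace_def
    by (subst sum.swap) (simp add: distrib_left sum.distrib sum_distrib_left mult_ac del: word_op_simps)
  finally show "state_trace d q N n (u @ [G i, G i] @ v) = state_trace d q N n (u @ v) + ?h * 
     (\<Sum>t<d. state_trace d q N n (u @ replicate t (T i) @ replicate (d - t) (T (Suc i)) @ [G i] @ v))"
    by simp
qed

lemma word_trace_state_trace:
  assumes q: "q \<noteq> 0" and d: "d \<ge> 1" and N: "(\<Sum>a<N. inverse q ^ (2 * a + 1)) \<noteq> 0"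
  shows "word_trace d ((q - inverse q) / of_nat d) (state_z q N / of_nat d) (state_trace d q N)"
  unfolding word_trace_def
proof (intro conjI allI ballI impI)
  fix n show "yh_functional d n ((q - inverse q) / of_nat d) (state_trace d q N n)"
    by (rule yh_functional_state_trace[OF q d])
next
  fix n w assume "w \<in> lists (yh_gens n)"
  from state_trace_T[OF this, of d q N 0] show "state_trace d q N (Suc n) w = state_trace d q N n w"
    using d by (simp add: sum_label_weight[OF N])
next
  fix n u v assume "u \<in> lists (yh_gens n)" "v \<in> lists (yh_gens n)"
  then show "state_trace d q N n (u @ v) = state_trace d q N n (v @ u)"
    unfolding state_trace_def word_op_simps
    by (intro op_trace_cyclic[of n] sym_op_word_op swp_states weight_swp) auto
next
  fix n :: nat and w assume "1 \<le> n" "w \<in> lists (yh_gens n)"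
  then show "state_trace d q N (Suc n) (w @ [G n]) = state_z q N / of_nat d * state_trace d q N n w"
    by (rule state_trace_markov_G[OF q])
next
  fix n w k assume w: "w \<in> lists (yh_gens n)" and k: "k \<in> {1..<d}"
  let ?x = "unity_root d ^ k"
  have "?x \<noteq> 1" using unity_root_power_eq_iff[OF d, of k 0] k by simp
  moreover have "?x ^ d = 1"
    using unity_root_power_d[OF d] by (metis power_commutes power_mult power_one mult.commute)
  ultimately have "(\<Sum>c<d. ?x ^ c) = 0" by (intro sum_powers_root_of_unity)
  then have "(\<Sum>c<d. (unity_root d ^ c) ^ k) = 0" by (simp add: mult.commute flip: power_mult)
  then show "state_trace d q N (Suc n) (w @ replicate k (T (Suc n))) = 0"
    by (simp add: state_trace_T[OF w])
qed

lemma state_trace_empty: "state_trace d q N 0 [] = 1"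
  by (simp add: state_trace_def op_trace_def states_def weight_def delta_def)


section \<open>Linear functionals on the Yokonuma--Hecke algebra\<close>

abbreviation wmono :: "yh_gen list \<Rightarrow> yh_poly" where
  "wmono w \<equiv> Poly_Mapping.single w 1"

lemma single_mult_single:
  "Poly_Mapping.single u a * Poly_Mapping.single v b = Poly_Mapping.single (u @ v) (a * b)"
  for a b :: complex
  by (simp add: mult_single plus_list_def)

lemma one_eq_wmono: "(1 :: yh_poly) = wmono []"
  by (simp flip: single_one add: zero_list_def)

lemma yg_power: "yg i = wmono [G i]" "yt j ^ k = wmono (replicate k (T j))"
  by (induction k) (simp_all add: yg_def yt_def one_eq_wmono single_mult_single)

lemma in_yh_free: "x \<in> carrier (yh_free n) \<longleftrightarrow> Poly_Mapping.keys x \<subseteq> lists (yh_gens n)"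
  by (auto simp: yh_free_def)

lemma yh_free_simps [simp]:
  "mult (yh_free n) = (*)" "one (yh_free n) = 1" "zero (yh_free n) = 0" "add (yh_free n) = (+)"
  by (simp_all add: yh_free_def)

lemma yh_free_closed:
  shows "x \<in> carrier (yh_free n) \<Longrightarrow> y \<in> carrier (yh_free n) \<Longrightarrow> x + y \<in> carrier (yh_free n)"
    and "x \<in> carrier (yh_free n) \<Longrightarrow> y \<in> carrier (yh_free n) \<Longrightarrow> x * y \<in> carrier (yh_free n)"
    and "x \<in> carrier (yh_free n) \<Longrightarrow> y \<in> carrier (yh_free n) \<Longrightarrow> x - y \<in> carrier (yh_free n)"
    and "x \<in> carrier (yh_free n) \<Longrightarrow> - x \<in> carrier (yh_free n)"
    and "0 \<in> carrier (yh_free n)" "1 \<in> carrier (yh_free n)"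
    and "w \<in> lists (yh_gens n) \<Longrightarrow> Poly_Mapping.single w c \<in> carrier (yh_free n)"
    and "yh_const c \<in> carrier (yh_free n)"
proof -
  show "x * y \<in> carrier (yh_free n)" if "x \<in> carrier (yh_free n)" "y \<in> carrier (yh_free n)"
  proof -
    have "k \<in> lists (yh_gens n)" if k: "k \<in> Poly_Mapping.keys (x * y)" for k
    proof -
      obtain a b where "k = a + b" "a \<in> Poly_Mapping.keys x" "b \<in> Poly_Mapping.keys y"
        using keys_mult[of x y] k by blast
      then show ?thesis
        using \<open>x \<in> _\<close> \<open>y \<in> _\<close> by (auto simp: in_yh_free plus_list_def)
    qed
    then show ?thesis by (auto simp: in_yh_free)
  qed
next
  show "x + y \<in> carrier (yh_free n)" if "x \<in> carrier (yh_free n)" "y \<in> carrier (yh_free n)"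
    using that keys_add[of x y] by (auto simp: in_yh_free simp del: in_lists_conv_set)
next
  show "x - y \<in> carrier (yh_free n)" if "x \<in> carrier (yh_free n)" "y \<in> carrier (yh_free n)"
    using that keys_add[of x "- y"] by (auto simp: in_yh_free in_keys_iff simp del: in_lists_conv_set)
next
  show "- x \<in> carrier (yh_free n)" if "x \<in> carrier (yh_free n)"
    using that by (auto simp: in_yh_free in_keys_iff simp del: in_lists_conv_set)
qed (auto simp: in_yh_free yh_const_def one_eq_wmono)

lemma yh_free_sum: "(\<And>i. i \<in> A \<Longrightarrow> f i \<in> carrier (yh_free n)) \<Longrightarrow> sum f A \<in> carrier (yh_free n)"
  by (induction A rule: infinite_finite_induct) (auto simp: yh_free_closed)

lemma ring_yh_free: "ring (yh_free n)"
proof (intro ringI abelian_groupI monoidI)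
  fix x assume "x \<in> carrier (yh_free n)"
  then show "\<exists>y\<in>carrier (yh_free n). y \<oplus>\<^bsub>yh_free n\<^esub> x = \<zero>\<^bsub>yh_free n\<^esub>"
    by (intro bexI[of _ "- x"]) (auto simp: yh_free_closed)
qed (auto simp: yh_free_closed algebra_simps)

lemma sum_of_monomials: "x = (\<Sum>w\<in>Poly_Mapping.keys x. Poly_Mapping.single w (Poly_Mapping.lookup x w))"
  by (rule poly_mapping_eqI) (simp add: lookup_sum lookup_single when_def in_keys_iff)

lemma monomial_induct:
  fixes x :: yh_poly
  assumes "Poly_Mapping.keys x \<subseteq> L" "P 0"
    and "\<And>w c. w \<in> L \<Longrightarrow> P (Poly_Mapping.single w c)"
    and "\<And>x y. Poly_Mapping.keys x \<subseteq> L \<Longrightarrow> Poly_Mapping.keys y \<subseteq> L \<Longrightarrow> P x \<Longrightarrow> P y \<Longrightarrow> P (x + y)"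
  shows "P x"
proof -
  have "Poly_Mapping.keys (\<Sum>w\<in>A. Poly_Mapping.single w (Poly_Mapping.lookup x w)) \<subseteq> L \<and>
      P (\<Sum>w\<in>A. Poly_Mapping.single w (Poly_Mapping.lookup x w))"
    if "finite A" "A \<subseteq> L" for A
    using that
  proof (induction rule: finite_induct)
    case (insert w A)
    let ?m = "Poly_Mapping.single w (Poly_Mapping.lookup x w)"
    let ?s = "\<Sum>w\<in>A. Poly_Mapping.single w (Poly_Mapping.lookup x w)"
    have "Poly_Mapping.keys ?m \<subseteq> L" "Poly_Mapping.keys ?s \<subseteq> L" "P ?m" "P ?s"
      using insert assms(3) by auto
    then have "Poly_Mapping.keys (?m + ?s) \<subseteq> L \<and> P (?m + ?s)"
      using assms(4) keys_add[of ?m ?s] by blast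
    then show ?case using insert by simp
  qed (use assms(2) in simp)
  from this[of "Poly_Mapping.keys x"] show ?thesis
    using assms(1) sum_of_monomials[of x] by simp
qed

lemma yh_free_induct [consumes 1, case_names zero single add]:
  assumes "x \<in> carrier (yh_free n)" "P 0"
    and "\<And>w c. w \<in> lists (yh_gens n) \<Longrightarrow> P (Poly_Mapping.single w c)"
    and "\<And>x y. x \<in> carrier (yh_free n) \<Longrightarrow> y \<in> carrier (yh_free n) \<Longrightarrow> P x \<Longrightarrow> P y \<Longrightarrow> P (x + y)"
  shows "P x"
  using assms monomial_induct[of x "lists (yh_gens n)" P] unfolding in_yh_free by blast

definition linear_ext :: "(yh_gen list \<Rightarrow> complex) \<Rightarrow> yh_poly \<Rightarrow> complex" where
  "linear_ext f x = (\<Sum>w\<in>Poly_Mapping.keys x. Poly_Mapping.lookup x w * f w)"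

lemma linear_ext_superset:
  assumes "finite A" "Poly_Mapping.keys x \<subseteq> A"
  shows "linear_ext f x = (\<Sum>w\<in>A. Poly_Mapping.lookup x w * f w)"
  unfolding linear_ext_def by (rule sum.mono_neutral_left) (use assms in \<open>auto simp: in_keys_iff\<close>)

lemma linear_ext_add: "linear_ext f (x + y) = linear_ext f x + linear_ext f y"
proof -
  let ?A = "Poly_Mapping.keys x \<union> Poly_Mapping.keys y"
  have "linear_ext f (x + y) = (\<Sum>w\<in>?A. Poly_Mapping.lookup (x + y) w * f w)"
    by (rule linear_ext_superset) (use keys_add[of x y] in auto)
  also have "\<dots> = linear_ext f x + linear_ext f y"
    by (simp add: linear_ext_superset[of ?A] lookup_add distrib_right sum.distrib)
  finally show ?thesis .
qed

lemma linear_ext_0 [simp]: "linear_ext f 0 = 0"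
  by (simp add: linear_ext_def)

lemma linear_ext_single [simp]: "linear_ext f (Poly_Mapping.single w c) = c * f w"
  by (cases "c = 0") (simp_all add: linear_ext_def)

lemma linear_ext_one [simp]: "linear_ext f 1 = f []"
  by (simp add: one_eq_wmono)

lemma linear_ext_diff: "linear_ext f (x - y) = linear_ext f x - linear_ext f y"
  using linear_ext_add[of f "x - y" y] by simp

lemma linear_ext_sum: "linear_ext f (sum x A) = (\<Sum>i\<in>A. linear_ext f (x i))"
  by (induction A rule: infinite_finite_induct) (auto simp: linear_ext_add)

lemma linear_ext_const_mult: "linear_ext f (yh_const c * x) = c * linear_ext f x"
proof (induction x rule: monomial_induct[of _ UNIV])
  case (3 w a)
  then show ?case by (simp add: yh_const_def single_mult_single)
qed (auto simp: linear_ext_add distrib_left)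

lemma yh_const_commute: "yh_const c * x = x * yh_const c"
proof (induction x rule: monomial_induct[of _ UNIV])
  case (3 w a)
  then show ?case by (simp add: yh_const_def single_mult_single mult.commute)
qed (auto simp: distrib_left distrib_right)

lemma single_eq_const: "Poly_Mapping.single w c = yh_const c * wmono w"
  by (simp add: yh_const_def single_mult_single)

subsection \<open>The defining ideal\<close>

text \<open>
  The quadratic relation in expanded form, as a combination of monomials.
\<close>

definition quadratic_rel :: "nat \<Rightarrow> complex \<Rightarrow> nat \<Rightarrow> yh_poly" where
  "quadratic_rel d q i = wmono [G i, G i] - wmono [] - yh_const ((q - inverse q) / of_nat d) *
     (\<Sum>s<d. wmono (replicate s (T i) @ replicate (d - s) (T (Suc i)) @ [G i]))"

lemma yh_const_mult: "yh_const a * yh_const b = yh_const (a * b)"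
  by (simp add: yh_const_def single_mult_single)

lemma ye_eq: "ye d i = yh_const (1 / of_nat d) * (\<Sum>s<d. wmono (replicate s (T i) @ replicate (d - s) (T (Suc i))))"
  by (simp add: ye_def yg_power single_mult_single)

lemma quadratic_rel_eq: "yg i ^ 2 - (1 + yh_const (q - inverse q) * ye d i * yg i) = quadratic_rel d q i"
proof -
  have "yh_const (q - inverse q) * ye d i * yg i = yh_const ((q - inverse q) / of_nat d) *
     (\<Sum>s<d. wmono (replicate s (T i) @ replicate (d - s) (T (Suc i)) @ [G i]))"
    unfolding ye_eq mult.assoc[symmetric] yh_const_mult
    by (simp add: mult.assoc sum_distrib_right yg_power single_mult_single)
  then show ?thesis
    by (simp add: quadratic_rel_def power2_eq_square yg_power single_mult_single one_eq_wmono)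
qed

lemma yh_relations_cases:
  assumes "r \<in> yh_relations d q n"
  obtains w w' where "mono_eq d n w w'" "r = wmono w - wmono w'"
    | i where "i \<in> {1..<n}" "r = quadratic_rel d q i"
proof -
  note forms = yg_power yg_power(2)[of _ 1, simplified] single_mult_single one_eq_wmono
  consider
     i j where "i \<in> {1..<n}" "j \<in> {1..<n}" "\<bar>int i - int j\<bar> = 1" "r = yg i * yg j * yg i - yg j * yg i * yg j"
   | i j where "i \<in> {1..<n}" "j \<in> {1..<n}" "\<bar>int i - int j\<bar> > 1" "r = yg i * yg j - yg j * yg i"
   | i j where "i \<in> {1..n}" "j \<in> {1..n}" "r = yt i * yt j - yt j * yt i"
   | i j where "i \<in> {1..<n}" "j \<in> {1..n}" "r = yt j * yg i - yg i * yt (Transposition.transpose i (i + 1) j)"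
   | j where "j \<in> {1..n}" "r = yt j ^ d - 1"
   | i where "i \<in> {1..<n}" "r = yg i ^ 2 - (1 + yh_const (q - inverse q) * ye d i * yg i)"
    using assms unfolding yh_relations_def by blast
  then show thesis
  proof cases
    case (1 i j)
    then consider "j = Suc i" | "i = Suc j" by linarith
    then have "mono_eq d n [G i, G j, G i] [G j, G i, G j]"
    proof cases
      case a: 1 then show ?thesis using mono_eq.braid[of i n d] 1 by simp
    next
      case a: 2 then show ?thesis using mono_eq.sym[OF mono_eq.braid[of j n d]] 1 by simp
    qed
    then show thesis using that(1) 1 by (simp add: forms)
  next
    case (2 i j)
    then consider "Suc i < j" | "Suc j < i" by linarith
    then have "mono_eq d n [G i, G j] [G j, G i]"
    proof cases
      case a: 1 then show ?thesis using mono_eq.far[of i j n d] 2 by simp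
    next
      case a: 2 then show ?thesis using mono_eq.sym[OF mono_eq.far[of j i n d]] 2 by simp
    qed
    then show thesis using that(1) 2 by (simp add: forms)
  next
    case (3 i j)
    then show thesis using that(1)[OF mono_eq.TT[of i n j d]] by (simp add: forms)
  next
    case (4 i j)
    then show thesis using that(1)[OF mono_eq.TG[of i n j d]] by (simp add: forms)
  next
    case (5 j)
    then show thesis using that(1)[OF mono_eq.Tpow[of j n d]] by (simp add: yg_power(2) one_eq_wmono)
  next
    case (6 i)
    then show thesis using that(2) quadratic_rel_eq by simp
  qed
qed

lemma quadratic_rel_closed: "i \<in> {1..<n} \<Longrightarrow> quadratic_rel d q i \<in> carrier (yh_free n)"
  unfolding quadratic_rel_def by (intro yh_free_closed yh_free_sum) auto

lemma yh_relations_closed: "yh_relations d q n \<subseteq> carrier (yh_free n)"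
proof
  fix r assume "r \<in> yh_relations d q n"
  then show "r \<in> carrier (yh_free n)"
  proof (cases rule: yh_relations_cases)
    case (1 w w')
    then show ?thesis using mono_eq_lists[of d n w w'] by (auto intro!: yh_free_closed)
  next
    case (2 i)
    then show ?thesis using quadratic_rel_closed by simp
  qed
qed

lemma ideal_yh_ideal: "ideal (yh_ideal d q n) (yh_free n)"
  unfolding yh_ideal_def using ring.genideal_ideal[OF ring_yh_free yh_relations_closed] .

lemma yh_relations_in_ideal: "r \<in> yh_relations d q n \<Longrightarrow> r \<in> yh_ideal d q n"
  unfolding yh_ideal_def using ring.genideal_self[OF ring_yh_free yh_relations_closed] by blast

text \<open>
  The ring operations of the free algebra are those of its type, so the ideal laws are stated without the ring record.
\<close>

lemma yh_ideal_closed: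
  shows "x \<in> yh_ideal d q n \<Longrightarrow> x \<in> carrier (yh_free n)"
    and "0 \<in> yh_ideal d q n"
    and "x \<in> yh_ideal d q n \<Longrightarrow> y \<in> yh_ideal d q n \<Longrightarrow> x + y \<in> yh_ideal d q n"
    and "x \<in> yh_ideal d q n \<Longrightarrow> y \<in> carrier (yh_free n) \<Longrightarrow> x * y \<in> yh_ideal d q n"
    and "x \<in> yh_ideal d q n \<Longrightarrow> y \<in> carrier (yh_free n) \<Longrightarrow> y * x \<in> yh_ideal d q n"
    and "x \<in> yh_ideal d q n \<Longrightarrow> - x \<in> yh_ideal d q n"
    and "x \<in> yh_ideal d q n \<Longrightarrow> y \<in> yh_ideal d q n \<Longrightarrow> x - y \<in> yh_ideal d q n"
proof -
  interpret ideal "yh_ideal d q n" "yh_free n" by (rule ideal_yh_ideal)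
  show c: "x \<in> yh_ideal d q n \<Longrightarrow> x \<in> carrier (yh_free n)" for x using a_subset by blast
  show "0 \<in> yh_ideal d q n" using additive_subgroup.zero_closed[OF additive_subgroup_axioms] by simp
  show add: "x \<in> yh_ideal d q n \<Longrightarrow> y \<in> yh_ideal d q n \<Longrightarrow> x + y \<in> yh_ideal d q n" for x y
    using additive_subgroup.a_closed[OF additive_subgroup_axioms, of x y] by simp
  show r: "x \<in> yh_ideal d q n \<Longrightarrow> y \<in> carrier (yh_free n) \<Longrightarrow> x * y \<in> yh_ideal d q n" for x y
    using I_r_closed[of x y] by simp
  show "x \<in> yh_ideal d q n \<Longrightarrow> y \<in> carrier (yh_free n) \<Longrightarrow> y * x \<in> yh_ideal d q n"
    using I_l_closed[of x y] by simp
  show m: "x \<in> yh_ideal d q n \<Longrightarrow> - x \<in> yh_ideal d q n" for x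
    using r[of x "- 1"] by (simp add: yh_free_closed)
  show "x \<in> yh_ideal d q n \<Longrightarrow> y \<in> yh_ideal d q n \<Longrightarrow> x - y \<in> yh_ideal d q n"
    using add[of x "- y"] m[of y] by simp
qed

lemma yh_ideal_minimal:
  assumes "yh_relations d q n \<subseteq> K" "K \<subseteq> carrier (yh_free n)" "0 \<in> K"
    and add: "\<And>x y. x \<in> K \<Longrightarrow> y \<in> K \<Longrightarrow> x + y \<in> K"
    and l: "\<And>x y. x \<in> K \<Longrightarrow> y \<in> carrier (yh_free n) \<Longrightarrow> y * x \<in> K"
    and r: "\<And>x y. x \<in> K \<Longrightarrow> y \<in> carrier (yh_free n) \<Longrightarrow> x * y \<in> K"
  shows "yh_ideal d q n \<subseteq> K"
proof -
  interpret ring "yh_free n" by (rule ring_yh_free)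
  have neg: "- x \<in> K" if "x \<in> K" for x
    using r[OF that, of "- 1"] by (simp add: yh_free_closed)
  have inv: "\<ominus>\<^bsub>yh_free n\<^esub> x = - x" if "x \<in> carrier (yh_free n)" for x
    using minus_equality[of "- x" x] that by (simp add: yh_free_closed)
  have "ideal K (yh_free n)"
  proof (intro idealI ring_yh_free group.subgroupI)
    show "group (add_monoid (yh_free n))" by (rule a_group)
    fix x assume x: "x \<in> K"
    show "inv\<^bsub>add_monoid (yh_free n)\<^esub> x \<in> K"
      using inv[of x] neg[OF x] x assms(2) by (auto simp: a_inv_def)
  qed (use assms in auto)
  then show ?thesis unfolding yh_ideal_def by (rule genideal_minimal) (rule assms(1))
qed

lemma mono_eq_in_ideal: "mono_eq d n w w' \<Longrightarrow> wmono w - wmono w' \<in> yh_ideal d q n"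
proof (induction rule: mono_eq.induct)
  case (refl w)
  then show ?case by (simp add: yh_ideal_closed)
next
  case (sym w w')
  then show ?case using yh_ideal_closed(6) by fastforce
next
  case (trans w w' w'')
  then show ?case using yh_ideal_closed(3)[OF trans.IH] by simp
next
  case (append u u' v v')
  have "u' \<in> lists (yh_gens n)" "v \<in> lists (yh_gens n)" using mono_eq_lists append by blast+
  then have "(wmono u - wmono u') * wmono v + wmono u' * (wmono v - wmono v') \<in> yh_ideal d q n"
    using append.IH by (intro yh_ideal_closed(3) yh_ideal_closed(4) yh_ideal_closed(5)[of "_ - _"] yh_free_closed(7))
  then show ?case by (simp add: algebra_simps single_mult_single)
next
  case (braid i)
  then have "yg i * yg (Suc i) * yg i - yg (Suc i) * yg i * yg (Suc i) \<in> yh_relations d q n"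
    unfolding yh_relations_def by (intro UnI1 CollectI exI[of _ i] exI[of _ "Suc i"]) auto
  from yh_relations_in_ideal[OF this] show ?case by (simp add: yg_power single_mult_single)
next
  case (far i j)
  have "yg i * yg j - yg j * yg i \<in> yh_relations d q n"
    unfolding yh_relations_def by (rule UnI1, rule UnI1, rule UnI1, rule UnI1, rule UnI2, intro CollectI exI[of _ i] exI[of _ j],
        use far in auto)
  from yh_relations_in_ideal[OF this] show ?case by (simp add: yg_power single_mult_single)
next
  case (TT i j)
  then have "yt i * yt j - yt j * yt i \<in> yh_relations d q n"
    unfolding yh_relations_def by blast
  from yh_relations_in_ideal[OF this] show ?case by (simp add: yt_def single_mult_single)
next
  case (TG i j)
  have "yt j * yg i - yg i * yt (Transposition.transpose i (i + 1) j) \<in> yh_relations d q n"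
    unfolding yh_relations_def
    by (rule UnI1, rule UnI1, rule UnI2, intro CollectI exI[of _ i] exI[of _ j], use TG in auto)
  from yh_relations_in_ideal[OF this] show ?case by (simp add: yg_def yt_def single_mult_single)
next
  case (Tpow j)
  then have "yt j ^ d - 1 \<in> yh_relations d q n"
    unfolding yh_relations_def by blast
  from yh_relations_in_ideal[OF this] show ?case by (simp add: yg_power one_eq_wmono)
qed

lemma quadratic_rel_in_ideal: "i \<in> {1..<n} \<Longrightarrow> quadratic_rel d q i \<in> yh_ideal d q n"
  unfolding quadratic_rel_eq[symmetric]
  by (rule yh_relations_in_ideal, unfold yh_relations_def, rule UnI2) blast

lemma wmono_quadratic: "wmono u * quadratic_rel d q i * wmono v = wmono (u @ [G i, G i] @ v) -
   (wmono (u @ v) + yh_const ((q - inverse q) / of_nat d) *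
     (\<Sum>s<d. wmono (u @ replicate s (T i) @ replicate (d - s) (T (Suc i)) @ [G i] @ v)))"
proof -
  have c: "wmono u * (yh_const c * x) * wmono v = yh_const c * (wmono u * x * wmono v)" for c x
    by (simp only: mult.assoc[symmetric] yh_const_commute[of c "wmono u"])
  then show ?thesis
    unfolding quadratic_rel_def left_diff_distrib right_diff_distrib c
    by (simp add: single_mult_single sum_distrib_left sum_distrib_right)
qed

lemma yh_const_mult_out: "(yh_const a * u) * r * (yh_const b * v) = yh_const (a * b) * (u * r * v)"
proof -
  have "(yh_const a * u) * r * (yh_const b * v) = yh_const a * ((u * r) * yh_const b) * v"
    by (simp only: mult.assoc)
  also have "(u * r) * yh_const b = yh_const b * (u * r)" by (rule yh_const_commute[symmetric])
  finally show ?thesis by (simp only: mult.assoc[symmetric] yh_const_mult)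
qed

text \<open>
  The elements that are annihilated in every context form an ideal, and by bilinearity it is enough to test the
  generators of the ideal in contexts that are words.
\<close>

lemma yh_functional_vanishes:
  assumes f: "yh_functional d n ((q - inverse q) / of_nat d) f" and x: "x \<in> yh_ideal d q n"
  shows "linear_ext f x = 0"
proof -
  let ?C = "carrier (yh_free n)"
  define K where "K = {x \<in> ?C. \<forall>u\<in>?C. \<forall>v\<in>?C. linear_ext f (u * x * v) = 0}"
  have "yh_ideal d q n \<subseteq> K"
  proof (rule yh_ideal_minimal)
    show "yh_relations d q n \<subseteq> K"
    proof
      fix r assume r: "r \<in> yh_relations d q n"
      have mono: "linear_ext f (wmono u * r * wmono v) = 0" if uv: "u \<in> lists (yh_gens n)" "v \<in> lists (yh_gens n)" for u v
        using r
      proof (cases rule: yh_relations_cases)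
        case (1 w w')
        from yh_functional_mono_eq[OF f mono_eq_context[OF 1(1) uv]]
        show ?thesis by (simp add: 1 algebra_simps single_mult_single linear_ext_diff)
      next
        case (2 i)
        from yh_functional_quadratic[OF f uv 2(1)]
        show ?thesis by (simp only: 2 wmono_quadratic linear_ext_diff linear_ext_add linear_ext_const_mult linear_ext_sum linear_ext_single) simp
      qed
      have "linear_ext f (u * r * v) = 0" if "u \<in> ?C" "v \<in> ?C" for u v
        using that(1)
      proof (induction rule: yh_free_induct)
        case (single w c)
        note w = single
        show ?case using that(2)
        proof (induction rule: yh_free_induct)
          case (single w' c')
          have "Poly_Mapping.single w c * r * Poly_Mapping.single w' c' = yh_const (c * c') * (wmono w * r * wmono w')"
            unfolding single_eq_const[of w c] single_eq_const[of w' c']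
            by (rule yh_const_mult_out)
          then show ?case using mono[OF w single] by (simp add: linear_ext_const_mult)
        qed (auto simp: linear_ext_add distrib_left)
      qed (auto simp: linear_ext_add distrib_right)
      then show "r \<in> K" using r yh_relations_closed unfolding K_def by blast
    qed
  next
    fix x y assume "x \<in> K" "y \<in> K"
    then show "x + y \<in> K" by (auto simp: K_def yh_free_closed distrib_left distrib_right linear_ext_add)
  next
    fix x y assume "x \<in> K" "y \<in> ?C"
    then show "y * x \<in> K" unfolding K_def
      by (auto simp: yh_free_closed mult.assoc[symmetric])
  next
    fix x y assume "x \<in> K" "y \<in> ?C"
    then show "x * y \<in> K" unfolding K_def
      by (auto simp: yh_free_closed mult.assoc)
  qed (auto simp: K_def yh_free_closed)
  then have "linear_ext f (1 * x * 1) = 0" using x unfolding K_def by (blast intro: yh_free_closed)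
  then show ?thesis by simp
qed

subsection \<open>Cosets\<close>

lemma yh_class_eq: "yh_class d q n x = {a + x | a. a \<in> yh_ideal d q n}"
  by (auto simp: yh_class_def a_r_coset_def r_coset_def)

lemma yh_class_eq_iff: "yh_class d q n x = yh_class d q n y \<longleftrightarrow> x - y \<in> yh_ideal d q n"
proof
  assume eq: "yh_class d q n x = yh_class d q n y"
  have "0 + x \<in> yh_class d q n x" unfolding yh_class_eq using yh_ideal_closed(2) by blast
  then obtain a where "a \<in> yh_ideal d q n" "x = a + y" unfolding eq yh_class_eq[of d q n y] by auto
  then show "x - y \<in> yh_ideal d q n" by simp
next
  have sub: "yh_class d q n x \<subseteq> yh_class d q n y" if xy: "x - y \<in> yh_ideal d q n" for x y
  proof
    fix b assume "b \<in> yh_class d q n x"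
    then obtain a where a: "a \<in> yh_ideal d q n" "b = a + x" unfolding yh_class_eq by auto
    then have "b = (a + (x - y)) + y" "a + (x - y) \<in> yh_ideal d q n"
      using xy yh_ideal_closed(3) by auto
    then show "b \<in> yh_class d q n y" unfolding yh_class_eq by blast
  qed
  assume xy: "x - y \<in> yh_ideal d q n"
  moreover have "y - x \<in> yh_ideal d q n" using yh_ideal_closed(6)[OF xy] by simp
  ultimately show "yh_class d q n x = yh_class d q n y" using sub by blast
qed

lemma ring_YH: "ring (YH d q n)"
  unfolding YH_def by (rule ideal.quotient_is_ring[OF ideal_yh_ideal])

lemma YH_carrier: "carrier (YH d q n) = yh_class d q n ` carrier (yh_free n)"
  by (auto simp: YH_def FactRing_def A_RCOSETS_def' yh_class_def)

lemma yh_class_hom: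
  shows "x \<in> carrier (yh_free n) \<Longrightarrow> yh_class d q n x \<in> carrier (YH d q n)"
    and "x \<in> carrier (yh_free n) \<Longrightarrow> y \<in> carrier (yh_free n) \<Longrightarrow>
      yh_class d q n x \<otimes>\<^bsub>YH d q n\<^esub> yh_class d q n y = yh_class d q n (x * y)"
    and "x \<in> carrier (yh_free n) \<Longrightarrow> y \<in> carrier (yh_free n) \<Longrightarrow>
      yh_class d q n x \<oplus>\<^bsub>YH d q n\<^esub> yh_class d q n y = yh_class d q n (x + y)"
    and "\<one>\<^bsub>YH d q n\<^esub> = yh_class d q n 1"
proof -
  have hom: "(\<lambda>x. yh_class d q n x) \<in> ring_hom (yh_free n) (YH d q n)"
    unfolding YH_def yh_class_def by (rule ideal.rcos_ring_hom[OF ideal_yh_ideal])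
  show "x \<in> carrier (yh_free n) \<Longrightarrow> yh_class d q n x \<in> carrier (YH d q n)"
    using ring_hom_closed[OF hom] by simp
  show "x \<in> carrier (yh_free n) \<Longrightarrow> y \<in> carrier (yh_free n) \<Longrightarrow>
      yh_class d q n x \<otimes>\<^bsub>YH d q n\<^esub> yh_class d q n y = yh_class d q n (x * y)"
    using ring_hom_mult[OF hom, of x y] by simp
  show "x \<in> carrier (yh_free n) \<Longrightarrow> y \<in> carrier (yh_free n) \<Longrightarrow>
      yh_class d q n x \<oplus>\<^bsub>YH d q n\<^esub> yh_class d q n y = yh_class d q n (x + y)"
    using ring_hom_add[OF hom, of x y] by simp
  show "\<one>\<^bsub>YH d q n\<^esub> = yh_class d q n 1"
    using ring_hom_one[OF hom] by simp
qed

lemma yh_free_mono: "x \<in> carrier (yh_free n) \<Longrightarrow> x \<in> carrier (yh_free (Suc n))"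
  unfolding in_yh_free using lists_gens_Suc by blast

lemma yh_ideal_mono: "yh_ideal d q n \<subseteq> yh_ideal d q (Suc n)"
proof -
  have "yh_ideal d q n \<subseteq> yh_ideal d q (Suc n) \<inter> carrier (yh_free n)"
  proof (rule yh_ideal_minimal)
    show "yh_relations d q n \<subseteq> yh_ideal d q (Suc n) \<inter> carrier (yh_free n)"
    proof
      fix r assume r: "r \<in> yh_relations d q n"
      then have "r \<in> yh_ideal d q (Suc n)"
      proof (cases rule: yh_relations_cases)
        case (1 w w')
        then show ?thesis using mono_eq_in_ideal mono_eq_mono[of d n w w' "Suc n"] by simp
      next
        case (2 i)
        then show ?thesis using quadratic_rel_in_ideal[of i "Suc n"] by simp
      qed
      then show "r \<in> yh_ideal d q (Suc n) \<inter> carrier (yh_free n)" using r yh_relations_closed by blast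
    qed
  qed (auto simp: yh_ideal_closed yh_free_closed yh_free_mono)
  then show ?thesis by blast
qed

lemma yh_incl_class: "yh_incl d q n (yh_class d q n x) = yh_class d q (Suc n) x"
proof -
  have "yh_incl d q n (yh_class d q n x) = {a + (b + x) | a b. a \<in> yh_ideal d q (Suc n) \<and> b \<in> yh_ideal d q n}"
    by (auto simp: yh_incl_def set_add_def set_mult_def yh_class_eq)
  also have "\<dots> = {a + x | a. a \<in> yh_ideal d q (Suc n)}"
  proof (intro equalityI subsetI)
    fix y assume "y \<in> {a + (b + x) | a b. a \<in> yh_ideal d q (Suc n) \<and> b \<in> yh_ideal d q n}"
    then obtain a b where "y = (a + b) + x" "a \<in> yh_ideal d q (Suc n)" "b \<in> yh_ideal d q (Suc n)"
      using yh_ideal_mono[of d q n] by (auto simp: add.assoc)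
    then show "y \<in> {a + x | a. a \<in> yh_ideal d q (Suc n)}" using yh_ideal_closed(3) by blast
  next
    fix y assume "y \<in> {a + x | a. a \<in> yh_ideal d q (Suc n)}"
    then obtain a where "y = a + (0 + x)" "a \<in> yh_ideal d q (Suc n)" by auto
    then show "y \<in> {a + (b + x) | a b. a \<in> yh_ideal d q (Suc n) \<and> b \<in> yh_ideal d q n}"
      using yh_ideal_closed(2)[of d q n] by blast
  qed
  finally show ?thesis by (simp add: yh_class_eq)
qed


subsection \<open>Uniqueness of the trace\<close>

lemma is_yh_trace_scale:
  "is_yh_trace d q \<tau> \<Longrightarrow> a \<in> carrier (YH d q n) \<Longrightarrow>
    \<tau> n (yh_class d q n (yh_const c) \<otimes>\<^bsub>YH d q n\<^esub> a) = smult c (\<tau> n a)"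
  unfolding is_yh_trace_def by blast

lemma yh_trace_word_trace:
  assumes tr: "is_yh_trace d q \<tau>"
  shows "word_trace d ((q - inverse q) / of_nat d) z (\<lambda>n w. poly (\<tau> n (yh_class d q n (wmono w))) z)"
proof -
  let ?c = "(q - inverse q) / of_nat d" and ?C = "\<lambda>n. carrier (yh_free n)"
  define F where "F n x = poly (\<tau> n (yh_class d q n x)) z" for n x
  have add: "F n (x + y) = F n x + F n y" if "x \<in> ?C n" "y \<in> ?C n" for n x y
    using tr that unfolding is_yh_trace_def F_def by (simp add: yh_class_hom flip: yh_class_hom(3))
  have scale: "F n (yh_const a * x) = a * F n x" if "x \<in> ?C n" for n a x
    using is_yh_trace_scale[OF tr, of "yh_class d q n x" n a] that unfolding F_def
    by (simp add: yh_class_hom yh_free_closed)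
  have ideal: "F n x = F n y" if "x - y \<in> yh_ideal d q n" for n x y
    using that unfolding F_def yh_class_eq_iff[symmetric] by simp
  have comm: "F n (x * y) = F n (y * x)" if "x \<in> ?C n" "y \<in> ?C n" for n x y
    using tr that unfolding is_yh_trace_def F_def by (simp add: yh_class_hom flip: yh_class_hom(2))
  have incl: "F (Suc n) x = F n x" if "x \<in> ?C n" for n x
    using tr that unfolding is_yh_trace_def F_def by (simp add: yh_class_hom flip: yh_incl_class)
  have G: "F (Suc n) (x * yg n) = z * F n x" if "n \<ge> 1" "x \<in> ?C n" for n x
  proof -
    have g: "yg n \<in> ?C (Suc n)" using that by (simp add: yg_power yh_free_closed)
    have "yh_class d q (Suc n) (x * yg n) =
      yh_incl d q n (yh_class d q n x) \<otimes>\<^bsub>YH d q (Suc n)\<^esub> yh_class d q (Suc n) (yg n)"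
      using that g by (simp add: yh_incl_class yh_class_hom yh_free_mono)
    then show ?thesis
      using tr that unfolding is_yh_trace_def F_def by (simp add: yh_class_hom)
  qed
  have T: "F (Suc n) (x * yt (Suc n) ^ k) = 0" if "k \<in> {1..<d}" "x \<in> ?C n" for n x k
  proof -
    have g: "yt (Suc n) ^ k \<in> ?C (Suc n)" using that by (simp add: yg_power yh_free_closed)
    have "yh_class d q (Suc n) (x * yt (Suc n) ^ k) =
      yh_incl d q n (yh_class d q n x) \<otimes>\<^bsub>YH d q (Suc n)\<^esub> yh_class d q (Suc n) (yt (Suc n) ^ k)"
      using that g by (simp add: yh_incl_class yh_class_hom yh_free_mono)
    then show ?thesis
      using tr that unfolding is_yh_trace_def F_def by (simp add: yh_class_hom)
  qed
  have zero: "F n 0 = 0" for n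
    using add[of 0 n 0] by (simp add: yh_free_closed)
  have sum: "F n (sum x A) = (\<Sum>i\<in>A. F n (x i))" if "finite A" "\<And>i. i \<in> A \<Longrightarrow> x i \<in> ?C n"
    for n A and x :: "nat \<Rightarrow> yh_poly"
    using that by (induction A rule: finite_induct) (simp_all add: zero add yh_free_sum)
  have "word_trace d ?c z (\<lambda>n w. F n (wmono w))"
    unfolding word_trace_def yh_functional_def
  proof (intro conjI allI impI ballI)
    fix n w w' assume "mono_eq d n w w'"
    then show "F n (wmono w) = F n (wmono w')" by (intro ideal mono_eq_in_ideal)
  next
    fix n u v i assume u: "u \<in> lists (yh_gens n)" and v: "v \<in> lists (yh_gens n)" and i: "i \<in> {1..<n}"
    let ?e = "\<lambda>s. u @ replicate s (T i) @ replicate (d - s) (T (Suc i)) @ [G i] @ v"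
    have e: "?e s \<in> lists (yh_gens n)" for s using u v i by auto
    have "wmono u * quadratic_rel d q i * wmono v \<in> yh_ideal d q n"
      using u v i by (intro yh_ideal_closed(4) yh_ideal_closed(5) quadratic_rel_in_ideal yh_free_closed(7))
    then have "F n (wmono (u @ [G i, G i] @ v)) = F n (wmono (u @ v) + yh_const ?c * (\<Sum>s<d. wmono (?e s)))"
      unfolding wmono_quadratic by (rule ideal)
    also have "\<dots> = F n (wmono (u @ v)) + F n (yh_const ?c * (\<Sum>s<d. wmono (?e s)))"
      using u v e by (intro add yh_free_closed(2,7,8) yh_free_sum) auto
    also have "F n (yh_const ?c * (\<Sum>s<d. wmono (?e s))) = ?c * F n (\<Sum>s<d. wmono (?e s))"
      by (rule scale, rule yh_free_sum, rule yh_free_closed(7), rule e)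
    also have "F n (\<Sum>s<d. wmono (?e s)) = (\<Sum>s<d. F n (wmono (?e s)))"
      by (rule sum[OF finite_lessThan], rule yh_free_closed(7), rule e)
    finally show "F n (wmono (u @ [G i, G i] @ v)) = F n (wmono (u @ v)) + ?c * (\<Sum>s<d. F n (wmono (?e s)))" .
  next
    fix n w assume "w \<in> lists (yh_gens n)"
    then show "F (Suc n) (wmono w) = F n (wmono w)" by (intro incl yh_free_closed)
  next
    fix n u v assume "u \<in> lists (yh_gens n)" "v \<in> lists (yh_gens n)"
    then show "F n (wmono (u @ v)) = F n (wmono (v @ u))"
      using comm[of "wmono u" n "wmono v"] by (simp add: single_mult_single yh_free_closed)
  next
    fix n w assume "1 \<le> n" "w \<in> lists (yh_gens n)"
    then show "F (Suc n) (wmono (w @ [G n])) = z * F n (wmono w)"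
      using G[of n "wmono w"] by (simp add: single_mult_single yh_free_closed yg_power)
  next
    fix n w k assume "w \<in> lists (yh_gens n)" "k \<in> {1..<d}"
    then show "F (Suc n) (wmono (w @ replicate k (T (Suc n)))) = 0"
      using T[of k "wmono w" n] by (simp add: single_mult_single yh_free_closed yg_power)
  qed
  then show ?thesis unfolding F_def .
qed

lemma poly_extI: "(\<And>z. poly p z = poly r z) \<Longrightarrow> p = r" for p r :: "complex poly"
  using poly_eq_poly_eq_iff by blast

text \<open>
  The pair of both traces is treated as one family of functionals with an additional Boolean parameter, whose values
  lie on the diagonal because they do so at \<open>1\<close>.
\<close>

lemma yh_trace_unique:
  assumes d: "d \<ge> 1" and \<tau>: "is_yh_trace d q \<tau>" "is_yh_trace d q \<tau>'"
  shows "\<tau> = \<tau>'"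
proof -
  let ?C = "\<lambda>n. carrier (yh_free n)"
  define S :: "(complex \<times> bool \<Rightarrow> complex) set" where "S = {f. \<forall>z. f (z, True) = f (z, False)}"
  have words: "\<tau> n (yh_class d q n (wmono w)) = \<tau>' n (yh_class d q n (wmono w))"
    if w: "w \<in> lists (yh_gens n)" for n w
  proof -
    define f where "f n w p = (if snd p then poly (\<tau> n (yh_class d q n (wmono w))) (fst p)
      else poly (\<tau>' n (yh_class d q n (wmono w))) (fst p))" for n w and p :: "complex \<times> bool"
    have "f n w \<in> S"
    proof (rule word_trace_in_closed[OF _ _ d _ _ w])
      show "closed_under (\<lambda>p. (q - inverse q) / of_nat d) S" "closed_under fst S"
        by (auto simp: closed_under_def S_def)
      show "word_trace d ((q - inverse q) / of_nat d) (fst p) (\<lambda>n w. f n w p)" for p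
        by (cases "snd p") (simp_all add: f_def yh_trace_word_trace \<tau>)
      have "wmono [] = (1 :: yh_poly)" by (simp add: one_eq_wmono)
      then show "f 0 [] \<in> S"
        using \<tau> unfolding is_yh_trace_def by (simp add: f_def S_def flip: yh_class_hom(4))
    qed
    then show ?thesis by (intro poly_extI) (simp add: f_def S_def)
  qed
  have eq: "\<tau> n (yh_class d q n x) = \<tau>' n (yh_class d q n x)" if "x \<in> ?C n" for n x
  proof -
    have tadd: "\<sigma> n (yh_class d q n (x + y)) = \<sigma> n (yh_class d q n x) + \<sigma> n (yh_class d q n y)"
      if "is_yh_trace d q \<sigma>" "x \<in> ?C n" "y \<in> ?C n" for \<sigma> x y
      using that unfolding is_yh_trace_def by (simp add: yh_class_hom flip: yh_class_hom(3))
    have scale: "\<sigma> n (yh_class d q n (yh_const a * x)) = smult a (\<sigma> n (yh_class d q n x))"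
      if "is_yh_trace d q \<sigma>" "x \<in> ?C n" for \<sigma> a x
      using is_yh_trace_scale[OF that(1), of "yh_class d q n x" n a] that
      by (simp add: yh_class_hom yh_free_closed)
    show ?thesis using that
    proof (induction rule: yh_free_induct)
      case zero
      show ?case using tadd[OF \<tau>(1), of 0 0] tadd[OF \<tau>(2), of 0 0] by (simp add: yh_free_closed)
    next
      case (single w c)
      then show ?case unfolding single_eq_const[of w c]
        by (simp add: scale[OF \<tau>(1)] scale[OF \<tau>(2)] yh_free_closed words)
    next
      case (add x y)
      then show ?case by (simp add: tadd[OF \<tau>(1)] tadd[OF \<tau>(2)])
    qed
  qed
  show ?thesis
  proof (intro ext)
    fix n a
    show "\<tau> n a = \<tau>' n a"
    proof (cases "a \<in> carrier (YH d q n)")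
      case True
      then show ?thesis using eq unfolding YH_carrier by blast
    next
      case False
      have "\<sigma> n \<in> extensional (carrier (YH d q n))" if "is_yh_trace d q \<sigma>" for \<sigma>
        using that unfolding is_yh_trace_def by blast
      from this[OF \<tau>(1)] this[OF \<tau>(2)] show ?thesis using False by (simp add: extensional_def)
    qed
  qed
qed

subsection \<open>Traces from word functionals\<close>

definition linear_ext_poly :: "(yh_gen list \<Rightarrow> complex poly) \<Rightarrow> yh_poly \<Rightarrow> complex poly" where
  "linear_ext_poly f x = (\<Sum>w\<in>Poly_Mapping.keys x. smult (Poly_Mapping.lookup x w) (f w))"

lemma poly_linear_ext_poly: "poly (linear_ext_poly f x) z = linear_ext (\<lambda>w. poly (f w) z) x"
  by (simp add: linear_ext_poly_def linear_ext_def poly_sum)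

lemma linear_ext_comm:
  assumes "\<And>u v. u \<in> lists (yh_gens n) \<Longrightarrow> v \<in> lists (yh_gens n) \<Longrightarrow> f (u @ v) = f (v @ u)"
    and "x \<in> carrier (yh_free n)" "y \<in> carrier (yh_free n)"
  shows "linear_ext f (x * y) = linear_ext f (y * x)"
  using assms(2)
proof (induction rule: yh_free_induct)
  case (single u c)
  show ?case using assms(3)
  proof (induction rule: yh_free_induct)
    case (single v c')
    then show ?case using assms(1)[OF \<open>u \<in> _\<close> single] by (simp add: single_mult_single)
  qed (auto simp: linear_ext_add distrib_left distrib_right)
qed (auto simp: linear_ext_add distrib_left distrib_right)

lemma linear_ext_mult_right:
  assumes "\<And>u. u \<in> lists (yh_gens n) \<Longrightarrow> f (u @ v) = a * g u" and "x \<in> carrier (yh_free n)"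
  shows "linear_ext f (x * wmono v) = a * linear_ext g x"
  using assms(2)
  by (induction rule: yh_free_induct) (simp_all add: linear_ext_add distrib_left distrib_right single_mult_single assms(1))

text \<open>
  The polynomials \<open>g\<close> determine a functional on cosets because their linear extension annihilates the ideal at every
  \<open>z\<close>; each axiom of the trace is an identity of polynomials that can be checked pointwise.
\<close>

lemma yh_trace_exists:
  fixes g :: "nat \<Rightarrow> yh_gen list \<Rightarrow> complex poly"
  assumes g: "\<And>z. word_trace d ((q - inverse q) / of_nat d) z (\<lambda>n w. poly (g n w) z)" and 1: "g 0 [] = 1"
  shows "\<exists>\<tau>. is_yh_trace d q \<tau> \<and>
    (\<forall>n. \<forall>x \<in> carrier (yh_free n). \<tau> n (yh_class d q n x) = linear_ext_poly (g n) x)"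
proof -
  let ?C = "\<lambda>n. carrier (yh_free n)"
  \<comment> \<open>Two representatives differ by an element of the ideal, so the choice does not matter.\<close>
  define \<tau> where "\<tau> n = restrict (\<lambda>a. linear_ext_poly (g n) (SOME x. x \<in> ?C n \<and> a = yh_class d q n x)) (carrier (YH d q n))"
    for n
  have \<tau>: "\<tau> n (yh_class d q n x) = linear_ext_poly (g n) x" if x: "x \<in> ?C n" for n x
  proof -
    define y where "y = (SOME y. y \<in> ?C n \<and> yh_class d q n x = yh_class d q n y)"
    have y: "y \<in> ?C n" "yh_class d q n x = yh_class d q n y"
      using someI[of "\<lambda>y. y \<in> ?C n \<and> yh_class d q n x = yh_class d q n y" x] x unfolding y_def by auto
    have "linear_ext_poly (g n) y = linear_ext_poly (g n) x"
    proof (rule poly_extI)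
      fix z
      have "linear_ext (\<lambda>w. poly (g n w) z) (x - y) = 0"
        using y(2) yh_functional_vanishes[OF word_traceD(1)[OF g]] unfolding yh_class_eq_iff by blast
      then show "poly (linear_ext_poly (g n) y) z = poly (linear_ext_poly (g n) x) z" by (simp add: poly_linear_ext_poly linear_ext_diff)
    qed
    moreover have "\<tau> n (yh_class d q n x) = linear_ext_poly (g n) y"
      using x by (simp add: \<tau>_def y_def yh_class_hom)
    ultimately show ?thesis by simp
  qed
  have one: "g n [] = 1" for n
  proof (induction n)
    case (Suc n)
    show ?case using word_traceD(2)[OF g, of "[]" n] Suc by (intro poly_extI) simp
  qed (rule 1)
  have "is_yh_trace d q \<tau>"
    unfolding is_yh_trace_def YH_carrier ball_simps(9)
  proof (intro conjI allI impI ballI)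
    fix n show "\<tau> n \<in> extensional (yh_class d q n ` ?C n)"
      unfolding \<tau>_def YH_carrier by simp
  next
    fix n x y assume "x \<in> ?C n" "y \<in> ?C n"
    then show "\<tau> n (yh_class d q n x \<oplus>\<^bsub>YH d q n\<^esub> yh_class d q n y) = \<tau> n (yh_class d q n x) + \<tau> n (yh_class d q n y)"
      by (intro poly_extI) (simp add: yh_class_hom \<tau> yh_free_closed poly_linear_ext_poly linear_ext_add)
  next
    fix n c x assume "x \<in> ?C n"
    then show "\<tau> n (yh_class d q n (yh_const c) \<otimes>\<^bsub>YH d q n\<^esub> yh_class d q n x) = smult c (\<tau> n (yh_class d q n x))"
      by (intro poly_extI) (simp add: yh_class_hom \<tau> yh_free_closed poly_linear_ext_poly linear_ext_const_mult)
  next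
    fix n x assume x: "x \<in> ?C n"
    have "linear_ext (\<lambda>w. poly (g (Suc n) w) z) x = linear_ext (\<lambda>w. poly (g n w) z) x" for z
      unfolding linear_ext_def
      by (intro sum.cong HOL.refl arg_cong2[where f = "(*)"] word_traceD(2)[OF g])
        (use x in \<open>auto simp: in_yh_free\<close>)
    then show "\<tau> (Suc n) (yh_incl d q n (yh_class d q n x)) = \<tau> n (yh_class d q n x)"
      using x by (intro poly_extI) (simp add: yh_incl_class \<tau> yh_free_mono poly_linear_ext_poly)
  next
    fix n x y assume xy: "x \<in> ?C n" "y \<in> ?C n"
    then show "\<tau> n (yh_class d q n x \<otimes>\<^bsub>YH d q n\<^esub> yh_class d q n y) =
        \<tau> n (yh_class d q n y \<otimes>\<^bsub>YH d q n\<^esub> yh_class d q n x)"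
      using linear_ext_comm[of n "\<lambda>w. poly (g n w) z" for z, OF word_traceD(3)[OF g] xy]
      by (intro poly_extI) (simp add: yh_class_hom \<tau> yh_free_closed poly_linear_ext_poly)
  next
    fix n
    show "\<tau> n \<one>\<^bsub>YH d q n\<^esub> = 1"
      by (rule poly_extI) (simp add: yh_class_hom(4) \<tau> yh_free_closed poly_linear_ext_poly one)
  next
    fix n x assume n: "1 \<le> n" and x: "x \<in> ?C n"
    have "linear_ext (\<lambda>w. poly (g (Suc n) w) z) (x * yg n) = z * linear_ext (\<lambda>w. poly (g n w) z) x" for z
      unfolding yg_power using word_traceD(4)[OF g n] by (intro linear_ext_mult_right[OF _ x]) simp
    moreover have "yg n \<in> ?C (Suc n)" using n by (simp add: yg_power yh_free_closed)
    ultimately show "\<tau> (Suc n) (yh_incl d q n (yh_class d q n x) \<otimes>\<^bsub>YH d q (Suc n)\<^esub> yh_class d q (Suc n) (yg n))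
         = [:0, 1:] * \<tau> n (yh_class d q n x)"
      using x by (intro poly_extI) (simp add: yh_incl_class yh_class_hom \<tau> yh_free_closed yh_free_mono poly_linear_ext_poly)
  next
    fix n x k assume x: "x \<in> ?C n" and k: "k \<in> {1..<d}"
    have "linear_ext (\<lambda>w. poly (g (Suc n) w) z) (x * yt (Suc n) ^ k) = 0 * linear_ext (\<lambda>w. poly (g n w) z) x" for z
      unfolding yg_power using word_traceD(5)[OF g _ k] by (intro linear_ext_mult_right[OF _ x]) simp
    moreover have "yt (Suc n) ^ k \<in> ?C (Suc n)" by (simp add: yg_power yh_free_closed)
    ultimately show "\<tau> (Suc n) (yh_incl d q n (yh_class d q n x) \<otimes>\<^bsub>YH d q (Suc n)\<^esub> yh_class d q (Suc n) (yt (Suc n) ^ k)) = 0"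
      using x by (intro poly_extI) (simp add: yh_incl_class yh_class_hom \<tau> yh_free_closed yh_free_mono poly_linear_ext_poly)
  qed
  then show ?thesis using \<tau> by blast
qed

lemma yh_trace_eq:
  assumes "d \<ge> 1" "\<And>z. word_trace d ((q - inverse q) / of_nat d) z (\<lambda>n w. poly (g n w) z)" "g 0 [] = 1"
    and "x \<in> carrier (yh_free n)"
  shows "yh_trace d q n (yh_class d q n x) = linear_ext_poly (g n) x"
proof -
  obtain \<tau> where \<tau>: "is_yh_trace d q \<tau>"
      "\<And>n x. x \<in> carrier (yh_free n) \<Longrightarrow> \<tau> n (yh_class d q n x) = linear_ext_poly (g n) x"
    using yh_trace_exists[OF assms(2,3)] by blast
  have "yh_trace d q = \<tau>"
    unfolding yh_trace_def using \<tau>(1) yh_trace_unique[OF assms(1)] by (intro the_equality) auto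
  then show ?thesis using \<tau>(2) assms(4) by simp
qed


section \<open>The trace as a polynomial\<close>

text \<open>
  Polynomials in two variables: the outer variable stands for \<open>h = q - 1/q\<close>, the inner one for \<open>d z\<close>.
\<close>

definition eval2 :: "complex poly poly \<Rightarrow> complex \<Rightarrow> complex \<Rightarrow> complex" where
  "eval2 P h z = poly (poly P [:h:]) z"

lemma eval2_simps [simp]:
  "eval2 0 h z = 0" "eval2 1 h z = 1" "eval2 (P + Q) h z = eval2 P h z + eval2 Q h z"
  "eval2 (P - Q) h z = eval2 P h z - eval2 Q h z"
  "eval2 (P * Q) h z = eval2 P h z * eval2 Q h z" "eval2 (sum F A) h z = (\<Sum>i\<in>A. eval2 (F i) h z)"
  by (simp_all add: eval2_def poly_sum)

definition hvar :: "complex \<Rightarrow> complex poly poly" where "hvar a = [:0, [:a:]:]"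
definition zvar :: "complex \<Rightarrow> complex poly poly" where "zvar a = [:[:0, a:]:]"

lemma eval2_vars [simp]:
  "eval2 (hvar a) h z = a * h" "eval2 (zvar a) h z = a * z"
  by (simp_all add: eval2_def hvar_def zvar_def)

text \<open>
  Parameters at which state sums exist: \<open>q\<close> runs through the integers from \<open>2\<close> on, so that \<open>q\<close> is not a root of unity,
  and the number of labels is \<open>m + 1\<close>.
\<close>

definition sample_q :: "nat \<Rightarrow> complex" where "sample_q k = of_nat (k + 2)"
definition sample_h :: "nat \<Rightarrow> complex" where "sample_h k = sample_q k - inverse (sample_q k)"
definition sample_z :: "nat \<Rightarrow> nat \<Rightarrow> complex" where "sample_z k m = state_z (sample_q k) (Suc m)"

lemma sample_q_nonzero [simp]: "sample_q k \<noteq> 0"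
  unfolding sample_q_def by (metis add_2_eq_Suc' nat.distinct(1) of_nat_eq_0_iff)

lemma norm_sample_q: "norm (sample_q k) = real k + 2"
  unfolding sample_q_def by (metis norm_of_nat of_nat_add of_nat_numeral)

lemma sample_q_power_ne_1: "inverse (sample_q k) ^ (2 * Suc m) \<noteq> 1"
proof
  assume "inverse (sample_q k) ^ (2 * Suc m) = 1"
  then have "norm (sample_q k) ^ (2 * Suc m) = 1"
    by (metis norm_one norm_power power_inverse inverse_eq_1_iff)
  moreover have "1 < norm (sample_q k) ^ (2 * Suc m)" unfolding norm_sample_q by (rule one_less_power) auto
  ultimately show False by simp
qed

lemma sample_h_nonzero: "sample_h k \<noteq> 0"
proof
  assume "sample_h k = 0"
  then have "sample_q k * sample_q k = 1" unfolding sample_h_def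
    by (metis sample_q_nonzero eq_iff_diff_eq_0 right_inverse)
  moreover have "inverse (sample_q k) ^ (2 * Suc 0) = inverse (sample_q k * sample_q k)" by (simp add: power2_eq_square)
  ultimately have "inverse (sample_q k) ^ (2 * Suc 0) = 1" by simp
  then show False using sample_q_power_ne_1 by blast
qed

lemma sample_geometric_sum:
  "sample_h k * (\<Sum>a<Suc m. inverse (sample_q k) ^ (2 * a + 1)) = 1 - inverse (sample_q k) ^ (2 * Suc m)"
  using q_powers_telescope[of "sample_q k" "Suc m"] unfolding sample_h_def sum_distrib_left by simp

lemma sample_sum_nonzero: "(\<Sum>a<Suc m. inverse (sample_q k) ^ (2 * a + 1)) \<noteq> 0"
  using sample_geometric_sum[of k m] sample_q_power_ne_1[of k m] by auto

text \<open>
  In closed form \<open>d z = h / (1 - q\<^sup>-\<^sup>2\<^sup>N)\<close> with \<open>N = m + 1\<close> labels, so for fixed \<open>q\<close> there are infinitely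
  many values.
\<close>

lemma sample_z_eq: "sample_z k m * (1 - inverse (sample_q k) ^ (2 * Suc m)) = sample_h k"
  using sample_geometric_sum[of k m, symmetric] sample_sum_nonzero[where m = m and k = k]
  unfolding sample_z_def state_z_def by simp

lemma inj_sample_z: "inj (sample_z k)"
proof
  fix m m' assume "sample_z k m = sample_z k m'"
  then have "sample_z k m * (1 - inverse (sample_q k) ^ (2 * Suc m)) = sample_z k m * (1 - inverse (sample_q k) ^ (2 * Suc m'))"
    using sample_z_eq by metis
  moreover have "sample_z k m \<noteq> 0" using sample_z_eq[of k m] sample_h_nonzero by auto
  ultimately have "inverse (sample_q k) ^ (2 * Suc m) = inverse (sample_q k) ^ (2 * Suc m')" by simp
  then have "norm (sample_q k) ^ (2 * Suc m) = norm (sample_q k) ^ (2 * Suc m')"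
    by (metis power_inverse inverse_eq_iff_eq norm_power)
  then have "2 * Suc m = 2 * Suc m'"
    unfolding norm_sample_q by (rule power_inject_exp[THEN iffD1, rotated]) simp
  then show "m = m'" by simp
qed

lemma inj_sample_h: "inj sample_h"
proof
  fix k k' assume eq: "sample_h k = sample_h k'"
  have "(sample_q k - sample_q k') * (1 + inverse (sample_q k * sample_q k')) = sample_h k - sample_h k'"
    unfolding sample_h_def by (simp add: field_simps)
  also have "\<dots> = 0" using eq by simp
  finally have "sample_q k = sample_q k' \<or> 1 + inverse (sample_q k * sample_q k') = 0" by simp
  moreover have "1 + inverse (sample_q k * sample_q k') \<noteq> 0"
  proof
    assume "1 + inverse (sample_q k * sample_q k') = 0"
    then have "inverse (sample_q k * sample_q k') = - 1" by (simp add: add_eq_0_iff)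
    then have "sample_q k * sample_q k' = - 1" by (metis inverse_inverse_eq inverse_minus_eq inverse_1)
    moreover have "of_nat ((k + 2) * (k' + 2) + 1) = sample_q k * sample_q k' + 1"
      by (simp only: sample_q_def of_nat_mult of_nat_add of_nat_1)
    ultimately have "(of_nat ((k + 2) * (k' + 2) + 1) :: complex) = 0" by simp
    then show False by (simp only: of_nat_eq_0_iff)
  qed
  ultimately show "k = k'" by (simp add: sample_q_def)
qed

text \<open>
  Zariski density of the sample points: for each sampled \<open>h\<close> the difference is a polynomial in the inner variable with
  infinitely many roots, so it vanishes, and then the difference has infinitely many roots in the outer variable.
\<close>

lemma eval2_eqI:
  assumes "\<And>k m. eval2 P (sample_h k) (sample_z k m) = eval2 Q (sample_h k) (sample_z k m)"
  shows "P = Q"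
proof -
  define R where "R = P - Q"
  have R: "eval2 R (sample_h k) (sample_z k m) = 0" for k m using assms by (simp add: R_def)
  have "poly R [:sample_h k:] = 0" for k
  proof (rule ccontr)
    assume "poly R [:sample_h k:] \<noteq> 0"
    then have "finite {z. poly (poly R [:sample_h k:]) z = 0}" by (rule poly_roots_finite)
    moreover have "range (sample_z k) \<subseteq> {z. poly (poly R [:sample_h k:]) z = 0}" using R by (auto simp: eval2_def)
    ultimately have "finite (range (sample_z k))" by (rule finite_subset[rotated])
    then show False using inj_sample_z finite_imageD infinite_UNIV_nat by blast
  qed
  then have sub: "range (\<lambda>k. [:sample_h k:]) \<subseteq> {z. poly R z = 0}" by auto
  have "inj (\<lambda>k. [:sample_h k:])" using inj_sample_h by (auto simp: inj_def)
  then have "infinite (range (\<lambda>k. [:sample_h k:]))" using finite_imageD infinite_UNIV_nat by blast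
  then have "R = 0" using poly_roots_finite[of R] finite_subset[OF sub] by blast
  then show ?thesis by (simp add: R_def)
qed

text \<open>
  The polynomial is unique by \<open>eval2_eqI\<close> and exists by \<open>word_trace_in_closed\<close>, since polynomial functions of the sample
  parameters are closed under all operations that the reduction uses.
\<close>

definition trace_poly :: "nat \<Rightarrow> nat \<Rightarrow> yh_gen list \<Rightarrow> complex poly poly" where
  "trace_poly d n w = (SOME P. \<forall>k m. eval2 P (sample_h k) (sample_z k m) = state_trace d (sample_q k) (Suc m) n w)"

lemma eval2_trace_poly:
  assumes d: "d \<ge> 1" and w: "w \<in> lists (yh_gens n)"
  shows "eval2 (trace_poly d n w) (sample_h k) (sample_z k m) = state_trace d (sample_q k) (Suc m) n w"
proof -
  define S :: "(nat \<times> nat \<Rightarrow> complex) set" where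
    "S = {f. \<exists>P. \<forall>k m. f (k, m) = eval2 P (sample_h k) (sample_z k m)}"
  let ?c = "\<lambda>p. sample_h (fst p) / of_nat d" and ?z = "\<lambda>p. sample_z (fst p) (snd p) / of_nat d"
  have "(\<lambda>p. state_trace d (sample_q (fst p)) (Suc (snd p)) n w) \<in> S"
  proof (rule word_trace_in_closed[where c = ?c and z = ?z and
        \<tau> = "\<lambda>n w p. state_trace d (sample_q (fst p)) (Suc (snd p)) n w", OF _ _ d _ _ w])
    have mult: "(\<lambda>p. eval2 R (sample_h (fst p)) (sample_z (fst p) (snd p)) * f p) \<in> S" if f: "f \<in> S" for R f
    proof -
      obtain P where "\<forall>k m. f (k, m) = eval2 P (sample_h k) (sample_z k m)" using f unfolding S_def by blast
      then show ?thesis unfolding S_def by (intro CollectI exI[of _ "R * P"]) simp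
    qed
    have add: "(\<lambda>p. f p + g p) \<in> S" if "f \<in> S" "g \<in> S" for f g
    proof -
      obtain P Q where "\<forall>k m. f (k, m) = eval2 P (sample_h k) (sample_z k m)" "\<forall>k m. g (k, m) = eval2 Q (sample_h k) (sample_z k m)"
        using \<open>f \<in> S\<close> \<open>g \<in> S\<close> unfolding S_def by blast
      then show ?thesis unfolding S_def by (intro CollectI exI[of _ "P + Q"]) simp
    qed
    have zero: "(\<lambda>p. 0) \<in> S" unfolding S_def by (intro CollectI exI[of _ 0]) simp
    show "closed_under ?c S"
      unfolding closed_under_def using add zero mult[of _ "hvar (1 / of_nat d)"] by simp
    show "closed_under ?z S"
      unfolding closed_under_def using add zero mult[of _ "zvar (1 / of_nat d)"] by simp
    show "word_trace d (?c p) (?z p) (\<lambda>n w. state_trace d (sample_q (fst p)) (Suc (snd p)) n w)" for p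
      using word_trace_state_trace[OF sample_q_nonzero d sample_sum_nonzero, of "fst p" "snd p"]
      by (simp add: sample_h_def sample_z_def)
    show "(\<lambda>p. state_trace d (sample_q (fst p)) (Suc (snd p)) 0 []) \<in> S"
      unfolding state_trace_empty S_def by (intro CollectI exI[of _ 1]) simp
  qed
  then have "\<exists>P. \<forall>k m. eval2 P (sample_h k) (sample_z k m) = state_trace d (sample_q k) (Suc m) n w"
    unfolding S_def by auto
  from someI_ex[OF this] show ?thesis unfolding trace_poly_def by blast
qed

lemma trace_poly_empty: "d \<ge> 1 \<Longrightarrow> trace_poly d 0 [] = 1"
  by (rule eval2_eqI) (simp add: eval2_trace_poly state_trace_empty)

text \<open>
  Each axiom is an equality of two polynomials that holds at the sample points, hence identically. This is how the trace
  reaches values of \<open>q\<close> at which the state sums are not available.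
\<close>

lemma word_trace_trace_poly:
  assumes d: "d \<ge> 1"
  shows "word_trace d (h / of_nat d) (z / of_nat d) (\<lambda>n w. eval2 (trace_poly d n w) h z)"
proof -
  let ?c = "hvar (1 / of_nat d)" and ?z = "zvar (1 / of_nat d)"
  note st = word_traceD[OF word_trace_state_trace[OF sample_q_nonzero d sample_sum_nonzero]]
  note ev = eval2_trace_poly[OF d]
  show ?thesis
    unfolding word_trace_def yh_functional_def
  proof (intro conjI allI impI ballI)
    fix n w w' assume w: "mono_eq d n w w'"
    then have "trace_poly d n w = trace_poly d n w'"
      using mono_eq_lists[OF w] yh_functional_mono_eq[OF st(1) w] by (intro eval2_eqI) (simp add: ev)
    then show "eval2 (trace_poly d n w) h z = eval2 (trace_poly d n w') h z" by simp
  next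
    fix n u v i assume uv: "u \<in> lists (yh_gens n)" "v \<in> lists (yh_gens n)" and i: "i \<in> {1..<n}"
    let ?e = "\<lambda>s. u @ replicate s (T i) @ replicate (d - s) (T (Suc i)) @ [G i] @ v"
    have e: "?e s \<in> lists (yh_gens n)" for s using uv i by auto
    have g: "u @ [G i, G i] @ v \<in> lists (yh_gens n)" "u @ v \<in> lists (yh_gens n)" using uv i by auto
    have "trace_poly d n (u @ [G i, G i] @ v) = trace_poly d n (u @ v) + ?c * (\<Sum>s<d. trace_poly d n (?e s))"
    proof (rule eval2_eqI)
      fix k m
      show "eval2 (trace_poly d n (u @ [G i, G i] @ v)) (sample_h k) (sample_z k m) =
        eval2 (trace_poly d n (u @ v) + ?c * (\<Sum>s<d. trace_poly d n (?e s))) (sample_h k) (sample_z k m)"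
        using yh_functional_quadratic[OF st(1) uv i, of k m]
        by (simp only: eval2_simps eval2_vars ev[OF e] ev[OF g(1)] ev[OF g(2)]) (simp add: sample_h_def)
    qed
    then show "eval2 (trace_poly d n (u @ [G i, G i] @ v)) h z = eval2 (trace_poly d n (u @ v)) h z +
        h / of_nat d * (\<Sum>s<d. eval2 (trace_poly d n (?e s)) h z)" by simp
  next
    fix n w assume "w \<in> lists (yh_gens n)"
    then have "trace_poly d (Suc n) w = trace_poly d n w"
      using st(2) by (intro eval2_eqI) (simp add: ev del: in_lists_conv_set)
    then show "eval2 (trace_poly d (Suc n) w) h z = eval2 (trace_poly d n w) h z" by simp
  next
    fix n u v assume "u \<in> lists (yh_gens n)" "v \<in> lists (yh_gens n)"
    then have "trace_poly d n (u @ v) = trace_poly d n (v @ u)"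
      using st(3)[of u n v] by (intro eval2_eqI) (simp add: ev del: in_lists_conv_set)
    then show "eval2 (trace_poly d n (u @ v)) h z = eval2 (trace_poly d n (v @ u)) h z" by simp
  next
    fix n :: nat and w assume n: "1 \<le> n" and w: "w \<in> lists (yh_gens n)"
    have g: "w @ [G n] \<in> lists (yh_gens (Suc n))" using n w by auto
    have "trace_poly d (Suc n) (w @ [G n]) = ?z * trace_poly d n w"
      using st(4)[OF n w] by (intro eval2_eqI) (simp add: ev[OF g] ev[OF w] flip: sample_z_def)
    then show "eval2 (trace_poly d (Suc n) (w @ [G n])) h z = z / of_nat d * eval2 (trace_poly d n w) h z"
      by simp
  next
    fix n :: nat and w k assume w: "w \<in> lists (yh_gens n)" and k: "k \<in> {1..<d}"
    have g: "w @ replicate k (T (Suc n)) \<in> lists (yh_gens (Suc n))" using w by auto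
    have "trace_poly d (Suc n) (w @ replicate k (T (Suc n))) = 0"
      using st(5)[OF w k] by (intro eval2_eqI) (simp add: ev[OF g])
    then show "eval2 (trace_poly d (Suc n) (w @ replicate k (T (Suc n)))) h z = 0" by simp
  qed
qed

section \<open>Braids\<close>

text \<open>
  In the algebra \<open>g\<^sub>i\<^sup>-\<^sup>1 = g\<^sub>i - (q - 1/q) e\<^sub>i\<close>. This evaluates a functional on the product of a word and a braid by
  expanding the inverse generators; \<open>braid_trace_poly\<close> does the same for polynomials and \<open>braid_elem\<close> in
  the free algebra.
\<close>

fun braid_expand ::
    "nat \<Rightarrow> complex \<Rightarrow> (yh_gen list \<Rightarrow> complex) \<Rightarrow> yh_gen list \<Rightarrow> braid_gen list \<Rightarrow> complex" where
  "braid_expand d c f u [] = f u"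
| "braid_expand d c f u (Sigma i # \<beta>) = braid_expand d c f (u @ [G i]) \<beta>"
| "braid_expand d c f u (SigmaInv i # \<beta>) = braid_expand d c f (u @ [G i]) \<beta> -
     c * (\<Sum>s<d. braid_expand d c f (u @ replicate s (T i) @ replicate (d - s) (T (Suc i))) \<beta>)"

fun braid_trace_poly :: "nat \<Rightarrow> nat \<Rightarrow> yh_gen list \<Rightarrow> braid_gen list \<Rightarrow> complex poly poly" where
  "braid_trace_poly d n u [] = trace_poly d n u"
| "braid_trace_poly d n u (Sigma i # \<beta>) = braid_trace_poly d n (u @ [G i]) \<beta>"
| "braid_trace_poly d n u (SigmaInv i # \<beta>) = braid_trace_poly d n (u @ [G i]) \<beta> -
     hvar (1 / of_nat d) *
     (\<Sum>s<d. braid_trace_poly d n (u @ replicate s (T i) @ replicate (d - s) (T (Suc i))) \<beta>)"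

fun braid_elem :: "nat \<Rightarrow> complex \<Rightarrow> braid_gen list \<Rightarrow> yh_poly" where
  "braid_elem d q [] = 1"
| "braid_elem d q (Sigma i # \<beta>) = yg i * braid_elem d q \<beta>"
| "braid_elem d q (SigmaInv i # \<beta>) = (yg i - yh_const (q - inverse q) * ye d i) * braid_elem d q \<beta>"


lemma eval2_braid_trace_poly:
  "eval2 (braid_trace_poly d n u \<beta>) h z = braid_expand d (h / of_nat d) (\<lambda>w. eval2 (trace_poly d n w) h z) u \<beta>"
proof (induction \<beta> arbitrary: u)
  case (Cons x \<beta>)
  then show ?case by (cases x) simp_all
qed simp

lemma braid_words_Cons [simp]:
  "x # \<beta> \<in> braid_words n \<longleftrightarrow> braid_idx x \<in> {1..<n} \<and> \<beta> \<in> braid_words n"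
  by (auto simp: braid_words_def)

lemma linear_ext_braid_elem:
  "linear_ext f (wmono u * braid_elem d q \<beta>) = braid_expand d ((q - inverse q) / of_nat d) f u \<beta>"
proof (induction \<beta> arbitrary: u)
  case (Cons x \<beta>)
  show ?case
  proof (cases x)
    case (Sigma i)
    then show ?thesis using Cons[of "u @ [G i]"]
      by (simp add: yg_power single_mult_single flip: mult.assoc)
  next
    case (SigmaInv i)
    let ?e = "\<lambda>s. replicate s (T i) @ replicate (d - s) (T (Suc i))"
    have "wmono u * (yh_const (q - inverse q) * ye d i) = yh_const ((q - inverse q) / of_nat d) * (\<Sum>s<d. wmono (u @ ?e s))"
    proof -
      have "wmono u * (yh_const (q - inverse q) * ye d i) =
          yh_const (q - inverse q) * wmono u * ye d i"
        by (simp only: mult.assoc[symmetric] yh_const_commute[of _ "wmono u"])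
      also have "\<dots> = yh_const (q - inverse q) * (wmono u * yh_const (1 / of_nat d)) * (\<Sum>s<d. wmono (?e s))"
        unfolding ye_eq by (simp only: mult.assoc)
      also have "\<dots> = yh_const ((q - inverse q) / of_nat d) * (wmono u * (\<Sum>s<d. wmono (?e s)))"
        unfolding yh_const_commute[symmetric] by (simp add: yh_const_mult flip: mult.assoc)
      finally show ?thesis by (simp add: sum_distrib_left single_mult_single)
    qed
    then have "wmono u * braid_elem d q (x # \<beta>) = wmono (u @ [G i]) * braid_elem d q \<beta> -
        yh_const ((q - inverse q) / of_nat d) * (\<Sum>s<d. wmono (u @ ?e s) * braid_elem d q \<beta>)"
      unfolding SigmaInv
      by (simp add: yg_power single_mult_single sum_distrib_right left_diff_distrib right_diff_distrib flip: mult.assoc)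
         (simp add: mult.assoc sum_distrib_right)
    then show ?thesis
      by (simp add: linear_ext_diff linear_ext_const_mult linear_ext_sum Cons SigmaInv)
  qed
qed simp

lemma ye_closed: "i \<in> {1..<n} \<Longrightarrow> ye d i \<in> carrier (yh_free n)"
  unfolding ye_eq by (intro yh_free_closed yh_free_sum) auto

lemma braid_elem_closed: "\<beta> \<in> braid_words n \<Longrightarrow> braid_elem d q \<beta> \<in> carrier (yh_free n)"
proof (induction \<beta>)
  case (Cons x \<beta>)
  then show ?case
    by (cases x) (auto intro!: yh_free_closed ye_closed simp: yg_power)
qed (simp add: yh_free_closed)

text \<open>
  The quadratic relation makes \<open>g\<^sub>i - (q - 1/q) e\<^sub>i\<close> a left inverse. A right inverse is obtained by moving \<open>e\<^sub>i\<close> through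
  \<open>g\<^sub>i\<close>, which exchanges \<open>t\<^sub>i\<close> and \<open>t\<^sub>i\<^sub>+\<^sub>1\<close>; the two inverses then coincide.
\<close>

lemma inv_yg_class:
  assumes i: "i \<in> {1..<n}"
  shows "inv\<^bsub>YH d q n\<^esub> (yh_class d q n (yg i)) = yh_class d q n (yg i - yh_const (q - inverse q) * ye d i)"
proof -
  let ?h = "q - inverse q" and ?C = "carrier (yh_free n)"
  let ?e = "\<lambda>s. replicate s (T i) @ replicate (d - s) (T (Suc i))"
  let ?f = "\<lambda>s. replicate s (T (Suc i)) @ replicate (d - s) (T i)"
  interpret YH: ring "YH d q n" by (rule ring_YH)
  define y where "y = yg i - yh_const ?h * ye d i"
  define y' where "y' = yg i - yh_const (?h / of_nat d) * (\<Sum>s<d. wmono (?f s))"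
  have g: "yg i \<in> ?C" using i by (simp add: yg_power yh_free_closed)
  have y: "y \<in> ?C" unfolding y_def using i g by (intro yh_free_closed ye_closed)
  have "?f s \<in> lists (yh_gens n)" for s using i by auto
  then have y': "y' \<in> ?C"
    unfolding y'_def by (intro yh_free_closed(2,3,7,8) yh_free_sum g)
  have "y * yg i - 1 = quadratic_rel d q i"
    unfolding quadratic_rel_eq[symmetric] y_def by (simp add: algebra_simps power2_eq_square)
  then have 1: "y * yg i - 1 \<in> yh_ideal d q n" using quadratic_rel_in_ideal[OF i] by metis
  have tg: "mono_eq d n ([G i] @ ?f s) (?e s @ [G i])" for s
  proof -
    have t: "mono_eq d n [T i, G i] [G i, T (Suc i)]" "mono_eq d n [T (Suc i), G i] [G i, T i]"
      using mono_eq.TG[of i n i d] mono_eq.TG[of i n "Suc i" d] i by auto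
    have "mono_eq d n (replicate s (T i) @ [G i]) ([G i] @ replicate s (T (Suc i)))"
      using i t(1) by (intro mono_eq_move_power) auto
    then have a: "mono_eq d n ([G i] @ replicate s (T (Suc i))) (replicate s (T i) @ [G i])"
      by (rule mono_eq.sym)
    have "mono_eq d n (replicate (d - s) (T (Suc i)) @ [G i]) ([G i] @ replicate (d - s) (T i))"
      using i t(2) by (intro mono_eq_move_power) auto
    then have b: "mono_eq d n ([G i] @ replicate (d - s) (T i)) (replicate (d - s) (T (Suc i)) @ [G i])"
      by (rule mono_eq.sym)
    have "mono_eq d n ([] @ ([G i] @ replicate s (T (Suc i))) @ replicate (d - s) (T i))
        ([] @ (replicate s (T i) @ [G i]) @ replicate (d - s) (T i))"
      using i by (intro mono_eq_context a) auto
    also have "mono_eq d n (replicate s (T i) @ ([G i] @ replicate (d - s) (T i)) @ [])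
        (replicate s (T i) @ (replicate (d - s) (T (Suc i)) @ [G i]) @ [])"
      using i by (intro mono_eq_context b) auto
    hence "mono_eq d n ([] @ (replicate s (T i) @ [G i]) @ replicate (d - s) (T i))
        (?e s @ [G i])" by simp
    finally show ?thesis by simp
  qed
  have "yg i * y' - 1 = quadratic_rel d q i + yh_const (?h / of_nat d) *
      (\<Sum>s<d. wmono (?e s @ [G i]) - wmono ([G i] @ ?f s))"
  proof -
    have "yg i * y' = wmono [G i, G i] - yh_const (?h / of_nat d) * (\<Sum>s<d. wmono ([G i] @ ?f s))"
    proof -
      have "yg i * (yh_const (?h / of_nat d) * (\<Sum>s<d. wmono (?f s))) =
        yh_const (?h / of_nat d) * (yg i * (\<Sum>s<d. wmono (?f s)))"
        by (simp only: mult.assoc[symmetric] yh_const_commute[of _ "yg i"])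
      then show ?thesis
        unfolding y'_def right_diff_distrib by (simp add: yg_power single_mult_single sum_distrib_left)
    qed
    then show ?thesis
      by (simp add: quadratic_rel_def one_eq_wmono sum_subtractf right_diff_distrib)
  qed
  also have "\<dots> \<in> yh_ideal d q n"
  proof -
    have "wmono (?e s @ [G i]) - wmono ([G i] @ ?f s) \<in> yh_ideal d q n" for s
      by (rule mono_eq_in_ideal[OF mono_eq.sym[OF tg]])
    then have "(\<Sum>s<k. wmono (?e s @ [G i]) - wmono ([G i] @ ?f s)) \<in> yh_ideal d q n" for k
      by (induction k) (simp_all add: yh_ideal_closed(2,3))
    then show ?thesis
      by (intro yh_ideal_closed(3) yh_ideal_closed(5) quadratic_rel_in_ideal i yh_free_closed(8))
  qed
  finally have 2: "yg i * y' - 1 \<in> yh_ideal d q n" .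
  have l: "yh_class d q n y \<otimes>\<^bsub>YH d q n\<^esub> yh_class d q n (yg i) = \<one>\<^bsub>YH d q n\<^esub>"
    using 1 y g by (simp add: yh_class_hom yh_class_eq_iff)
  have r: "yh_class d q n (yg i) \<otimes>\<^bsub>YH d q n\<^esub> yh_class d q n y' = \<one>\<^bsub>YH d q n\<^esub>"
    using 2 y' g by (simp add: yh_class_hom yh_class_eq_iff)
  have c: "yh_class d q n (yg i) \<in> carrier (YH d q n)" "yh_class d q n y \<in> carrier (YH d q n)"
      "yh_class d q n y' \<in> carrier (YH d q n)"
    using y y' g by (simp_all add: yh_class_hom)
  have "yh_class d q n y = yh_class d q n y'"
    by (rule YH.inv_unique[OF l r c])
  then show ?thesis
    using YH.inv_unique'[OF c(1,2)] l r unfolding y_def by simp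
qed

lemma yh_braid_eq:
  "\<beta> \<in> braid_words n \<Longrightarrow> yh_braid d q n \<beta> = yh_class d q n (braid_elem d q \<beta>)"
proof (induction \<beta>)
  case Nil
  then show ?case by (simp add: yh_braid_def yh_class_hom)
next
  case (Cons x \<beta>)
  then have eq: "yh_braid d q n (x # \<beta>) = yh_braid_gen d q n x \<otimes>\<^bsub>YH d q n\<^esub> yh_class d q n (braid_elem d q \<beta>)"
    by (simp add: yh_braid_def)
  have B: "braid_elem d q \<beta> \<in> carrier (yh_free n)" using Cons braid_elem_closed by simp
  have g: "yg (braid_idx x) \<in> carrier (yh_free n)" "ye d (braid_idx x) \<in> carrier (yh_free n)"
    using Cons by (auto simp: yg_power yh_free_closed ye_closed)
  show ?case
  proof (cases x)
    case (Sigma i)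
    then show ?thesis using eq B g by (simp add: yh_class_hom)
  next
    case (SigmaInv i)
    moreover have "yg i - yh_const (q - inverse q) * ye d i \<in> carrier (yh_free n)"
      using g SigmaInv by (intro yh_free_closed) auto
    ultimately show ?thesis using eq B Cons by (simp add: yh_class_hom inv_yg_class)
  qed
qed

text \<open>
  The trace polynomials are in the variable \<open>d z\<close>, so the trace itself arises by substituting \<open>d z\<close> for the inner variable.
\<close>

lemma poly_yh_trace_braid:
  assumes d: "d \<ge> 1" and \<beta>: "\<beta> \<in> braid_words n"
  shows "poly (yh_trace d q n (yh_braid d q n \<beta>)) z =
    eval2 (braid_trace_poly d n [] \<beta>) (q - inverse q) (of_nat d * z)"
proof -
  \<comment> \<open>from a polynomial in \<open>d z\<close> to one in \<open>z\<close>\<close>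
  define g where "g n w = pcompose (poly (trace_poly d n w) [:q - inverse q:]) [:0, of_nat d:]" for n w
  have g: "poly (g n w) z = eval2 (trace_poly d n w) (q - inverse q) (of_nat d * z)" for n w z
    by (simp add: g_def eval2_def poly_pcompose mult.commute)
  have "word_trace d ((q - inverse q) / of_nat d) z (\<lambda>n w. poly (g n w) z)" for z
    unfolding g using word_trace_trace_poly[OF d, of "q - inverse q" "of_nat d * z"] d by simp
  moreover have "g 0 [] = 1" by (simp add: g_def trace_poly_empty[OF d] pcompose_1)
  ultimately have "yh_trace d q n (yh_braid d q n \<beta>) = linear_ext_poly (g n) (braid_elem d q \<beta>)"
    unfolding yh_braid_eq[OF \<beta>] by (intro yh_trace_eq d braid_elem_closed \<beta>)
  then have "poly (yh_trace d q n (yh_braid d q n \<beta>)) z = linear_ext (\<lambda>w. poly (g n w) z) (wmono [] * braid_elem d q \<beta>)"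
    by (simp add: poly_linear_ext_poly flip: one_eq_wmono)
  then show ?thesis unfolding linear_ext_braid_elem g eval2_braid_trace_poly .
qed

fun braid_gen_op :: "complex \<Rightarrow> braid_gen \<Rightarrow> (state \<Rightarrow> complex) \<Rightarrow> state \<Rightarrow> complex" where
  "braid_gen_op q (Sigma i) = Rop q i"
| "braid_gen_op q (SigmaInv i) = Rinv q i"

definition braid_op :: "complex \<Rightarrow> braid_gen list \<Rightarrow> (state \<Rightarrow> complex) \<Rightarrow> state \<Rightarrow> complex" where
  "braid_op q \<beta> = foldr (braid_gen_op q) \<beta>"

lemma braid_op_simps [simp]:
  "braid_op q [] = id" "braid_op q (x # \<beta>) = braid_gen_op q x \<circ> braid_op q \<beta>"
  by (auto simp: braid_op_def)

lemma braid_expand_state_trace: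
  assumes q: "q \<noteq> 0" and d: "d \<ge> 1"
  shows "\<beta> \<in> braid_words n \<Longrightarrow> u \<in> lists (yh_gens n) \<Longrightarrow>
    braid_expand d ((q - inverse q) / of_nat d) (state_trace d q N n) u \<beta> =
      op_trace (states d N n) (weight d q N n) (word_op d q u \<circ> braid_op q \<beta>)"
proof (induction \<beta> arbitrary: u)
  case Nil
  then show ?case by (simp add: state_trace_def)
next
  case (Cons x \<beta>)
  show ?case
  proof (cases x)
    case (Sigma i)
    then show ?thesis using Cons(1)[of "u @ [G i]"] Cons(2,3) by (simp add: comp_assoc)
  next
    case (SigmaInv i)
    let ?c = "(q - inverse q) / of_nat d"
    let ?e = "\<lambda>s. replicate s (T i) @ replicate (d - s) (T (Suc i))"
    have i: "i \<in> {1..<n}" and \<beta>: "\<beta> \<in> braid_words n" using Cons(2) SigmaInv by auto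
    note U = sym_op_word_op[OF Cons(3), of d q]
    have inv: "Rinv q i \<phi> s = Rop q i \<phi> s + (- ?c) * (\<Sum>t<d. word_op d q (?e t) \<phi> s)"
      if s: "s \<in> states d N n" for \<phi> s
    proof -
      have "s i \<in> {..<d} \<times> {..<N}" "s (Suc i) \<in> {..<d} \<times> {..<N}"
        using s i unfolding states_def by (auto simp: PiE_iff)
      then have "fst (s i) < d" "fst (s (Suc i)) < d" by auto
      from word_op_color_projector[OF d this, where q = q] show ?thesis
        using d by (simp add: Rinv_eq[OF q] del: word_op_simps(3))
    qed
    have "word_op d q u (Rinv q i \<phi>) s = word_op d q (u @ [G i]) \<phi> s -
       ?c * (\<Sum>t<d. word_op d q (u @ ?e t) \<phi> s)" if s: "s \<in> states d N n" for \<phi> s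
    proof -
      have "word_op d q u (Rinv q i \<phi>) s =
          word_op d q u (\<lambda>s. Rop q i \<phi> s + (- ?c) * (\<Sum>t<d. word_op d q (?e t) \<phi> s)) s"
        by (rule sym_op_cong[OF U swp_states inv s])
      also have "\<dots> = word_op d q u (Rop q i \<phi>) s + (- ?c) * (\<Sum>t<d. word_op d q u (word_op d q (?e t) \<phi>) s)"
        by (simp only: sym_op_add[OF U] sym_op_scale[OF U] sym_op_sum[OF U finite_lessThan])
      finally show ?thesis by simp
    qed
    then have "op_trace (states d N n) (weight d q N n) (word_op d q u \<circ> braid_op q (x # \<beta>)) =
      (\<Sum>s\<in>states d N n. weight d q N n s * ((word_op d q (u @ [G i]) \<circ> braid_op q \<beta>) (delta s) s -
         ?c * (\<Sum>t<d. (word_op d q (u @ ?e t) \<circ> braid_op q \<beta>) (delta s) s)))"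
      unfolding op_trace_def SigmaInv by (intro sum.cong HOL.refl) (simp only: braid_op_simps braid_gen_op.simps comp_apply)
    also have "\<dots> = op_trace (states d N n) (weight d q N n) (word_op d q (u @ [G i]) \<circ> braid_op q \<beta>) -
       ?c * (\<Sum>t<d. op_trace (states d N n) (weight d q N n) (word_op d q (u @ ?e t) \<circ> braid_op q \<beta>))"
      unfolding op_trace_def
      by (subst sum.swap) (simp add: right_diff_distrib sum_subtractf sum_distrib_left mult_ac del: word_op_simps)
    also have "\<dots> = braid_expand d ?c (state_trace d q N n) u (x # \<beta>)"
      using Cons(1)[OF \<beta>] Cons(3) i SigmaInv by (simp add: comp_def)
    finally show ?thesis by (rule HOL.sym)
  qed
qed

lemma eval2_braid_sample:
  assumes d: "d \<ge> 1" and \<beta>: "\<beta> \<in> braid_words n"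
  shows "eval2 (braid_trace_poly d n [] \<beta>) (sample_h k) (sample_z k m) =
    op_trace (states d (Suc m) n) (weight d (sample_q k) (Suc m) n) (braid_op (sample_q k) \<beta>)"
proof -
  have cong: "braid_expand d c f u \<beta> = braid_expand d c g u \<beta>"
    if "\<And>w. w \<in> lists (yh_gens n) \<Longrightarrow> f w = g w" "u \<in> lists (yh_gens n)" for c f g u
    using \<beta> that(2)
  proof (induction \<beta> arbitrary: u)
    case (Cons x \<beta>)
    then show ?case by (cases x) auto
  qed (simp add: that(1))
  have "eval2 (braid_trace_poly d n [] \<beta>) (sample_h k) (sample_z k m) =
      braid_expand d (sample_h k / of_nat d) (state_trace d (sample_q k) (Suc m) n) [] \<beta>"
    unfolding eval2_braid_trace_poly by (intro cong eval2_trace_poly[OF d]) simp_all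
  then show ?thesis
    using braid_expand_state_trace[OF sample_q_nonzero d \<beta>, of "[]" k "Suc m"] by (simp add: sample_h_def)
qed


section \<open>Sums over colorings of the strands\<close>

text \<open>
  Transports a coloring of the strands through the braid.
\<close>

fun twist :: "braid_gen list \<Rightarrow> (nat \<Rightarrow> 'a) \<Rightarrow> nat \<Rightarrow> 'a" where
  "twist [] \<gamma> = \<gamma>"
| "twist (x # \<beta>) \<gamma> = swp (braid_idx x) (twist \<beta> \<gamma>)"

definition invariant_coloring :: "nat \<Rightarrow> braid_gen list \<Rightarrow> (nat \<Rightarrow> 'a) \<Rightarrow> bool" where
  "invariant_coloring n \<beta> \<gamma> \<longleftrightarrow> (\<forall>j\<in>{1..n}. twist \<beta> \<gamma> j = \<gamma> j)"

lemma twist_cong: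
  assumes "\<beta> \<in> braid_words n" "\<And>j. j \<in> {1..n} \<Longrightarrow> \<gamma> j = \<gamma>' j" "j \<in> {1..n}"
  shows "twist \<beta> \<gamma> j = twist \<beta> \<gamma>' j"
  using assms(1,3)
proof (induction \<beta> arbitrary: j)
  case (Cons x \<beta>)
  then have "Transposition.transpose (braid_idx x) (Suc (braid_idx x)) j \<in> {1..n}"
    by (intro transpose_range) auto
  then show ?case using Cons by (simp add: swp_def)
qed (simp add: assms(2))

text \<open>
  Where an operator acts diagonally between different positions, their colors agree, so the flip would not change the
  coloring either.
\<close>

lemma braid_op_support:
  assumes "\<And>r. \<psi> r \<noteq> 0 \<Longrightarrow> fst \<circ> r = \<gamma>" "braid_op q \<beta> \<psi> s \<noteq> 0"
  shows "fst \<circ> s = twist \<beta> \<gamma>"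
  using assms(2)
proof (induction \<beta> arbitrary: s)
  case Nil
  then show ?case using assms(1) by simp
next
  case (Cons x \<beta>)
  let ?i = "braid_idx x" and ?\<phi> = "braid_op q \<beta> \<psi>"
  consider "?\<phi> (swp ?i s) \<noteq> 0" | "?\<phi> s \<noteq> 0" "fst (s ?i) = fst (s (Suc ?i))"
    using Cons(2) by (cases x; cases "?\<phi> (swp ?i s) = 0") (auto simp: Rop_def Rinv_def split: if_splits)
  then show ?case
  proof cases
    case 1
    have "swp ?i (fst \<circ> swp ?i s) = fst \<circ> s" by (simp add: swp_def comp_assoc)
    then show ?thesis using Cons(1)[OF 1] by simp
  next
    case 2
    have "swp ?i (fst \<circ> s) = fst \<circ> s" using 2 by (intro swp_same) simp
    then show ?thesis using Cons(1)[OF 2(1)] by simp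
  qed
qed

definition labelled :: "nat \<Rightarrow> (nat \<Rightarrow> nat) \<Rightarrow> (nat \<Rightarrow> nat) \<Rightarrow> state" where
  "labelled n \<gamma> l = restrict (\<lambda>j. (\<gamma> j, l j)) {1..n}"

text \<open>
  The part of the state sum with fixed coloring, without the factor \<open>d\<^sup>-\<^sup>n\<close>. The number of colors does not occur in it.
\<close>

definition coloring_trace :: "complex \<Rightarrow> nat \<Rightarrow> nat \<Rightarrow> braid_gen list \<Rightarrow> (nat \<Rightarrow> nat) \<Rightarrow> complex" where
  "coloring_trace q N n \<beta> \<gamma> = (\<Sum>l\<in>PiE {1..n} (\<lambda>_. {..<N}). (\<Prod>j\<in>{1..n}. label_weight q N (l j)) *
     braid_op q \<beta> (delta (labelled n \<gamma> l)) (labelled n \<gamma> l))"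

lemma coloring_trace_cong:
  "(\<And>j. j \<in> {1..n} \<Longrightarrow> \<gamma> j = \<gamma>' j) \<Longrightarrow> coloring_trace q N n \<beta> \<gamma> = coloring_trace q N n \<beta> \<gamma>'"
proof -
  assume "\<And>j. j \<in> {1..n} \<Longrightarrow> \<gamma> j = \<gamma>' j"
  then have "labelled n \<gamma> = labelled n \<gamma>'" by (auto simp: labelled_def fun_eq_iff)
  then show ?thesis by (simp add: coloring_trace_def)
qed

lemma op_trace_eq_coloring_sum:
  assumes "d \<ge> 1"
  shows "of_nat d ^ n * op_trace (states d N n) (weight d q N n) (braid_op q \<beta>) =
    (\<Sum>\<gamma>\<in>PiE {1..n} (\<lambda>_. {..<d}). coloring_trace q N n \<beta> \<gamma>)"
proof -
  let ?L = "PiE {1..n} (\<lambda>_. {..<N})" and ?X = "PiE {1..n} (\<lambda>_. {..<d})"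
  let ?D = "\<lambda>s. braid_op q \<beta> (delta s) s"
  have "of_nat d ^ n * weight d q N n s = (\<Prod>j\<in>{1..n}. label_weight q N (snd (s j)))" for s
    using assms by (simp add: weight_def prod_dividef)
  then have "of_nat d ^ n * op_trace (states d N n) (weight d q N n) (braid_op q \<beta>) =
     (\<Sum>s\<in>states d N n. (\<Prod>j\<in>{1..n}. label_weight q N (snd (s j))) * ?D s)"
    unfolding op_trace_def by (simp add: sum_distrib_left flip: mult.assoc)
  also have "\<dots> = (\<Sum>(\<gamma>, l)\<in>?X \<times> ?L. (\<Prod>j\<in>{1..n}. label_weight q N (l j)) * ?D (labelled n \<gamma> l))"
  proof (rule sum.reindex_bij_witness[where j = "\<lambda>s. (restrict (fst \<circ> s) {1..n}, restrict (snd \<circ> s) {1..n})"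
        and i = "\<lambda>(\<gamma>, l). labelled n \<gamma> l"])
    fix s assume s: "s \<in> states d N n"
    have s': "s j \<in> {..<d} \<times> {..<N}" if "j \<in> {1..n}" for j
      using PiE_mem[OF s[unfolded states_def] that] .
    show 1: "(case (restrict (fst \<circ> s) {1..n}, restrict (snd \<circ> s) {1..n}) of (\<gamma>, l) \<Rightarrow> labelled n \<gamma> l) = s"
    proof
      fix j
      show "(case (restrict (fst \<circ> s) {1..n}, restrict (snd \<circ> s) {1..n}) of (\<gamma>, l) \<Rightarrow> labelled n \<gamma> l) j = s j"
      proof (cases "j \<in> {1..n}")
        case False
        then show ?thesis using PiE_arb[OF s[unfolded states_def] False] by (simp only: labelled_def restrict_def prod.case if_False)
      qed (simp add: labelled_def)
    qed
    show "(restrict (fst \<circ> s) {1..n}, restrict (snd \<circ> s) {1..n}) \<in> ?X \<times> ?L"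
      using s' by (auto simp: PiE_iff mem_Times_iff)
    show "(case (restrict (fst \<circ> s) {1..n}, restrict (snd \<circ> s) {1..n}) of (\<gamma>, l) \<Rightarrow>
        (\<Prod>j\<in>{1..n}. label_weight q N (l j)) * ?D (labelled n \<gamma> l)) =
        (\<Prod>j\<in>{1..n}. label_weight q N (snd (s j))) * ?D s"
      using 1 by simp
  next
    fix p assume p: "p \<in> ?X \<times> ?L"
    obtain \<gamma> l where p': "p = (\<gamma>, l)" "\<gamma> \<in> ?X" "l \<in> ?L" using p by auto
    have "restrict (fst \<circ> labelled n \<gamma> l) {1..n} = restrict \<gamma> {1..n}"
        "restrict (snd \<circ> labelled n \<gamma> l) {1..n} = restrict l {1..n}"
      by (simp_all add: labelled_def cong: restrict_cong)
    then have "restrict (fst \<circ> labelled n \<gamma> l) {1..n} = \<gamma>" "restrict (snd \<circ> labelled n \<gamma> l) {1..n} = l"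
      using PiE_restrict[OF p'(2)] PiE_restrict[OF p'(3)] by simp_all
    then show "(restrict (fst \<circ> (case p of (\<gamma>, l) \<Rightarrow> labelled n \<gamma> l)) {1..n},
        restrict (snd \<circ> (case p of (\<gamma>, l) \<Rightarrow> labelled n \<gamma> l)) {1..n}) = p"
      using p' by simp
    show "(case p of (\<gamma>, l) \<Rightarrow> labelled n \<gamma> l) \<in> states d N n"
      using p' unfolding states_def labelled_def by (auto simp: PiE_iff)
  qed
  also have "\<dots> = (\<Sum>\<gamma>\<in>?X. coloring_trace q N n \<beta> \<gamma>)"
    unfolding coloring_trace_def by (rule sum.cartesian_product[symmetric])
  finally show ?thesis .
qed

lemma coloring_trace_zero:
  assumes "\<beta> \<in> braid_words n" "\<not> invariant_coloring n \<beta> \<gamma>"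
  shows "coloring_trace q N n \<beta> \<gamma> = 0"
proof -
  have "braid_op q \<beta> (delta s) s = 0" if s: "s = labelled n \<gamma> l" for s l
  proof (rule ccontr)
    assume "braid_op q \<beta> (delta s) s \<noteq> 0"
    then have tw: "fst \<circ> s = twist \<beta> (fst \<circ> s)"
      by (rule braid_op_support[rotated]) (simp add: delta_def split: if_splits)
    have \<gamma>: "(fst \<circ> s) j = \<gamma> j" if "j \<in> {1..n}" for j using that by (simp add: s labelled_def)
    have "twist \<beta> \<gamma> j = \<gamma> j" if "j \<in> {1..n}" for j
      using twist_cong[OF assms(1) \<gamma> that, symmetric] fun_cong[OF tw, of j] \<gamma>[OF that] by (simp only:)
    then show False using assms(2) unfolding invariant_coloring_def by blast
  qed
  then show ?thesis by (simp add: coloring_trace_def)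
qed

text \<open>
  Renaming colors commutes with the operators because they only compare colors for equality.
\<close>

lemma coloring_trace_rename:
  assumes \<beta>: "\<beta> \<in> braid_words n" and f: "inj f"
  shows "coloring_trace q N n \<beta> (f \<circ> \<gamma>) = coloring_trace q N n \<beta> \<gamma>"
proof -
  define m :: "state \<Rightarrow> state" where
    "m s = (\<lambda>j. if j \<in> {1..n} then (f (fst (s j)), snd (s j)) else s j)" for s
  have inj: "inj m"
  proof
    fix s r assume eq: "m s = m r"
    have "s j = r j" for j
      using fun_cong[OF eq, of j] by (simp add: m_def prod_eq_iff inj_eq[OF f] split: if_splits)
    then show "s = r" by blast
  qed
  have swp_m: "swp i (m s) = m (swp i s)" if "i \<in> {1..<n}" for i s
  proof
    fix j show "swp i (m s) j = m (swp i s) j"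
      using that by (cases "j = i"; cases "j = Suc i") (simp_all add: m_def)
  qed
  have m_iff: "m s i = m s (Suc i) \<longleftrightarrow> s i = s (Suc i)" "fst (m s i) = fst (m s (Suc i)) \<longleftrightarrow> fst (s i) = fst (s (Suc i))"
    "snd (m s i) = snd (s i)" "snd (m s (Suc i)) = snd (s (Suc i))" if "i \<in> {1..<n}" for i s
    using that f by (auto simp: m_def inj_eq prod_eq_iff)
  have op: "braid_op q \<beta> \<psi> (m s) = braid_op q \<beta> (\<psi> \<circ> m) s" for \<psi> s
    using \<beta>
  proof (induction \<beta> arbitrary: s)
    case (Cons x \<beta>)
    then have i: "braid_idx x \<in> {1..<n}" and "\<beta> \<in> braid_words n" by simp_all
    note IH = Cons.IH[OF this(2)]
    show ?case
      using i by (cases x) (simp_all only: braid_op_simps comp_apply braid_gen_op.simps Rop_def Rinv_def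
        braid_idx.simps m_iff swp_m IH)
  qed simp
  have "braid_op q \<beta> (delta (m s)) (m s) = braid_op q \<beta> (delta s) s" for s
  proof -
    have "delta (m s) \<circ> m = delta s" by (rule ext) (simp add: delta_def inj_eq[OF inj])
    then show ?thesis using op by simp
  qed
  moreover have "labelled n (f \<circ> \<gamma>) l = m (labelled n \<gamma> l)" for l
    by (auto simp: labelled_def m_def fun_eq_iff)
  ultimately show ?thesis by (simp add: coloring_trace_def)
qed

text \<open>
  Invariant colorings are those that are constant on the cycles of the permutation of the braid. If they are
  determined by one color on \<open>A\<close> and one on its complement, there are at most two cycles. This form is what the coloring
  sum needs and what connectedness provides, and it avoids the permutation itself.
\<close>

definition at_most_two_cycles :: "nat \<Rightarrow> braid_gen list \<Rightarrow> bool" where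
  "at_most_two_cycles n \<beta> \<longleftrightarrow> (\<exists>A. \<forall>\<gamma> :: nat \<Rightarrow> nat. invariant_coloring n \<beta> \<gamma> \<longrightarrow>
     (\<forall>i\<in>{1..n}. \<forall>j\<in>{1..n}. (i \<in> A \<longleftrightarrow> j \<in> A) \<longrightarrow> \<gamma> i = \<gamma> j))"

text \<open>
  Only invariant colorings contribute, and after renaming they are the coloring by \<open>0\<close> alone or the
  coloring by \<open>0\<close> on \<open>A\<close> and \<open>1\<close> elsewhere. If \<open>A\<close> or its complement contains no strand, then all invariant colorings use
  one color and \<open>b = 0\<close>.
\<close>

lemma coloring_sum_two_cycles:
  assumes n: "n \<ge> 1" and \<beta>: "\<beta> \<in> braid_words n" and "at_most_two_cycles n \<beta>"
  shows "\<exists>a b. \<forall>d. (\<Sum>\<gamma>\<in>PiE {1..n} (\<lambda>_. {..<d}). coloring_trace q N n \<beta> \<gamma>) =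
    of_nat d * a + of_nat d * (of_nat d - 1) * b"
proof -
  let ?t = "coloring_trace q N n \<beta>"
  obtain A where A': "\<forall>\<gamma> :: nat \<Rightarrow> nat. invariant_coloring n \<beta> \<gamma> \<longrightarrow>
     (\<forall>i\<in>{1..n}. \<forall>j\<in>{1..n}. (i \<in> A \<longleftrightarrow> j \<in> A) \<longrightarrow> \<gamma> i = \<gamma> j)"
    using assms(3) unfolding at_most_two_cycles_def by (elim exE)
  have A: "\<gamma> i = \<gamma> j" if "invariant_coloring n \<beta> \<gamma>" "i \<in> {1..n}" "j \<in> {1..n}" "i \<in> A \<longleftrightarrow> j \<in> A"
    for \<gamma> :: "nat \<Rightarrow> nat" and i j
    using A'[rule_format, OF that] .
  have supp: "?t \<gamma> = 0" if "i \<in> {1..n}" "j \<in> {1..n}" "i \<in> A \<longleftrightarrow> j \<in> A" "\<gamma> i \<noteq> \<gamma> j" for \<gamma> i j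
  proof (rule coloring_trace_zero[OF \<beta>], rule notI)
    assume "invariant_coloring n \<beta> \<gamma>"
    from A[OF this that(1,2,3)] that(4) show False by simp
  qed
  have const: "?t (\<lambda>_. c) = ?t (\<lambda>_. 0)" for c
    using coloring_trace_rename[OF \<beta>, of "\<lambda>x. x + c" q N "\<lambda>_. 0"] by (simp add: comp_def inj_def)
  have restr: "?t (restrict \<gamma> {1..n}) = ?t \<gamma>" for \<gamma> by (rule coloring_trace_cong) simp
  show ?thesis
  proof (cases "\<exists>i\<in>{1..n}. \<exists>j\<in>{1..n}. i \<in> A \<and> j \<notin> A")
    case False
    have "(\<Sum>\<gamma>\<in>PiE {1..n} (\<lambda>_. {..<d}). ?t \<gamma>) = of_nat d * ?t (\<lambda>_. 0)" for d
    proof -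
      let ?c = "\<lambda>c. restrict (\<lambda>_. c) {1..n}"
      have "(\<Sum>\<gamma>\<in>PiE {1..n} (\<lambda>_. {..<d}). ?t \<gamma>) = (\<Sum>\<gamma>\<in>?c ` {..<d}. ?t \<gamma>)"
      proof (rule sum.mono_neutral_right)
        show "\<forall>\<gamma>\<in>PiE {1..n} (\<lambda>_. {..<d}) - ?c ` {..<d}. ?t \<gamma> = 0"
        proof
          fix \<gamma> assume \<gamma>: "\<gamma> \<in> PiE {1..n} (\<lambda>_. {..<d}) - ?c ` {..<d}"
          have "\<gamma> 1 < d" using PiE_mem[of \<gamma> "{1..n}" _ 1] n \<gamma> by auto
          then have "?c (\<gamma> 1) \<in> ?c ` {..<d}" by (intro imageI) simp
          then have "\<gamma> \<noteq> ?c (\<gamma> 1)" using \<gamma> by (metis DiffD2)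
          then obtain j where j: "\<gamma> j \<noteq> ?c (\<gamma> 1) j" by blast
          have jn: "j \<in> {1..n}"
          proof (rule ccontr)
            assume "j \<notin> {1..n}"
            moreover have "\<gamma> \<in> PiE {1..n} (\<lambda>_. {..<d})" using \<gamma> by blast
            ultimately have "\<gamma> j = undefined" using PiE_arb by metis
            with \<open>j \<notin> {1..n}\<close> j show False by auto
          qed
          have 1: "1 \<in> {1..n}" using n by simp
          have "j \<in> A \<longleftrightarrow> 1 \<in> A" using False jn 1 by blast
          moreover have "\<gamma> j \<noteq> \<gamma> 1" using j jn by simp
          ultimately show "?t \<gamma> = 0" using supp[OF jn 1] by blast
        qed
      qed (auto intro!: finite_PiE)
      also have "\<dots> = (\<Sum>c<d. ?t (?c c))"
      proof (intro sum.reindex[unfolded comp_def] inj_onI)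
        fix c c' assume "?c c = ?c c'"
        from fun_cong[OF this, of 1] show "c = c'" using n by simp
      qed
      also have "\<dots> = (\<Sum>c<d. ?t (\<lambda>_. 0))"
        by (intro sum.cong HOL.refl HOL.trans[OF restr const])
      finally show ?thesis by simp
    qed
    then show ?thesis by (intro exI[of _ "?t (\<lambda>_. 0)"] exI[of _ 0]) simp
  next
    case True
    then obtain i0 j0 where ij: "i0 \<in> {1..n}" "i0 \<in> A" "j0 \<in> {1..n}" "j0 \<notin> A" by blast
    define two :: "nat \<times> nat \<Rightarrow> nat \<Rightarrow> nat" where "two p j = (if j \<in> A then fst p else snd p)" for p j
    let ?c = "\<lambda>p. restrict (two p) {1..n}"
    have neq: "?t (two (c, c')) = ?t (two (0, 1))" if "c \<noteq> c'" for c c'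
    proof -
      \<comment> \<open>an injective renaming that sends \<open>0\<close> to \<open>c\<close> and \<open>1\<close> to \<open>c'\<close>\<close>
      let ?f = "\<lambda>x. if x = 0 then c else if x = 1 then c' else x + c + c'"
      have "inj ?f" using that by (auto simp: inj_def)
      moreover have "two (c, c') = ?f \<circ> two (0, 1)" by (auto simp: two_def fun_eq_iff)
      ultimately show ?thesis using coloring_trace_rename[OF \<beta>] by metis
    qed
    have eq: "?t (two (c, c)) = ?t (\<lambda>_. 0)" for c
    proof -
      have "two (c, c) = (\<lambda>_. c)" by (simp add: two_def fun_eq_iff)
      then show ?thesis using const[of c] by metis
    qed
    have "(\<Sum>\<gamma>\<in>PiE {1..n} (\<lambda>_. {..<d}). ?t \<gamma>) =
        of_nat d * ?t (\<lambda>_. 0) + of_nat d * (of_nat d - 1) * ?t (two (0, 1))" for d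
    proof -
      have "(\<Sum>\<gamma>\<in>PiE {1..n} (\<lambda>_. {..<d}). ?t \<gamma>) = (\<Sum>\<gamma>\<in>?c ` ({..<d} \<times> {..<d}). ?t \<gamma>)"
      proof (rule sum.mono_neutral_right)
        show "\<forall>\<gamma>\<in>PiE {1..n} (\<lambda>_. {..<d}) - ?c ` ({..<d} \<times> {..<d}). ?t \<gamma> = 0"
        proof
          fix \<gamma> assume \<gamma>: "\<gamma> \<in> PiE {1..n} (\<lambda>_. {..<d}) - ?c ` ({..<d} \<times> {..<d})"
          have "\<gamma> i0 < d" "\<gamma> j0 < d" using PiE_mem[of \<gamma> "{1..n}" "\<lambda>_. {..<d}"] ij \<gamma> by auto
          then have "?c (\<gamma> i0, \<gamma> j0) \<in> ?c ` ({..<d} \<times> {..<d})" by (intro imageI) simp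
          then have "\<gamma> \<noteq> ?c (\<gamma> i0, \<gamma> j0)" using \<gamma> by (metis DiffD2)
          then obtain j where j: "\<gamma> j \<noteq> ?c (\<gamma> i0, \<gamma> j0) j" by blast
          have jn: "j \<in> {1..n}"
          proof (rule ccontr)
            assume "j \<notin> {1..n}"
            moreover have "\<gamma> \<in> PiE {1..n} (\<lambda>_. {..<d})" using \<gamma> by blast
            ultimately have "\<gamma> j = undefined" using PiE_arb by metis
            with \<open>j \<notin> {1..n}\<close> j show False by auto
          qed
          show "?t \<gamma> = 0"
          proof (cases "j \<in> A")
            case True
            then have "\<gamma> j \<noteq> \<gamma> i0" using j jn by (simp add: two_def)
            then show ?thesis using supp[OF jn ij(1)] True ij by blast
          next
            case False
            then have "\<gamma> j \<noteq> \<gamma> j0" using j jn by (simp add: two_def)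
            then show ?thesis using supp[OF jn ij(3)] False ij by blast
          qed
        qed
      qed (auto intro!: finite_PiE simp: two_def)
      also have "\<dots> = (\<Sum>p\<in>{..<d} \<times> {..<d}. ?t (?c p))"
      proof (intro sum.reindex[unfolded comp_def] inj_onI)
        fix p p' assume "?c p = ?c p'"
        from fun_cong[OF this, of i0] fun_cong[OF this, of j0] show "p = p'"
          using ij by (simp add: two_def prod_eq_iff)
      qed
      also have "\<dots> = (\<Sum>c<d. \<Sum>c'<d. ?t (two (c, c')))"
        unfolding restr by (simp add: sum.cartesian_product')
      also have "\<dots> = (\<Sum>c<d. \<Sum>c'<d. ?t (two (0, 1)) + (if c' = c then ?t (\<lambda>_. 0) - ?t (two (0, 1)) else 0))"
      proof (intro sum.cong HOL.refl)
        fix c c'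
        show "?t (two (c, c')) = ?t (two (0, 1)) + (if c' = c then ?t (\<lambda>_. 0) - ?t (two (0, 1)) else 0)"
        proof (cases "c = c'")
          case True
          then show ?thesis using eq[of c] by simp
        next
          case False
          from neq[OF this] show ?thesis using False by simp
        qed
      qed
      also have "\<dots> = of_nat d * (of_nat d * ?t (two (0, 1)) + (?t (\<lambda>_. 0) - ?t (two (0, 1))))"
        by (simp add: sum.distrib sum.delta)
      finally show ?thesis by (simp add: algebra_simps)
    qed
    then show ?thesis by blast
  qed
qed

lemma eval2_of_nat [simp]: "eval2 (of_nat k) h z = of_nat k"
  by (induction k) simp_all

lemma eval2_power [simp]: "eval2 (P ^ k) h z = eval2 P h z ^ k"
  by (induction k) simp_all

text \<open>
  The cases \<open>d = 1\<close> and \<open>d = 2\<close> of the coloring sum determine its two coefficients, which expresses the case of general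
  \<open>d\<close> by these two. The resulting identity holds at the sample points, hence everywhere.
\<close>

lemma trace_relation_two_cycles:
  assumes n: "n \<ge> 1" and \<beta>: "\<beta> \<in> braid_words n" and "at_most_two_cycles n \<beta>" and d: "d \<ge> 1"
  shows "of_nat d ^ (n - 1) * eval2 (braid_trace_poly d n [] \<beta>) h z =
    eval2 (braid_trace_poly 1 n [] \<beta>) h z + (of_nat d - 1) *
      (2 ^ (n - 1) * eval2 (braid_trace_poly 2 n [] \<beta>) h z - eval2 (braid_trace_poly 1 n [] \<beta>) h z)"
proof -
  let ?P = "\<lambda>d. braid_trace_poly d n [] \<beta>"
  have "of_nat d ^ (n - 1) * ?P d = ?P 1 + (of_nat d - 1) * (of_nat 2 ^ (n - 1) * ?P 2 - ?P 1)"
  proof (rule eval2_eqI)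
    fix k m
    let ?V = "\<lambda>d. eval2 (?P d) (sample_h k) (sample_z k m)"
    obtain a b where "\<forall>d. (\<Sum>\<gamma>\<in>PiE {1..n} (\<lambda>_. {..<d}). coloring_trace (sample_q k) (Suc m) n \<beta> \<gamma>) =
        of_nat d * a + of_nat d * (of_nat d - 1) * b"
      using coloring_sum_two_cycles[OF n \<beta> assms(3), of "sample_q k" "Suc m"] by (elim exE)
    note ab = this[rule_format]
    have "of_nat e * (of_nat e ^ (n - 1) * ?V e) = of_nat e * (a + (of_nat e - 1) * b)" if "e \<ge> 1" for e
    proof -
      have "of_nat e ^ n * ?V e = of_nat e * a + of_nat e * (of_nat e - 1) * b"
        unfolding eval2_braid_sample[OF that \<beta>] op_trace_eq_coloring_sum[OF that] ab ..
      moreover have "of_nat e ^ n = of_nat e * (of_nat e ^ (n - 1) :: complex)"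
        using n by (cases n) simp_all
      ultimately show ?thesis by (simp add: algebra_simps)
    qed
    then have V: "of_nat e ^ (n - 1) * ?V e = a + (of_nat e - 1) * b" if "e \<ge> 1" for e
      using that by (metis mult_cancel_left of_nat_eq_0_iff not_one_le_zero)
    show "eval2 (of_nat d ^ (n - 1) * ?P d) (sample_h k) (sample_z k m) =
        eval2 (?P 1 + (of_nat d - 1) * (of_nat 2 ^ (n - 1) * ?P 2 - ?P 1)) (sample_h k) (sample_z k m)"
      using V[OF d] V[of 1] V[of 2] by (simp del: of_nat_numeral) simp
  qed
  from arg_cong[OF this, of "\<lambda>P. eval2 P h z"] show ?thesis by (simp del: of_nat_numeral) simp
qed


section \<open>Components of closed braids\<close>

context
  fixes \<beta> :: "braid_gen list"
begin

abbreviation (input) sectors where "sectors \<equiv> Suc (length \<beta>)"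

definition sector_gen :: "nat \<Rightarrow> braid_gen option" where
  "sector_gen k = (map Some \<beta> @ [None]) ! k"

definition strand_pt :: "nat \<Rightarrow> nat \<Rightarrow> real \<Rightarrow> space3" where
  "strand_pt k j s = (rcis (strand_radius (sector_gen k) j s) (2 * pi * (real k + s) / real sectors),
     strand_height (sector_gen k) j s)"

text \<open>
  A coloring \<open>\<gamma>\<close> of the strands in the last, crossingless sector is carried back through the braid; it closes up around the axis
  when it is invariant.
\<close>

definition sector_coloring :: "(nat \<Rightarrow> nat) \<Rightarrow> nat \<Rightarrow> nat \<Rightarrow> nat" where
  "sector_coloring \<gamma> k = twist (drop k \<beta>) \<gamma>"

definition colored_part :: "nat \<Rightarrow> (nat \<Rightarrow> nat) \<Rightarrow> nat set \<Rightarrow> space3 set" where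
  "colored_part n \<gamma> C =
     (\<Union>k\<in>{..<sectors}. \<Union>j\<in>{j\<in>{1..n}. sector_coloring \<gamma> k j \<in> C}. strand_pt k j ` {0..1})"

lemma closed_braid_eq: "closed_braid n \<beta> = {strand_pt k j s | k j s. k < sectors \<and> j \<in> {1..n} \<and> s \<in> {0..1}}"
  by (simp add: closed_braid_def Let_def strand_pt_def sector_gen_def)

lemma sector_gen_simps:
  "k < length \<beta> \<Longrightarrow> sector_gen k = Some (\<beta> ! k)" "sector_gen (length \<beta>) = None"
  by (simp_all add: sector_gen_def nth_append)

lemma closed_colored_part: "closed (colored_part n \<gamma> C)"
proof -
  have "continuous_on {0..1} (\<lambda>s. strand_height v j s)" for v j
  proof (cases v)
    case (Some x)
    then show ?thesis
      by (cases x; cases "j = braid_idx x"; cases "j = Suc (braid_idx x)")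
        (auto intro!: continuous_intros)
  qed (simp add: continuous_on_const)
  moreover have "continuous_on {0..1} (\<lambda>s. strand_radius v j s)" for v j
    by (cases v) (auto intro!: continuous_intros)
  ultimately have "continuous_on {0..1} (strand_pt k j)" for k j
    unfolding strand_pt_def rcis_def by (intro continuous_intros) auto
  then have "compact (strand_pt k j ` {0..1})" for k j by (intro compact_continuous_image) auto
  then have "closed (strand_pt k j ` {0..1})" for k j by (rule compact_imp_closed)
  then show ?thesis unfolding colored_part_def by (intro closed_UN ballI) auto
qed

lemma colored_part_cover: "closed_braid n \<beta> = colored_part n \<gamma> C \<union> colored_part n \<gamma> (- C)"
  unfolding closed_braid_eq colored_part_def by fast

text \<open>
  The end of a sector is the start of the next one, with the same color, so every point of the closed braid can be
  described with \<open>s < 1\<close>. At the end of the last sector this uses that the coloring is invariant.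
\<close>

lemma strand_pt_normalize:
  assumes \<beta>: "\<beta> \<in> braid_words n" and inv: "invariant_coloring n \<beta> \<gamma>"
    and "k < sectors" "j \<in> {1..n}" "s \<in> {0..1}"
  obtains k' j' s' where "k' < sectors" "j' \<in> {1..n}" "0 \<le> s'" "s' < 1"
    "strand_pt k j s = strand_pt k' j' s'" "sector_coloring \<gamma> k j = sector_coloring \<gamma> k' j'"
proof (cases "s = 1")
  case False
  then show thesis using that[of k j s] assms by simp
next
  case True
  have h0: "strand_height v j 0 = 0" for v j
  proof (cases v)
    case (Some x) then show ?thesis by (cases x) auto
  qed simp
  have h1: "strand_height v j 1 = 0" for v j
  proof (cases v)
    case (Some x) then show ?thesis by (cases x) auto
  qed simp
  have r0: "strand_radius v j 0 = real j" for v j by (cases v) auto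
  show thesis
  proof (cases "k < length \<beta>")
    case k: True
    let ?i = "braid_idx (\<beta> ! k)"
    let ?j = "Transposition.transpose ?i (Suc ?i) j"
    have i: "?i \<in> {1..<n}" using \<beta> k by (auto simp: braid_words_def)
    then have j: "?j \<in> {1..n}" using assms(4) by (intro transpose_range) auto
    have "strand_pt k j 1 = strand_pt (Suc k) ?j 0"
      using k by (simp add: strand_pt_def h0 h1 r0 sector_gen_simps add.commute)
    moreover have "sector_coloring \<gamma> k j = sector_coloring \<gamma> (Suc k) ?j"
      using k by (simp add: sector_coloring_def swp_def flip: Cons_nth_drop_Suc)
    ultimately show thesis using that[of "Suc k" ?j 0] k j True by simp
  next
    case False
    then have k: "k = length \<beta>" using assms(3) by simp
    have "2 * pi * (real (length \<beta>) + 1) / (1 + real (length \<beta>)) = 2 * pi"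
      by (simp add: field_simps)
    then have "strand_pt k j 1 = strand_pt 0 j 0"
      by (simp add: k strand_pt_def h0 h1 r0 sector_gen_simps rcis_def)
    moreover have "sector_coloring \<gamma> k j = sector_coloring \<gamma> 0 j"
      using inv assms(4) by (simp add: k sector_coloring_def invariant_coloring_def)
    ultimately show thesis using that[of 0 j 0] assms(4) True by simp
  qed
qed

lemma rcis_eqD:
  assumes "rcis r a = rcis r' a'" "r > 0" "r' > 0" "0 \<le> a" "a < 2 * pi" "0 \<le> a'" "a' < 2 * pi"
  shows "r = r' \<and> a = a'"
proof -
  have "norm (rcis r a) = norm (rcis r' a')" using assms(1) by simp
  then have "r = r'" using assms by (simp add: norm_mult rcis_def)
  moreover have "Arg2pi (rcis r a) = a" if "r > 0" "0 \<le> a" "a < 2 * pi" for r a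
    by (rule Arg2pi_unique[of r]) (use that in \<open>auto simp: rcis_def cis_conv_exp\<close>)
  ultimately show ?thesis using assms by metis
qed

text \<open>
  Within a sector the radii of two strands agree only in the middle of a crossing, where the bump of one strand
  separates the heights.
\<close>

lemma strands_disjoint:
  assumes v: "\<And>x. v = Some x \<Longrightarrow> braid_idx x \<ge> 1" and s: "0 \<le> s" "s < 1"
    and r: "strand_radius v j s = strand_radius v j' s" and h: "strand_height v j s = strand_height v j' s"
  shows "j = j'"
proof (cases v)
  case None
  then show ?thesis using r by simp
next
  case (Some x)
  define i where "i = braid_idx x"
  define t where "t = Transposition.transpose i (Suc i)"
  have R: "(1 - s) * real j + s * real (t j) = (1 - s) * real j' + s * real (t j')"
    using r Some by (simp add: t_def i_def)
  have t: "t i = Suc i" "t (Suc i) = i" "\<And>j. j \<noteq> i \<Longrightarrow> j \<noteq> Suc i \<Longrightarrow> t j = j"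
    by (simp_all add: t_def)
  have val: "(1 - s) * real i + s * real (t i) = real i + s"
    "(1 - s) * real (Suc i) + s * real (t (Suc i)) = real (Suc i) - s"
    "\<And>j. j \<noteq> i \<Longrightarrow> j \<noteq> Suc i \<Longrightarrow> (1 - s) * real j + s * real (t j) = real j"
    by (simp_all add: t algebra_simps)
  have heights: "strand_height v i (1/2) \<noteq> strand_height v (Suc i) (1/2)"
    using Some by (cases x) (auto simp: i_def)
  have cross: False if "real i + s = real (Suc i) - s" "{j, j'} = {i, Suc i}"
  proof -
    have half: "s = 1/2" using that(1) by simp
    have "strand_height v j (1/2) = strand_height v j' (1/2)" using h unfolding half .
    then show False using heights that(2) by (auto simp: doubleton_eq_iff)
  qed
  have no_nat: "real a \<noteq> real i + s \<and> real a \<noteq> real (Suc i) - s" if "a \<noteq> i" "a \<noteq> Suc i" for a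
  proof -
    have "a < i \<or> a > Suc i" using that by linarith
    then show ?thesis using s by auto
  qed
  show ?thesis
  proof (cases "j = i"; cases "j = Suc i"; cases "j' = i"; cases "j' = Suc i")
  qed (use R val cross no_nat[of j] no_nat[of j'] in \<open>force\<close>)+
qed

text \<open>
  For \<open>s < 1\<close> the angle determines the sector and \<open>s\<close>, and then radius and height determine the strand.
\<close>

lemma colored_parts_disjoint:
  assumes \<beta>: "\<beta> \<in> braid_words n" and inv: "invariant_coloring n \<beta> \<gamma>"
  shows "colored_part n \<gamma> C \<inter> colored_part n \<gamma> (- C) = {}"
proof -
  have idx: "braid_idx x \<in> {1..<n}" if "sector_gen k = Some x" "k < sectors" for k x
  proof -
    have "k < length \<beta>" using that sector_gen_simps by (cases "k = length \<beta>") auto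
    then show ?thesis using that \<beta> by (auto simp: sector_gen_simps braid_words_def)
  qed
  have pos: "strand_radius (sector_gen k) j s > 0" if "k < sectors" "j \<in> {1..n}" "0 \<le> s" "s < 1" for k j s
  proof (cases "sector_gen k")
    case (Some x)
    let ?j = "Transposition.transpose (braid_idx x) (Suc (braid_idx x)) j"
    have "?j \<in> {1..n}" using idx[OF Some that(1)] that(2) by (intro transpose_range) auto
    then have "(1 - s) * real j > 0" "s * real ?j \<ge> 0" using that by auto
    then show ?thesis using Some by simp
  qed (use that in simp)
  have same: "sector_coloring \<gamma> k j = sector_coloring \<gamma> k' j'"
    if "k < sectors" "j \<in> {1..n}" "0 \<le> s" "s < 1" "k' < sectors" "j' \<in> {1..n}" "0 \<le> s'" "s' < 1"
      "strand_pt k j s = strand_pt k' j' s'" for k j s k' j' s'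
  proof -
    have ang: "0 \<le> 2 * pi * (real k + s) / real sectors" "2 * pi * (real k + s) / real sectors < 2 * pi"
      if "k < sectors" "0 \<le> s" "s < 1" for k s
    proof -
      have "real k + s < real sectors" using that by linarith
      then show "2 * pi * (real k + s) / real sectors < 2 * pi" by (simp add: divide_less_eq)
    qed (use that in simp)
    have eq: "strand_radius (sector_gen k) j s = strand_radius (sector_gen k') j' s' \<and>
        2 * pi * (real k + s) / real sectors = 2 * pi * (real k' + s') / real sectors"
      using that by (intro rcis_eqD pos ang) (auto simp: strand_pt_def)
    then have "real k + s = real k' + s'" by simp
    then have "\<bar>real k - real k'\<bar> < 1" using that by linarith
    then have k: "k' = k" by linarith
    then have s: "s' = s" using \<open>real k + s = real k' + s'\<close> by simp
    have "j = j'"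
      using strands_disjoint[of "sector_gen k" s j j'] idx[of k] that eq unfolding k s
      by (auto simp: strand_pt_def)
    then show ?thesis using k by simp
  qed
  have "x \<notin> colored_part n \<gamma> (- C)" if x: "x \<in> colored_part n \<gamma> C" for x
  proof
    assume "x \<in> colored_part n \<gamma> (- C)"
    then obtain k' j' s' where 2: "k' < sectors" "j' \<in> {1..n}" "s' \<in> {0..1}" "x = strand_pt k' j' s'"
        "sector_coloring \<gamma> k' j' \<notin> C"
      unfolding colored_part_def by blast
    obtain k j s where 1: "k < sectors" "j \<in> {1..n}" "s \<in> {0..1}" "x = strand_pt k j s"
        "sector_coloring \<gamma> k j \<in> C"
      using x unfolding colored_part_def by blast
    obtain a b c where n1: "a < sectors" "b \<in> {1..n}" "0 \<le> c" "c < 1" "strand_pt k j s = strand_pt a b c"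
        "sector_coloring \<gamma> k j = sector_coloring \<gamma> a b"
      using strand_pt_normalize[OF \<beta> inv 1(1-3)] by metis
    obtain a' b' c' where n2: "a' < sectors" "b' \<in> {1..n}" "0 \<le> c'" "c' < 1" "strand_pt k' j' s' = strand_pt a' b' c'"
        "sector_coloring \<gamma> k' j' = sector_coloring \<gamma> a' b'"
      using strand_pt_normalize[OF \<beta> inv 2(1-3)] by metis
    have "sector_coloring \<gamma> a b = sector_coloring \<gamma> a' b'"
      using same[OF n1(1-4) n2(1-4)] n1(5) n2(5) 1(4) 2(4) by simp
    then show False using 1(5) 2(5) n1(6) n2(6) by simp
  qed
  then show ?thesis by blast
qed

end

lemma connected_piece_same_color:
  fixes \<gamma> :: "nat \<Rightarrow> nat"
  assumes \<beta>: "\<beta> \<in> braid_words n" and inv: "invariant_coloring n \<beta> \<gamma>"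
    and K: "connected K" "K \<subseteq> closed_braid n \<beta>"
    and ij: "i \<in> {1..n}" "j \<in> {1..n}" "strand_pt \<beta> 0 i 0 \<in> K" "strand_pt \<beta> 0 j 0 \<in> K"
  shows "\<gamma> i = \<gamma> j"
proof (rule ccontr)
  assume neq: "\<gamma> i \<noteq> \<gamma> j"
  let ?X = "colored_part \<beta> n \<gamma>" and ?C = "{\<gamma> i}"
  have col: "sector_coloring \<beta> \<gamma> 0 l = \<gamma> l" if "l \<in> {1..n}" for l
    using inv that by (simp add: sector_coloring_def invariant_coloring_def)
  have mem: "strand_pt \<beta> 0 l 0 \<in> ?X D" if "l \<in> {1..n}" "\<gamma> l \<in> D" for l D
    unfolding colored_part_def using that col[OF that(1)]
    by (intro UN_I[of 0] UN_I[of l] imageI) auto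
  have "?X ?C \<inter> ?X (- ?C) \<inter> K = {}" using colored_parts_disjoint[OF \<beta> inv, of ?C] by simp
  moreover have "K \<subseteq> ?X ?C \<union> ?X (- ?C)" using K(2) colored_part_cover[of n \<beta> \<gamma> ?C] by simp
  ultimately have "?X ?C \<inter> K = {} \<or> ?X (- ?C) \<inter> K = {}"
    using connected_closedD[OF K(1) _ _ closed_colored_part closed_colored_part] by metis
  moreover have "strand_pt \<beta> 0 i 0 \<in> ?X ?C" using mem[OF ij(1)] by simp
  moreover have "strand_pt \<beta> 0 j 0 \<in> ?X (- ?C)" using mem[OF ij(2)] neq by simp
  ultimately show False using ij(3,4) by (metis IntI empty_iff)
qed

text \<open>
  The set \<open>A\<close> consists of the strands that start on the first component. Strands that start on the same component lie in one
  connected set, so invariant colorings agree on them.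
\<close>

lemma two_component_closure:
  assumes L: "oriented_link 2 L" and \<beta>: "\<beta> \<in> braid_words n" and cl: "is_closure_of 2 L n \<beta>"
  shows "n \<ge> 1" and "at_most_two_cycles n \<beta>"
proof -
  obtain H where H: "ambient_isotopy H" "H 1 ` link_image 2 L = closed_braid n \<beta>"
    using cl unfolding is_closure_of_def by blast
  define K where "K i = (\<lambda>u. H 1 (L (i, u))) ` sphere 0 1" for i :: nat
  have img: "closed_braid n \<beta> = K 0 \<union> K 1"
  proof -
    have "{..<2::nat} = {0, 1}" by auto
    then show ?thesis
      unfolding H(2)[symmetric] link_image_def K_def by (auto simp: image_iff)
  qed
  have conn: "connected (K i)" if "i < 2" for i
  proof -
    obtain h where "homeomorphism UNIV UNIV (H 1) h"
      using H(1) unfolding ambient_isotopy_def by force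
    then have "continuous_on UNIV (H 1)" by (rule homeomorphism_cont1)
    moreover have "continuous_on (sphere 0 1) (\<lambda>u. L (i, u))"
      using L that unfolding oriented_link_def by blast
    ultimately have "continuous_on (sphere 0 1) (\<lambda>u. H 1 (L (i, u)))"
      by (rule continuous_on_compose2) auto
    moreover have "connected (sphere (0::complex) 1)" by (rule connected_sphere) simp
    ultimately show ?thesis unfolding K_def by (rule connected_continuous_image)
  qed
  have "K 0 \<noteq> {}" unfolding K_def by auto
  then have "closed_braid n \<beta> \<noteq> {}" using img by blast
  then show "n \<ge> 1" unfolding closed_braid_eq by auto
  define A where "A = {j. strand_pt \<beta> 0 j 0 \<in> K 0}"
  have "\<gamma> i = \<gamma> j" if inv: "invariant_coloring n \<beta> \<gamma>" and ij: "i \<in> {1..n}" "j \<in> {1..n}" "i \<in> A \<longleftrightarrow> j \<in> A"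
    for \<gamma> :: "nat \<Rightarrow> nat" and i j
  proof -
    have base: "strand_pt \<beta> 0 l 0 \<in> K 0 \<union> K 1" if "l \<in> {1..n}" for l
      unfolding img[symmetric] closed_braid_eq using that by force
    have "\<exists>a<2. strand_pt \<beta> 0 i 0 \<in> K a \<and> strand_pt \<beta> 0 j 0 \<in> K a"
    proof (cases "i \<in> A")
      case True
      then show ?thesis using ij(3) unfolding A_def by (intro exI[of _ 0]) simp
    next
      case False
      then show ?thesis using ij(3) base[OF ij(1)] base[OF ij(2)] unfolding A_def
        by (intro exI[of _ 1]) simp
    qed
    then obtain a where a: "a < 2" "strand_pt \<beta> 0 i 0 \<in> K a" "strand_pt \<beta> 0 j 0 \<in> K a" by blast
    have "K a \<subseteq> closed_braid n \<beta>" using a(1) img by (auto simp: less_2_cases_iff)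
    from connected_piece_same_color[OF \<beta> inv conn[OF a(1)] this ij(1,2) a(2,3)] show ?thesis .
  qed
  then show "at_most_two_cycles n \<beta>"
    unfolding at_most_two_cycles_def by (intro exI[of _ A] allI impI ballI)
qed

section \<open>Comparison of the invariants\<close>

text \<open>
  The normalized contribution of the two-colored strands, which is read off from the case \<open>d = 2\<close>.
\<close>

definition mixed_term :: "nat \<Rightarrow> braid_gen list \<Rightarrow> complex \<times> complex \<Rightarrow> complex" where
  "mixed_term n \<beta> = (\<lambda>(q, z). theta_Lambda 1 q z ^ (n - 1) * csqrt (theta_lambda 1 q z) powi exponent_sum \<beta> *
     (2 ^ (n - 1) * eval2 (braid_trace_poly 2 n [] \<beta>) (q - inverse q) z -
        eval2 (braid_trace_poly 1 n [] \<beta>) (q - inverse q) z))"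

lemma theta_lambda_scale: "d \<ge> 1 \<Longrightarrow> theta_lambda d q (z / of_nat d) = theta_lambda 1 q z"
  by (cases "z = 0") (simp_all add: theta_lambda_def field_simps)

lemma theta_Lambda_scale: "d \<ge> 1 \<Longrightarrow> theta_Lambda d q (z / of_nat d) = of_nat d * theta_Lambda 1 q z"
  by (simp add: theta_Lambda_def theta_lambda_scale)

lemma theta_domain_scale: "d \<ge> 1 \<Longrightarrow> (q, z / of_nat d) \<in> theta_domain d \<longleftrightarrow> (q, z) \<in> theta_domain 1"
  by (auto simp: theta_domain_def theta_lambda_scale)

text \<open>
  The factor \<open>d\<^sup>n\<^sup>-\<^sup>1\<close> that \<open>\<Lambda>\<close> produces is the one on the left of \<open>trace_relation_two_cycles\<close>.
\<close>

lemma Theta_decomposition: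
  assumes d: "d \<ge> 1" and n: "n \<ge> 1" and \<beta>: "\<beta> \<in> braid_words n" and two: "at_most_two_cycles n \<beta>"
    and dom: "(q, z) \<in> theta_domain 1"
  shows "Theta d n \<beta> (q, z / of_nat d) = homflypt n \<beta> (q, z) + (of_nat d - 1) * mixed_term n \<beta> (q, z)"
proof -
  let ?V = "\<lambda>d. eval2 (braid_trace_poly d n [] \<beta>) (q - inverse q) z"
  let ?F = "theta_Lambda 1 q z ^ (n - 1) * csqrt (theta_lambda 1 q z) powi exponent_sum \<beta>"
  have "Theta e n \<beta> (q, z / of_nat e) = ?F * (of_nat e ^ (n - 1) * ?V e)" if e: "e \<ge> 1" for e
    using dom e theta_domain_scale[OF e, of q z]
    by (simp add: Theta_def theta_lambda_scale[OF e] theta_Lambda_scale[OF e] poly_yh_trace_braid[OF e \<beta>]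
        power_mult_distrib mult_ac)
  from this[OF d] this[of 1] show ?thesis
    unfolding trace_relation_two_cycles[OF n \<beta> two d]
    by (simp add: homflypt_def mixed_term_def algebra_simps)
qed

lemma Theta_eq_iff_mixed_term:
  assumes d: "d \<ge> 2"
    and 1: "n1 \<ge> 1" "\<beta>1 \<in> braid_words n1" "at_most_two_cycles n1 \<beta>1"
    and 2: "n2 \<ge> 1" "\<beta>2 \<in> braid_words n2" "at_most_two_cycles n2 \<beta>2"
    and P: "homflypt n1 \<beta>1 = homflypt n2 \<beta>2"
  shows "Theta d n1 \<beta>1 = Theta d n2 \<beta>2 \<longleftrightarrow>
    (\<forall>p \<in> theta_domain 1. mixed_term n1 \<beta>1 p = mixed_term n2 \<beta>2 p)"
proof -
  have d1: "d \<ge> 1" and nz: "(of_nat d - 1 :: complex) \<noteq> 0"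
  proof -
    have "(of_nat d :: complex) \<noteq> of_nat 1" using d by (simp only: of_nat_eq_iff)
    then show "(of_nat d - 1 :: complex) \<noteq> 0" by simp
  qed (use d in simp)
  have pt: "Theta d n1 \<beta>1 (q, z / of_nat d) = Theta d n2 \<beta>2 (q, z / of_nat d) \<longleftrightarrow>
      mixed_term n1 \<beta>1 (q, z) = mixed_term n2 \<beta>2 (q, z)" if "(q, z) \<in> theta_domain 1" for q z
    using Theta_decomposition[OF d1 1 that] Theta_decomposition[OF d1 2 that] P nz by simp
  show ?thesis
  proof
    assume "Theta d n1 \<beta>1 = Theta d n2 \<beta>2"
    then show "\<forall>p \<in> theta_domain 1. mixed_term n1 \<beta>1 p = mixed_term n2 \<beta>2 p" using pt by auto
  next
    assume eq: "\<forall>p \<in> theta_domain 1. mixed_term n1 \<beta>1 p = mixed_term n2 \<beta>2 p"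
    show "Theta d n1 \<beta>1 = Theta d n2 \<beta>2"
    proof
      fix p :: "complex \<times> complex"
      obtain q z where p: "p = (q, (of_nat d * z) / of_nat d)" "p = (q, z)" using d by (cases p) simp
      show "Theta d n1 \<beta>1 p = Theta d n2 \<beta>2 p"
      proof (cases "p \<in> theta_domain d")
        case True
        then have "(q, of_nat d * z) \<in> theta_domain 1" using theta_domain_scale[OF d1, of q "of_nat d * z"] p(1) by simp
        then show ?thesis using pt eq unfolding p(1) by blast
      qed (simp add: Theta_def)
    qed
  qed
qed

theorem theorem7p1:
  fixes d d' n1 n2 :: nat
    and L1 L2 :: "nat \<times> complex \<Rightarrow> space3"
    and \<alpha>1 \<alpha>2 :: "braid_gen list"
  assumes "d \<ge> 2" and "d' \<ge> 2"
    and "oriented_link 2 L1" and "oriented_link 2 L2"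
    and "\<alpha>1 \<in> braid_words n1" and "is_closure_of 2 L1 n1 \<alpha>1"
    and "\<alpha>2 \<in> braid_words n2" and "is_closure_of 2 L2 n2 \<alpha>2"
    and "homflypt n1 \<alpha>1 = homflypt n2 \<alpha>2"
  shows "Theta d n1 \<alpha>1 = Theta d n2 \<alpha>2 \<longleftrightarrow> Theta d' n1 \<alpha>1 = Theta d' n2 \<alpha>2"
proof -
  note c1 = two_component_closure[OF assms(3,5,6)]
  note c2 = two_component_closure[OF assms(4,7,8)]
  show ?thesis
    using Theta_eq_iff_mixed_term[OF assms(1) c1(1) assms(5) c1(2) c2(1) assms(7) c2(2) assms(9)]
      Theta_eq_iff_mixed_term[OF assms(2) c1(1) assms(5) c1(2) c2(1) assms(7) c2(2) assms(9)] by simp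
qed

end
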